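(* Let $D$ be a domain in $\mathbb R^n$, $n\ge2$, let $A\subset D$ be a nondegenerate continuum, let $K\subset\overline{\mathbb R^n}$ be compact with $K\ne\overline{\mathbb R^n}$, let $\delta>0$, and let $Q:D\to[0,\infty]$ be Lebesgue measurable satisfying the sphere-integrability condition in $D$. Then: (1) if $D$ is bounded, the family $\mathfrak B^{\delta,K}_{A,Q}(D)$ is equi-uniform (hence uniformly light) and uniformly open on every compact set $K_1\subset D$; (2) if $Q\in L^1(D)$ and $f(x)\ne\infty$ for every $x\in D$ and every $f\in\mathfrak B^{\delta,K}_{A,Q}(D)$, then for every compact $K_1\subset D$ there exist constants $C,C_1>0$ such that $|f(x)-f(y)|\ge C_1\exp\Big\{-\frac{\|Q\|_{L^1(D)}}{C|x-y|^n}\Big\}$ for all $x,y\in K_1$ and every $f\in\mathfrak B^{\delta,K}_{A,Q}(D)$.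
   Context: $\overline{\mathbb R^n}$ carries the chordal metric $h(x,y)=\frac{|x-y|}{\sqrt{1+|x|^2}\sqrt{1+|y|^2}}$, $h(x,\infty)=\frac{1}{\sqrt{1+|x|^2}}$; $h(E)=\sup_{x,y\in E}h(x,y)$; $B_h(y_0,r)=\{y:h(y,y_0)<r\}$; $B(x_0,r)$ Euclidean ball. $S(x_0,r)=\{|x-x_0|=r\}$, $A(x_0,r_1,r_2)=\{r_1<|x-x_0|<r_2\}$. $\Gamma(E,F,G)$: paths $\gamma:[a,b]\to\overline{\mathbb R^n}$ with $\gamma(a)\in E$, $\gamma(b)\in F$, $\gamma(t)\in G$ for $a<t<b$; $M$ = conformal $n$-modulus. Ring $Q$-inequality at $x_0$ for radii in $(0,R)$ (with $Q:=0$ outside $D$): $M(f(\Gamma(S(x_0,r_1),S(x_0,r_2),D)))\le\int_{A(x_0,r_1,r_2)\cap D}Q(x)\eta^n(|x-x_0|)\,dm(x)$ for all $0<r_1<r_2<R$ and all measurable $\eta:(r_1,r_2)\to[0,\infty]$ with $\int_{r_1}^{r_2}\eta\,dr\ge1$. Sphere-integrability condition: for each $x_0\in D$ and every $0<r_1<r_2<\sup_{x\in D}|x-x_0|$ there is $E_1\subset[r_1,r_2]$ of positive linear measure such that $Q$ is $\mathcal H^{n-1}$-integrable over $S(x_0,r)$ for every $r\in E_1$. $\mathfrak B^{\delta,K}_{A,Q}(D)$: all homeomorphisms $f$ of $D$ into $K$ (i.e. $f(D)\subset K$) satisfying the ring $Q$-inequality at every $x_0\in D$ for radii in $(0,\sup_{x\in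 D}|x-x_0|)$ and such that $h(f(A))\ge\delta$. Equi-uniform on $K_1$: for every $\varepsilon>0$ there is $\delta_1>0$ with $h(f(x),f(y))\ge\delta_1$ for all $f$ in the family and all $x,y\in K_1$ with $h(x,y)\ge\varepsilon$. Uniformly light on $K_1$: for every $\varepsilon>0$ there is $\delta_1>0$ with $h(f(C))\ge\delta_1$ for all $f$ and all continua $C\subset K_1$ with $h(C)\ge\varepsilon$. Uniformly open on $K_1$: for every $\varepsilon_0>0$ there is $r_0>0$ with $B_h(f(x_0),r_0)\subset f(B(x_0,\varepsilon_0))$ for every $f$ and every ball $B(x_0,\varepsilon_0)\subset K_1$. *)

theory Defs
  imports "HOL-Analysis.Analysis"
begin

text \<open>The one-point compactification of R^n is modelled by the type 'a option,
  where None plays the role of the point at infinity and Some x the finite point x.\<close>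

definition chordal :: "'a::euclidean_space option \<Rightarrow> 'a option \<Rightarrow> real" where
  "chordal p q = (case (p, q) of
      (Some x, Some y) \<Rightarrow> norm (x - y) / (sqrt (1 + (norm x)\<^sup>2) * sqrt (1 + (norm y)\<^sup>2))
    | (Some x, None) \<Rightarrow> 1 / sqrt (1 + (norm x)\<^sup>2)
    | (None, Some y) \<Rightarrow> 1 / sqrt (1 + (norm y)\<^sup>2)
    | (None, None) \<Rightarrow> 0)"

definition chordal_diam :: "'a::euclidean_space option set \<Rightarrow> real" where
  "chordal_diam E = (SUP p\<in>E. SUP q\<in>E. chordal p q)"

definition chordal_ball :: "'a::euclidean_space option \<Rightarrow> real \<Rightarrow> 'a option set" where
  "chordal_ball y0 r = {y. chordal y y0 < r}"

definition chordal_open :: "'a::euclidean_space option set \<Rightarrow> bool" where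
  "chordal_open U \<longleftrightarrow> (\<forall>y\<in>U. \<exists>r>0. chordal_ball y r \<subseteq> U)"

definition chordal_compact :: "'a::euclidean_space option set \<Rightarrow> bool" where
  "chordal_compact K \<longleftrightarrow>
     (\<forall>\<U>. (\<forall>U\<in>\<U>. chordal_open U) \<and> K \<subseteq> \<Union>\<U> \<longrightarrow> (\<exists>\<V>\<subseteq>\<U>. finite \<V> \<and> K \<subseteq> \<Union>\<V>))"

definition homeomorphism_into :: "'a::euclidean_space set \<Rightarrow> ('a \<Rightarrow> 'a option) \<Rightarrow> bool" where
  "homeomorphism_into D f \<longleftrightarrow> inj_on f D
     \<and> (\<forall>x\<in>D. \<forall>e>0. \<exists>d>0. \<forall>x'\<in>D. dist x' x < d \<longrightarrow> chordal (f x') (f x) < e)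
     \<and> (\<forall>x\<in>D. \<forall>e>0. \<exists>d>0. \<forall>x'\<in>D. chordal (f x') (f x) < d \<longrightarrow> dist x' x < e)"

text \<open>A path in the extended space is a pair (I, g) with I a (parameter) interval
  contained in [0,1] and g defined on I.\<close>

definition path_length :: "(real \<Rightarrow> 'a::euclidean_space) \<Rightarrow> real \<Rightarrow> real \<Rightarrow> ennreal" where
  "path_length p c d = (SUP (k, t) \<in> {(k, t :: nat \<Rightarrow> real). t 0 = c \<and> t k = d \<and> (\<forall>i<k. t i \<le> t (Suc i))}.
       ennreal (\<Sum>i<k. dist (p (t (Suc i))) (p (t i))))"

definition arclen :: "(real \<Rightarrow> 'a::euclidean_space) \<Rightarrow> real \<Rightarrow> real \<Rightarrow> real \<Rightarrow> real" where
  "arclen p c d t = enn2real (path_length p c (max c (min d t)))"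

definition line_int :: "('a::euclidean_space \<Rightarrow> ennreal) \<Rightarrow> (real \<Rightarrow> 'a) \<Rightarrow> real \<Rightarrow> real \<Rightarrow> ennreal" where
  "line_int \<rho> p c d = (\<integral>\<^sup>+ t. \<rho> (p t) * indicator {c..d} t \<partial>interval_measure (arclen p c d))"

definition finite_subint :: "real set \<Rightarrow> (real \<Rightarrow> 'a option) \<Rightarrow> real \<Rightarrow> real \<Rightarrow> bool" where
  "finite_subint I g c d \<longleftrightarrow> c \<le> d \<and> {c..d} \<subseteq> I \<and> (\<forall>t\<in>{c..d}. g t \<noteq> None)"

definition loc_rectifiable :: "real set \<times> (real \<Rightarrow> 'a::euclidean_space option) \<Rightarrow> bool" where
  "loc_rectifiable \<gamma> \<longleftrightarrow> (\<forall>c d. finite_subint (fst \<gamma>) (snd \<gamma>) c d \<longrightarrow>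
       path_length (\<lambda>t. the (snd \<gamma> t)) c d < \<infinity>)"

definition path_int :: "('a::euclidean_space \<Rightarrow> ennreal) \<Rightarrow> real set \<times> (real \<Rightarrow> 'a option) \<Rightarrow> ennreal" where
  "path_int \<rho> \<gamma> = (SUP (c, d) \<in> {(c, d). finite_subint (fst \<gamma>) (snd \<gamma>) c d}.
       line_int \<rho> (\<lambda>t. the (snd \<gamma> t)) c d)"

definition admissible :: "('a::euclidean_space \<Rightarrow> ennreal) \<Rightarrow> (real set \<times> (real \<Rightarrow> 'a option)) set \<Rightarrow> bool" where
  "admissible \<rho> \<Gamma> \<longleftrightarrow> \<rho> \<in> borel_measurable borel \<and>
      (\<forall>\<gamma>\<in>\<Gamma>. loc_rectifiable \<gamma> \<longrightarrow> path_int \<rho> \<gamma> \<ge> 1)"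

definition modulus :: "(real set \<times> (real \<Rightarrow> 'a::euclidean_space option)) set \<Rightarrow> ennreal" where
  "modulus \<Gamma> = (INF \<rho> \<in> {\<rho>. admissible \<rho> \<Gamma>}. \<integral>\<^sup>+ x. (\<rho> x) ^ DIM('a) \<partial>lborel)"

definition path_family :: "'a::euclidean_space set \<Rightarrow> 'a set \<Rightarrow> 'a set \<Rightarrow> (real \<Rightarrow> 'a) set" where
  "path_family E F G = {\<gamma>. continuous_on {0..1} \<gamma> \<and> \<gamma> 0 \<in> E \<and> \<gamma> 1 \<in> F \<and> (\<forall>t\<in>{0<..<1}. \<gamma> t \<in> G)}"

definition image_family :: "('a::euclidean_space \<Rightarrow> 'a option) \<Rightarrow> 'a set \<Rightarrow> (real \<Rightarrow> 'a) set
     \<Rightarrow> (real set \<times> (real \<Rightarrow> 'a option)) set" where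
  "image_family f D \<Gamma> = {({t\<in>{0..1}. \<gamma> t \<in> D}, \<lambda>t. f (\<gamma> t)) | \<gamma>. \<gamma> \<in> \<Gamma>}"

definition sup_dist :: "'a::euclidean_space set \<Rightarrow> 'a \<Rightarrow> ereal" where
  "sup_dist D x0 = (SUP x\<in>D. ereal (dist x x0))"

definition ring_Q_ineq :: "('a::euclidean_space \<Rightarrow> 'a option) \<Rightarrow> 'a set \<Rightarrow> ('a \<Rightarrow> ennreal) \<Rightarrow> 'a \<Rightarrow> ereal \<Rightarrow> bool" where
  "ring_Q_ineq f D Q x0 R \<longleftrightarrow>
     (\<forall>r1 r2 (\<eta> :: real \<Rightarrow> ennreal). 0 < r1 \<and> r1 < r2 \<and> ereal r2 < R \<and> \<eta> \<in> borel_measurable lebesgue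
        \<and> (\<integral>\<^sup>+ r. \<eta> r * indicator {r1<..<r2} r \<partial>lebesgue) \<ge> 1 \<longrightarrow>
        modulus (image_family f D (path_family (sphere x0 r1) (sphere x0 r2) D))
          \<le> (\<integral>\<^sup>+ x. Q x * (\<eta> (dist x x0)) ^ DIM('a) * indicator ({x. r1 < dist x x0 \<and> dist x x0 < r2} \<inter> D) x \<partial>lebesgue))"

text \<open>unnormalised s-dimensional Hausdorff outer measure (normalising constant irrelevant here)\<close>
definition hausdorff_outer :: "nat \<Rightarrow> 'a::euclidean_space set \<Rightarrow> ennreal" where
  "hausdorff_outer s E = (SUP \<delta>\<in>{0<..}. INF C \<in> {C :: nat \<Rightarrow> 'a set. E \<subseteq> (\<Union>i. C i) \<and> (\<forall>i. bounded (C i) \<and> diameter (C i) \<le> \<delta>)}.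
       (\<Sum>i. ennreal (diameter (C i) ^ s)))"

definition hausdorff_measure :: "nat \<Rightarrow> 'a::euclidean_space measure" where
  "hausdorff_measure s = measure_of UNIV (lambda_system UNIV UNIV (hausdorff_outer s)) (hausdorff_outer s)"

definition sphere_integrable :: "'a::euclidean_space set \<Rightarrow> ('a \<Rightarrow> ennreal) \<Rightarrow> bool" where
  "sphere_integrable D Q \<longleftrightarrow>
     (\<forall>x0\<in>D. \<forall>r1 r2. 0 < r1 \<and> r1 < r2 \<and> ereal r2 < sup_dist D x0 \<longrightarrow>
        (\<exists>E1 \<subseteq> {r1..r2}. E1 \<in> sets lebesgue \<and> emeasure lebesgue E1 > 0 \<and>
          (\<forall>r\<in>E1. (\<lambda>x. Q x * indicator (sphere x0 r \<inter> D) x) \<in> borel_measurable (hausdorff_measure (DIM('a) - 1))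
              \<and> (\<integral>\<^sup>+ x. Q x * indicator (sphere x0 r \<inter> D) x \<partial>hausdorff_measure (DIM('a) - 1)) < \<infinity>)))"

definition classB :: "real \<Rightarrow> 'a::euclidean_space option set \<Rightarrow> 'a set \<Rightarrow> ('a \<Rightarrow> ennreal) \<Rightarrow> 'a set
     \<Rightarrow> ('a \<Rightarrow> 'a option) set" where
  "classB \<delta> K A Q D = {f. homeomorphism_into D f \<and> f ` D \<subseteq> K
      \<and> (\<forall>x0\<in>D. ring_Q_ineq f D Q x0 (sup_dist D x0))
      \<and> chordal_diam (f ` A) \<ge> \<delta>}"

definition equi_uniform :: "('a::euclidean_space \<Rightarrow> 'a option) set \<Rightarrow> 'a set \<Rightarrow> bool" where
  "equi_uniform \<F> K1 \<longleftrightarrow> (\<forall>e>0. \<exists>d>0. \<forall>f\<in>\<F>. \<forall>x\<in>K1. \<forall>y\<in>K1.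
      chordal (Some x) (Some y) \<ge> e \<longrightarrow> chordal (f x) (f y) \<ge> d)"

definition uniformly_light :: "('a::euclidean_space \<Rightarrow> 'a option) set \<Rightarrow> 'a set \<Rightarrow> bool" where
  "uniformly_light \<F> K1 \<longleftrightarrow> (\<forall>e>0. \<exists>d>0. \<forall>f\<in>\<F>. \<forall>C. C \<subseteq> K1 \<and> C \<noteq> {} \<and> compact C \<and> connected C
      \<and> chordal_diam (Some ` C) \<ge> e \<longrightarrow> chordal_diam (f ` C) \<ge> d)"

definition uniformly_open :: "('a::euclidean_space \<Rightarrow> 'a option) set \<Rightarrow> 'a set \<Rightarrow> bool" where
  "uniformly_open \<F> K1 \<longleftrightarrow> (\<forall>e0>0. \<exists>r0>0. \<forall>f\<in>\<F>. \<forall>x0. ball x0 e0 \<subseteq> K1 \<longrightarrow>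
      chordal_ball (f x0) r0 \<subseteq> f ` ball x0 e0)"

end

theory Submission
  imports Defs
begin

text \<open>
  Let \<open>f\<close> be in the family and let \<open>p\<close> be a point of the sphere. If the image of a ball \<open>B1\<close> and the
  complement of the image of a larger concentric ball \<open>B2\<close> both come within chordal distance \<open>s\<close> of
  \<open>p\<close> and both reach out to distance \<open>T\<close>, then all spheres about \<open>p\<close> of intermediate radii meet both sets
  (the complement is connected, since \<open>B2\<close> is a ball, and it contains a fixed point outside \<open>K\<close>). On each
  such sphere the two points met are joined by a large family of Lipschitz curves, and integration over
  the radii bounds the modulus of the image of the ring family from below by a multiple of \<open>ln (T / s)\<close>. The
  ring inequality with a suitable test function bounds the same modulus from above independently
  of \<open>f\<close>, so \<open>s\<close> cannot be small compared with \<open>T\<close>.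

  That the image of a ball has diameter bounded from below uniformly in \<open>f\<close>, so that a fixed \<open>T\<close> is
  available, follows from the same estimate: otherwise smallness would spread from the ball to all
  of \<open>D\<close>, and the image of \<open>A\<close> would be small.
\<close>

section \<open>The chordal metric\<close>

text \<open>The lower bound works with curves inside spheres because the exponent
  \<open>DIM('a)\<close> exceeds the dimension of the sphere: even the curves joining two single
  points then form a family of positive modulus, so it is enough that a sphere meets both sets
  somewhere. Surface measure is avoided by extending functions on the sphere constantly along rays
  and integrating over a shell. The compactification is an obstacle twice. Topologically it is
  removed by an inversion at a finite point \<open>u\<close> outside \<open>K\<close>, which turns
  each member of the family into a continuous injection into R^n. Metrically, chordal scales
  correspond to Euclidean radii in different ways near infinity and away from it; the scales between
  \<open>s\<close> and \<open>T\<close> are cut at their geometric mean, one half is always usable,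
  and the price is a factor 2 in the exponent. Part (2) is the same estimate with \<open>s\<close>
  the distance of the two image points: a ring of width proportional to \<open>norm (x - y)\<close>
  and a constant test function bound the modulus by a multiple of
  \<open>1 / norm (x - y) ^ DIM('a)\<close>.\<close>

definition stereo :: "'a::euclidean_space option \<Rightarrow> 'a \<times> real" where
  "stereo p = (case p of None \<Rightarrow> (0, 1)
     | Some x \<Rightarrow> ((2 / (1 + (norm x)\<^sup>2)) *\<^sub>R x, ((norm x)\<^sup>2 - 1) / ((norm x)\<^sup>2 + 1)))"

lemma sqrt_one_plus_norm_pos: "0 < sqrt (1 + (norm x)\<^sup>2)"
  by (simp add: add_pos_nonneg)

lemma chordal_commute: "chordal p q = chordal q p"
  by (auto simp: chordal_def norm_minus_commute mult.commute split: option.splits)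

lemma chordal_nonneg: "0 \<le> chordal p q"
  by (auto simp: chordal_def split: option.splits)

lemma chordal_self [simp]: "chordal p p = 0"
  by (auto simp: chordal_def split: option.splits)

lemma chordal_eq_0_iff: "chordal p q = 0 \<longleftrightarrow> p = q"
proof -
  have "sqrt (1 + (norm (x::'a))\<^sup>2) \<noteq> 0" for x using sqrt_one_plus_norm_pos[of x] by linarith
  then show ?thesis by (auto simp: chordal_def split: option.splits)
qed

lemma dist_stereo_infinity: "(dist (stereo (Some x)) (stereo None))\<^sup>2 = (2 * chordal (Some x) None)\<^sup>2"
proof -
  define X where "X = 1 + (norm x)\<^sup>2"
  have pos: "X > 0" by (auto simp: X_def add_pos_nonneg)
  have n: "(norm x)\<^sup>2 = X - 1" by (simp add: X_def)
  show ?thesis using pos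
    by (simp add: stereo_def chordal_def dist_norm norm_Pair real_sqrt_pow2 power_mult_distrib power_divide n)
       (simp add: field_simps power2_eq_square)
qed

text \<open>Stereographic projection makes the chordal metric half of the Euclidean distance on the
  unit sphere; from this it inherits the triangle inequality and the bound 1.\<close>

lemma dist_stereo: "dist (stereo p) (stereo q) = 2 * chordal p q"
proof -
  have *: "(dist (stereo p) (stereo q))\<^sup>2 = (2 * chordal p q)\<^sup>2" for p q :: "'a option"
  proof (cases p; cases q)
    fix x y assume p: "p = Some x" and q: "q = Some y"
    define X where "X = 1 + (norm x)\<^sup>2"
    define Y where "Y = 1 + (norm y)\<^sup>2"
    have pos: "X > 0" "Y > 0" by (auto simp: X_def Y_def add_pos_nonneg)
    have xx: "x \<bullet> x = X - 1" "y \<bullet> y = Y - 1" by (auto simp: X_def Y_def dot_square_norm)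
    have "(dist (stereo p) (stereo q))\<^sup>2 =
        (norm ((2 / X) *\<^sub>R x - (2 / Y) *\<^sub>R y))\<^sup>2 + ((X - 2) / X - (Y - 2) / Y)\<^sup>2"
      using pos by (simp add: p q stereo_def dist_norm norm_Pair real_sqrt_pow2 X_def Y_def add.commute)
    also have "(norm ((2 / X) *\<^sub>R x - (2 / Y) *\<^sub>R y))\<^sup>2
        = (2/X)\<^sup>2 * (X - 1) - 2 * (2/X) * (2/Y) * (x \<bullet> y) + (2/Y)\<^sup>2 * (Y - 1)"
      unfolding power2_norm_eq_inner
      by (simp add: inner_diff_left inner_diff_right inner_commute[of y x] xx power2_eq_square)
         (simp add: diff_divide_distrib mult.commute)
    finally have L: "(dist (stereo p) (stereo q))\<^sup>2 = (2/X)\<^sup>2 * (X - 1) - 2 * (2/X) * (2/Y) * (x \<bullet> y) + (2/Y)\<^sup>2 * (Y - 1)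
       + ((X - 2) / X - (Y - 2) / Y)\<^sup>2" .
    have "(2 * chordal p q)\<^sup>2 = 4 * (norm (x - y))\<^sup>2 / (X * Y)"
      using pos by (simp add: p q chordal_def power_mult_distrib power_divide X_def Y_def)
    also have "(norm (x - y))\<^sup>2 = X - 1 - 2 * (x \<bullet> y) + (Y - 1)"
      unfolding power2_norm_eq_inner
      by (simp add: inner_diff_left inner_diff_right inner_commute[of y x] xx)
    finally have R: "(2 * chordal p q)\<^sup>2 = 4 * (X - 1 - 2 * (x \<bullet> y) + (Y - 1)) / (X * Y)" .
    have "(2/X)\<^sup>2 * (X - 1) - 2 * (2/X) * (2/Y) * w + (2/Y)\<^sup>2 * (Y - 1) + ((X - 2) / X - (Y - 2) / Y)\<^sup>2
       = 4 * (X - 1 - 2 * w + (Y - 1)) / (X * Y)" for w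
    proof -
      have "X \<noteq> 0" "Y \<noteq> 0" using pos by auto
      then show ?thesis by (simp add: divide_simps power2_eq_square) algebra
    qed
    then show ?thesis unfolding L R .
  qed (auto simp: dist_stereo_infinity dist_commute[of "stereo None"] chordal_commute[of None])
  show ?thesis by (rule power2_eq_imp_eq[OF *]) (auto simp: chordal_nonneg)
qed

lemma chordal_triangle: "chordal p r \<le> chordal p q + chordal q r"
  using dist_triangle[of "stereo p" "stereo r" "stereo q"] by (simp add: dist_stereo)

lemma norm_stereo: "norm (stereo p) = 1"
proof (cases p)
  case (Some x)
  define X where "X = 1 + (norm x)\<^sup>2"
  have pos: "X > 0" by (auto simp: X_def add_pos_nonneg)
  have n: "(norm x)\<^sup>2 = X - 1" by (simp add: X_def)
  have "(norm (stereo p))\<^sup>2 = 1" using pos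
    by (simp add: Some stereo_def norm_Pair real_sqrt_pow2 power_mult_distrib power_divide n)
       (simp add: field_simps power2_eq_square)
  then show ?thesis by (simp add: power2_eq_1_iff) (metis norm_ge_zero not_one_le_zero neg_0_le_iff_le)
qed (simp add: stereo_def norm_Pair)

lemma chordal_le_1: "chordal p q \<le> 1"
  using norm_triangle_ineq4[of "stereo p" "stereo q"] dist_stereo[of p q] by (simp add: norm_stereo dist_norm)

lemma chordal_le_dist: "chordal (Some x) (Some y) \<le> dist x y"
proof -
  have "1 \<le> sqrt (1 + (norm x)\<^sup>2) * sqrt (1 + (norm y)\<^sup>2)"
    using mult_mono[of 1 "sqrt (1 + (norm x)\<^sup>2)" 1 "sqrt (1 + (norm y)\<^sup>2)"] by simp
  then have "norm (x - y) / (sqrt (1 + (norm x)\<^sup>2) * sqrt (1 + (norm y)\<^sup>2)) \<le> norm (x - y) / 1"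
    by (intro divide_left_mono) auto
  then show ?thesis by (simp add: chordal_def dist_norm)
qed

lemma chordal_None: "chordal (Some x) None = 1 / sqrt (1 + (norm x)\<^sup>2)"
  by (simp add: chordal_def)

text \<open>The sets \<open>U k\<close> increase with \<open>k\<close> and exhaust the complement of
  \<open>b\<close>, so a finite subcover amounts to a single one of them, the one of largest
  index.\<close>

lemma chordal_compact_dist_pos:
  assumes K: "chordal_compact K" and b: "b \<notin> K"
  obtains r where "r > 0" "\<And>y. y \<in> K \<Longrightarrow> r \<le> chordal y b"
proof -
  define U where "U k = {y. chordal y b > 1 / real (Suc k)}" for k
  have "chordal_open (U k)" for k
    unfolding chordal_open_def
  proof
    fix y assume y: "y \<in> U k"
    have "chordal_ball y (chordal y b - 1 / real (Suc k)) \<subseteq> U k"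
    proof
      fix w assume "w \<in> chordal_ball y (chordal y b - 1 / real (Suc k))"
      then show "w \<in> U k" using chordal_triangle[of y b w]
        by (simp add: chordal_ball_def U_def chordal_commute)
    qed
    then show "\<exists>r>0. chordal_ball y r \<subseteq> U k"
      using y by (intro exI[of _ "chordal y b - 1 / real (Suc k)"]) (auto simp: U_def)
  qed
  moreover have "K \<subseteq> (\<Union>k. U k)"
  proof
    fix y assume "y \<in> K"
    then have "chordal y b > 0" using b chordal_eq_0_iff[of y b] chordal_nonneg[of y b] by (metis less_eq_real_def)
    then obtain k where "1 / real (Suc k) < chordal y b" using nat_approx_posE by blast
    then show "y \<in> (\<Union>k. U k)" by (auto simp: U_def)
  qed
  ultimately obtain V where V: "V \<subseteq> range U" "finite V" "K \<subseteq> \<Union>V"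
    using K unfolding chordal_compact_def by (metis (no_types, lifting) imageE)
  then obtain F where F: "finite F" "V = U ` F" by (meson finite_subset_image)
  define r where "r = 1 / real (Suc (Max (insert 0 F)))"
  show ?thesis
  proof (rule that)
    show "r > 0" by (simp add: r_def)
    fix y assume "y \<in> K"
    then obtain k where k: "k \<in> F" "y \<in> U k" using V(3) F by auto
    have "k \<le> Max (insert 0 F)" using F(1) k(1) by auto
    then have "r \<le> 1 / real (Suc k)" unfolding r_def by (intro divide_left_mono) auto
    also have "\<dots> < chordal y b" using k(2) by (simp add: U_def)
    finally show "r \<le> chordal y b" by simp
  qed
qed

text \<open>The inversion needs a finite centre. If the omitted point is infinity, a whole chordal
  neighbourhood of it is omitted, and this contains finite points.\<close>

lemma chordal_compact_omits_finite_point: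
  fixes K :: "'a::euclidean_space option set"
  assumes K: "chordal_compact K" and ne: "K \<noteq> UNIV"
  obtains u r where "r > 0" "\<And>y. y \<in> K \<Longrightarrow> r \<le> chordal y (Some u)"
proof -
  obtain b where b: "b \<notin> K" using ne by auto
  obtain u where u: "Some u \<notin> K"
  proof (cases b)
    case None
    obtain r where r: "r > 0" "\<And>y. y \<in> K \<Longrightarrow> r \<le> chordal y None"
      using chordal_compact_dist_pos[OF K] b None by metis
    obtain u0 :: 'a where u0: "u0 \<in> Basis" using nonempty_Basis by blast
    \<comment> \<open>A vector of norm \<open>1 / r\<close> has chordal distance
      \<open>1 / sqrt (1 + 1 / r^2) < r\<close> from infinity.\<close>
    define u where "u = (1 / r) *\<^sub>R u0"
    have nu: "norm u = 1 / r" using r(1) u0 by (simp add: u_def)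
    have "1 / r < sqrt (1 + (norm u)\<^sup>2)" unfolding nu by (intro real_less_rsqrt) simp
    then have "chordal (Some u) None < r" using r(1) sqrt_one_plus_norm_pos[of u]
      by (simp add: chordal_None field_simps)
    then show thesis using that r(2)[of "Some u"] by fastforce
  qed (use b that in auto)
  then show thesis using chordal_compact_dist_pos[OF K u] that by metis
qed

section \<open>Topology of an embedding omitting a point\<close>

text \<open>Sends \<open>Some u\<close> to infinity and infinity to 0. At \<open>Some u\<close>
  itself the formula yields the default value 0, which collides with the image of infinity; hence
  the premises \<open>p \<noteq> Some u\<close> throughout.\<close>

definition inversion :: "'a::euclidean_space \<Rightarrow> 'a option \<Rightarrow> 'a" where
  "inversion u p = (case p of None \<Rightarrow> 0 | Some w \<Rightarrow> (w - u) /\<^sub>R (norm (w - u))\<^sup>2)"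

lemma norm_diff_inversion:
  fixes a b :: "'a::real_inner"
  assumes "a \<noteq> 0" "b \<noteq> 0"
  shows "norm (a /\<^sub>R (norm a)\<^sup>2 - b /\<^sub>R (norm b)\<^sup>2) = norm (a - b) / (norm a * norm b)"
proof -
  define A where "A = (norm a)\<^sup>2"
  define B where "B = (norm b)\<^sup>2"
  have pos: "A \<noteq> 0" "B \<noteq> 0" using assms by (auto simp: A_def B_def)
  have AB: "a \<bullet> a = A" "b \<bullet> b = B" by (auto simp: A_def B_def dot_square_norm)
  have "(norm (a /\<^sub>R A - b /\<^sub>R B))\<^sup>2 = A / A\<^sup>2 - 2 * (a \<bullet> b) / (A * B) + B / B\<^sup>2"
    unfolding power2_norm_eq_inner
    by (simp add: inner_diff_left inner_diff_right inner_commute[of b a] AB power2_eq_square field_simps)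
  also have "\<dots> = (A - 2 * (a \<bullet> b) + B) / (A * B)"
    using pos by (simp add: field_simps power2_eq_square)
  also have "A - 2 * (a \<bullet> b) + B = (norm (a - b))\<^sup>2"
    unfolding power2_norm_eq_inner
    by (simp add: inner_diff_left inner_diff_right inner_commute[of b a] AB)
  finally have "(norm (a /\<^sub>R A - b /\<^sub>R B))\<^sup>2 = (norm (a - b) / (norm a * norm b))\<^sup>2"
    by (simp add: A_def B_def power_divide power_mult_distrib)
  then show ?thesis by (simp add: A_def B_def)
qed

text \<open>Inversion changes chordal distances only by factors measuring the distance to the
  centre. On a set that keeps away from \<open>u\<close> these are bounded, so continuity survives
  the change of coordinate.\<close>

lemma dist_inversion:
  assumes "p \<noteq> Some u" "q \<noteq> Some u"
  shows "dist (inversion u p) (inversion u q)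
    = chordal p q / ((1 + (norm u)\<^sup>2) * chordal p (Some u) * chordal q (Some u))"
proof -
  have pos: "sqrt (1 + (norm x)\<^sup>2) > 0" for x :: 'a by (rule sqrt_one_plus_norm_pos)
  have u: "1 + (norm u)\<^sup>2 = sqrt (1 + (norm u)\<^sup>2) * sqrt (1 + (norm u)\<^sup>2)" by simp
  show ?thesis
  proof (cases p; cases q)
    fix w v assume p: "p = Some w" and q: "q = Some v"
    have ne: "w - u \<noteq> 0" "v - u \<noteq> 0" using assms p q by auto
    have d: "dist (inversion u p) (inversion u q) = norm (w - v) / (norm (w - u) * norm (v - u))"
      using norm_diff_inversion[OF ne] by (simp add: p q inversion_def dist_norm)
    have eq: "n / (A * B) = n / (W * V) / (K * (A / (W * U)) * (B / (V * U)))"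
      if "A \<noteq> 0" "B \<noteq> 0" "W \<noteq> 0" "V \<noteq> 0" "U \<noteq> 0" "K = U * U" for n A B W V U K :: real
      using that by simp
    show ?thesis unfolding d unfolding p q chordal_def option.case prod.case
      by (rule eq) (use ne pos[of u] pos[of w] pos[of v] in linarith | use ne in simp | rule u)+
  next
    fix w assume p: "p = Some w" and q: "q = None"
    have ne: "w - u \<noteq> 0" using assms p by auto
    then have d: "dist (inversion u p) (inversion u q) = 1 / norm (w - u)"
      by (simp add: p q inversion_def power2_eq_square divide_inverse)
    have eq: "1 / A = 1 / W / (K * (A / (W * U)) * (1 / U))"
      if "A \<noteq> 0" "W \<noteq> 0" "U \<noteq> 0" "K = U * U" for A W U K :: real
      using that by simp
    show ?thesis unfolding d unfolding p q chordal_def option.case prod.case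
      by (rule eq) (use ne pos[of u] pos[of w] in linarith | use ne in simp | rule u)+
  next
    fix w assume p: "p = None" and q: "q = Some w"
    have ne: "w - u \<noteq> 0" using assms q by auto
    then have d: "dist (inversion u p) (inversion u q) = 1 / norm (w - u)"
      by (simp add: p q inversion_def power2_eq_square divide_inverse)
    have eq: "1 / A = 1 / W / (K * (1 / U) * (A / (W * U)))"
      if "A \<noteq> 0" "W \<noteq> 0" "U \<noteq> 0" "K = U * U" for A W U K :: real
      using that by simp
    show ?thesis unfolding d unfolding p q chordal_def option.case prod.case
      by (rule eq) (use ne pos[of u] pos[of w] in linarith | use ne in simp | rule u)+
  qed (auto simp: inversion_def)
qed

lemma inversion_inj:
  assumes "p \<noteq> Some u" "q \<noteq> Some u" "inversion u p = inversion u q"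
  shows "p = q"
proof -
  have "1 + (norm u)\<^sup>2 \<noteq> 0" by (simp add: add_nonneg_eq_0_iff)
  then have "chordal p q = 0"
    using dist_inversion[of p u q] chordal_eq_0_iff[of p "Some u"] chordal_eq_0_iff[of q "Some u"] assms
    by simp
  then show ?thesis by (simp add: chordal_eq_0_iff)
qed

lemma inversion_of_inversion: "v \<noteq> 0 \<Longrightarrow> inversion u (Some (u + v /\<^sub>R (norm v)\<^sup>2)) = v"
  by (simp add: inversion_def divide_simps power2_eq_square)

text \<open>Spheres about \<open>c\<close> are level sets of \<open>height c\<close>. In the coordinate \<open>v = inversion u p\<close> the height becomes
  the rational function \<open>height_inv c u\<close>, which is continuous also at \<open>v = 0\<close>, the image of infinity.\<close>
definition height :: "'a::euclidean_space \<Rightarrow> 'a option \<Rightarrow> real" where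
  "height c p = (case p of None \<Rightarrow> 0 | Some w \<Rightarrow> 1 / (1 + (dist w c)\<^sup>2))"

definition height_inv :: "'a::euclidean_space \<Rightarrow> 'a \<Rightarrow> 'a \<Rightarrow> real" where
  "height_inv c u v = (norm v)\<^sup>2 / (1 + 2 * ((u - c) \<bullet> v) + (1 + (norm (u - c))\<^sup>2) * (norm v)\<^sup>2)"

text \<open>By the Cauchy-Schwarz inequality the denominator is at least
  \<open>(norm d * norm v - 1)^2 + (norm v)^2\<close>.\<close>

lemma height_inv_denominator_pos:
  "0 < 1 + 2 * (d \<bullet> v) + (1 + (norm d)\<^sup>2) * (norm v)\<^sup>2" for v :: "'a::euclidean_space"
proof (cases "v = 0")
  case False
  have "\<bar>d \<bullet> v\<bar> \<le> norm d * norm v" by (rule Cauchy_Schwarz_ineq2)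
  then have "(norm d * norm v - 1)\<^sup>2 + (norm v)\<^sup>2 \<le> 1 + 2 * (d \<bullet> v) + (1 + (norm d)\<^sup>2) * (norm v)\<^sup>2"
    by (simp add: power2_eq_square algebra_simps)
  moreover have "(norm v)\<^sup>2 > 0" using False by simp
  ultimately show ?thesis by (smt (verit) zero_le_power2)
qed simp

lemma continuous_on_height_inv: "continuous_on A (height_inv c u)"
proof -
  have "1 + 2 * ((u - c) \<bullet> v) + (1 + (norm (u - c))\<^sup>2) * (norm v)\<^sup>2 \<noteq> 0" for v
    using height_inv_denominator_pos[of "u - c" v] by linarith
  then show ?thesis unfolding height_inv_def by (intro continuous_intros) simp
qed

lemma height_inv_inversion:
  assumes "p \<noteq> Some u" shows "height_inv c u (inversion u p) = height c p"
proof (cases p)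
  case (Some w)
  define N where "N = (norm (w - u))\<^sup>2"
  have ne: "w - u \<noteq> 0" using assms Some by auto
  then have N: "N > 0" by (simp add: N_def)
  have v: "inversion u p = (w - u) /\<^sub>R N" by (simp add: Some inversion_def N_def)
  have nv: "(norm (inversion u p))\<^sup>2 = 1 / N"
    unfolding v using N by (simp add: power_mult_distrib power_divide N_def[symmetric] divide_simps) (simp add: power2_eq_square)
  have "(dist w c)\<^sup>2 = ((w - u) + (u - c)) \<bullet> ((w - u) + (u - c))"
    by (simp add: dist_norm power2_norm_eq_inner)
  also have "\<dots> = N + 2 * ((u - c) \<bullet> (w - u)) + (norm (u - c))\<^sup>2"
    unfolding N_def power2_norm_eq_inner
    by (simp only: inner_add_left inner_add_right inner_commute[of "w - u" "u - c"])
  finally have d: "(dist w c)\<^sup>2 = N + 2 * ((u - c) \<bullet> (w - u)) + (norm (u - c))\<^sup>2" .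
  have "height_inv c u (inversion u p) = (1/N) / (1 + 2 * ((u - c) \<bullet> (w - u)) / N + (1 + (norm (u - c))\<^sup>2) / N)"
  proof -
    have "(u - c) \<bullet> inversion u p = ((u - c) \<bullet> (w - u)) / N" unfolding v by (simp add: divide_inverse mult.commute)
    then show ?thesis unfolding height_inv_def nv by simp
  qed
  also have "\<dots> = 1 / (N * (1 + 2 * ((u - c) \<bullet> (w - u)) / N + (1 + (norm (u - c))\<^sup>2) / N))"
    using N by simp
  also have "N * (1 + 2 * ((u - c) \<bullet> (w - u)) / N + (1 + (norm (u - c))\<^sup>2) / N)
      = N + 2 * ((u - c) \<bullet> (w - u)) + (1 + (norm (u - c))\<^sup>2)"
    using N by (simp add: distrib_left add_divide_distrib)
  finally show ?thesis by (simp add: Some height_def d)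
qed (simp add: height_inv_def inversion_def height_def)

lemma height_eq_iff:
  assumes "t > 0" "height c p = 1 / (1 + t\<^sup>2)"
  obtains w where "p = Some w" "dist w c = t"
proof (cases p)
  case None
  then show ?thesis using assms by (simp add: height_def add_nonneg_eq_0_iff)
next
  case (Some w)
  have "1 + (dist w c)\<^sup>2 > 0" "1 + t\<^sup>2 > 0" by (auto intro: add_pos_nonneg)
  then have "(dist w c)\<^sup>2 = t\<^sup>2" using assms by (simp add: height_def Some)
  then have "dist w c = t" using assms(1) by (simp add: power2_eq_iff_nonneg)
  then show ?thesis using that Some by blast
qed

lemma continuous_height_Some: "continuous_on A (\<lambda>w. height c (Some w))"
proof -
  have "1 + (dist w c)\<^sup>2 \<noteq> 0" for w by (simp add: add_nonneg_eq_0_iff)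
  then show ?thesis by (auto simp: height_def intro!: continuous_intros)
qed

lemma affine_in_interval:
  fixes a b t :: real
  assumes "a \<le> b" "t \<in> {0..1}"
  shows "a + (b - a) * t \<in> {a..b}"
proof -
  have "0 \<le> (b - a) * t" using assms by (intro mult_nonneg_nonneg) auto
  moreover have "a + (b - a) * t \<le> a + (b - a) * 1" using assms by (intro add_left_mono mult_left_mono) auto
  moreover have "a + (b - a) * 1 = b" by simp
  ultimately show ?thesis by simp
qed

section \<open>A single embedding in the inverted coordinate\<close>

locale omitting_homeo =
  fixes D :: "'a::euclidean_space set" and f :: "'a \<Rightarrow> 'a option" and u :: 'a and r0 :: real
  assumes dim2: "DIM('a) \<ge> 2" and openD: "open D" and homeo: "homeomorphism_into D f"
    and r0: "r0 > 0" and omits: "\<And>x. x \<in> D \<Longrightarrow> r0 \<le> chordal (f x) (Some u)"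
begin

lemma f_ne: "x \<in> D \<Longrightarrow> f x \<noteq> Some u"
  using omits[of x] r0 by auto

text \<open>In this coordinate the map is a continuous injection of \<open>D\<close> into R^n, so
  that invariance of domain and the non-separation theorem for R^n become available.\<close>

definition phi :: "'a \<Rightarrow> 'a" where "phi x = inversion u (f x)"

lemma dist_phi_le:
  assumes "x \<in> D" "y \<in> D"
  shows "dist (phi x) (phi y) \<le> chordal (f x) (f y) / r0\<^sup>2"
proof -
  have "r0\<^sup>2 \<le> chordal (f x) (Some u) * chordal (f y) (Some u)"
    unfolding power2_eq_square using omits assms r0 by (intro mult_mono) (auto simp: chordal_nonneg)
  also have "\<dots> \<le> (1 + (norm u)\<^sup>2) * (chordal (f x) (Some u) * chordal (f y) (Some u))"
    using mult_right_mono[of 1 "1 + (norm u)\<^sup>2" "chordal (f x) (Some u) * chordal (f y) (Some u)"]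
    by (simp add: chordal_nonneg)
  finally have "chordal (f x) (f y) / ((1 + (norm u)\<^sup>2) * (chordal (f x) (Some u) * chordal (f y) (Some u)))
      \<le> chordal (f x) (f y) / r0\<^sup>2"
    using r0 chordal_nonneg by (intro frac_le) auto
  then show ?thesis
    unfolding phi_def dist_inversion[OF f_ne[OF assms(1)] f_ne[OF assms(2)]] by (simp add: mult.assoc)
qed

lemma continuous_phi: "continuous_on D phi"
proof (unfold continuous_on_iff, intro ballI allI impI)
  fix x and e :: real assume x: "x \<in> D" "0 < e"
  then have "e * r0\<^sup>2 > 0" using r0 by simp
  then obtain d where d: "d > 0" "\<And>x'. x' \<in> D \<Longrightarrow> dist x' x < d \<Longrightarrow> chordal (f x') (f x) < e * r0\<^sup>2"
    using homeo x unfolding homeomorphism_into_def by blast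
  show "\<exists>d>0. \<forall>x'\<in>D. dist x' x < d \<longrightarrow> dist (phi x') (phi x) < e"
  proof (intro exI[of _ d] conjI ballI impI)
    fix x' assume "x' \<in> D" "dist x' x < d"
    then have "dist (phi x') (phi x) \<le> chordal (f x') (f x) / r0\<^sup>2" "chordal (f x') (f x) / r0\<^sup>2 < e"
      using d(2)[of x'] dist_phi_le[of x' x] x r0 by (auto simp: pos_divide_less_eq)
    then show "dist (phi x') (phi x) < e" by linarith
  qed (use d in auto)
qed

lemma inj_f: "inj_on f D"
  using homeo by (simp add: homeomorphism_into_def)

lemma inj_phi: "inj_on phi D"
proof (rule inj_onI)
  fix x y assume xy: "x \<in> D" "y \<in> D" "phi x = phi y"
  then have "f x = f y" unfolding phi_def by (intro inversion_inj[OF f_ne f_ne])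
  then show "x = y" using inj_f xy by (simp add: inj_on_def)
qed

lemma phi_image_iff:
  assumes "S \<subseteq> D" "p \<noteq> Some u"
  shows "inversion u p \<in> phi ` S \<longleftrightarrow> p \<in> f ` S"
  using assms inversion_inj[of p u] f_ne unfolding phi_def by (auto simp: image_iff)

lemma height_f: "x \<in> D \<Longrightarrow> height c (f x) = height_inv c u (phi x)"
  by (simp add: phi_def height_inv_inversion f_ne)

text \<open>Intermediate value theorem for the height on the connected ball. The level
  \<open>1 / (1 + t^2)\<close> is positive, hence attained at a finite point.\<close>

lemma sphere_meets_image:
  assumes sub: "cball z r \<subseteq> D" and x: "x1 \<in> cball z r" "x2 \<in> cball z r" and t: "t > 0"
    and h: "height c (f x1) \<le> 1 / (1 + t\<^sup>2)" "1 / (1 + t\<^sup>2) \<le> height c (f x2)"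
  obtains w where "Some w \<in> f ` cball z r" "dist w c = t"
proof -
  have "continuous_on (cball z r) (\<lambda>x. height_inv c u (phi x))"
    using continuous_on_compose[OF continuous_on_subset[OF continuous_phi sub] continuous_on_height_inv]
    by (simp add: o_def)
  then have "connected ((\<lambda>x. height_inv c u (phi x)) ` cball z r)"
    by (intro connected_continuous_image) auto
  moreover have "height_inv c u (phi x1) \<le> 1 / (1 + t\<^sup>2)" "1 / (1 + t\<^sup>2) \<le> height_inv c u (phi x2)"
    using h x sub height_f by (metis subsetD)+
  ultimately have "1 / (1 + t\<^sup>2) \<in> (\<lambda>x. height_inv c u (phi x)) ` cball z r"
    using x by (meson connectedD_interval imageI)
  then obtain x where x: "x \<in> cball z r" "height c (f x) = 1 / (1 + t\<^sup>2)"
    using height_f sub by (metis (no_types, lifting) imageE subsetD)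
  then show ?thesis using height_eq_iff[OF t x(2)] that by (metis imageI)
qed

lemma compact_phi: "cball z r \<subseteq> D \<Longrightarrow> compact (phi ` cball z r)"
  using compact_continuous_image[OF continuous_on_subset[OF continuous_phi]] by auto

text \<open>This set represents the complement of the image in the compactification with
  \<open>u\<close> removed, since \<open>u\<close> has gone to infinity.\<close>

lemma connected_complement_phi: "cball z r \<subseteq> D \<Longrightarrow> connected (- phi ` cball z r)"
proof (rule connected_complement_homeomorphic_convex_compact)
  assume sub: "cball z r \<subseteq> D"
  have "cball z r homeomorphic phi ` cball z r"
    using homeomorphic_compact[OF compact_cball continuous_on_subset[OF continuous_phi sub] refl inj_on_subset[OF inj_phi sub]] .
  then show "phi ` cball z r homeomorphic cball z r" by (rule homeomorphic_sym[THEN iffD1])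
qed (use dim2 in auto)

text \<open>The intermediate value theorem should be applied between \<open>q\<close> and
  \<open>u\<close>, but \<open>u\<close> has no inverted coordinate. It is replaced by a finite
  point \<open>w\<close> so close to \<open>u\<close> that its coordinate lies outside the compact
  image; the height changes little, which is why the inequality at \<open>u\<close> has to be
  strict.\<close>

lemma sphere_meets_complement:
  assumes sub: "cball z r \<subseteq> D" and q: "q \<notin> f ` cball z r" "q \<noteq> Some u" and t: "t > 0"
    and h: "height c q \<le> 1 / (1 + t\<^sup>2) \<and> 1 / (1 + t\<^sup>2) < height c (Some u)
          \<or> height c (Some u) < 1 / (1 + t\<^sup>2) \<and> 1 / (1 + t\<^sup>2) \<le> height c q"
  obtains w where "Some w \<notin> f ` cball z r" "dist w c = t" "w \<noteq> u"
proof -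
  define k where "k = 1 / (1 + t\<^sup>2)"
  have k: "k > 0" by (auto simp: k_def add_pos_nonneg)
  obtain B where B: "\<And>v. v \<in> phi ` cball z r \<Longrightarrow> norm v \<le> B"
    using compact_imp_bounded[OF compact_phi[OF sub]] unfolding bounded_iff by blast
  have nt: "at u \<noteq> bot" by simp
  have "(\<lambda>w. height c (Some w)) \<midarrow>u\<rightarrow> height c (Some u)"
    using continuous_height_Some[of UNIV c] by (simp add: continuous_on_def)
  note lim = order_tendstoD[OF this]
  have "filterlim (\<lambda>w. norm (w - u)) (at_right 0) (at u)"
    by (auto simp: filterlim_at eventually_at_filter intro!: tendsto_eq_intros)
  then have "filterlim (\<lambda>w. inverse (norm (w - u))) at_top (at u)"
    by (rule filterlim_compose[OF filterlim_inverse_at_top_right])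
  then have "\<forall>\<^sub>F w in at u. B < inverse (norm (w - u))"
    by (auto simp: filterlim_at_top_dense)
  moreover have "\<forall>\<^sub>F w in at u. w \<noteq> u" by (simp add: eventually_at_filter)
  moreover have "\<forall>\<^sub>F w in at u. height c q \<le> k \<and> k < height c (Some w)
          \<or> height c (Some w) < k \<and> k \<le> height c q"
  proof (cases "height c q \<le> k \<and> k < height c (Some u)")
    case True
    then show ?thesis using lim(1)[of k] by (auto elim: eventually_mono)
  next
    case False
    then show ?thesis using lim(2)[of k] h by (auto elim: eventually_mono simp: k_def)
  qed
  ultimately have "\<forall>\<^sub>F w in at u. B < inverse (norm (w - u)) \<and> w \<noteq> u \<and> (height c q \<le> k \<and> k < height c (Some w)
          \<or> height c (Some w) < k \<and> k \<le> height c q)" by eventually_elim auto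
  then obtain w where w: "B < inverse (norm (w - u))" "w \<noteq> u"
     "height c q \<le> k \<and> k < height c (Some w) \<or> height c (Some w) < k \<and> k \<le> height c q"
    using eventually_happens'[OF nt] by blast
  have "norm (inversion u (Some w)) = inverse (norm (w - u))"
    using w(2) by (simp add: inversion_def power2_eq_square divide_simps)
  then have "inversion u (Some w) \<notin> phi ` cball z r" using B w(1) by force
  then have v1: "inversion u (Some w) \<in> - phi ` cball z r" by simp
  have v2: "inversion u q \<in> - phi ` cball z r" using phi_image_iff[OF sub q(2)] q(1) by simp
  have "connected (height_inv c u ` (- phi ` cball z r))"
    by (intro connected_continuous_image continuous_on_height_inv connected_complement_phi sub)
  moreover have "height_inv c u (inversion u (Some w)) = height c (Some w)" "height_inv c u (inversion u q) = height c q"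
    using w q by (auto intro!: height_inv_inversion)
  moreover from this v1 v2 have im: "height c (Some w) \<in> height_inv c u ` (- phi ` cball z r)"
      "height c q \<in> height_inv c u ` (- phi ` cball z r)" by (metis imageI)+
  ultimately have "k \<in> height_inv c u ` (- phi ` cball z r)"
    using w(3) connectedD_interval[OF _ im, of k] connectedD_interval[OF _ im(2,1), of k] by auto
  then obtain v where v: "v \<notin> phi ` cball z r" "height_inv c u v = k" by auto
  \<comment> \<open>\<open>v = 0\<close> is the coordinate of infinity, which has height 0 and lies
    on no sphere.\<close>
  have "v \<noteq> 0" using v(2) k by (auto simp: height_inv_def)
  define w' where "w' = u + v /\<^sub>R (norm v)\<^sup>2"
  have iv: "inversion u (Some w') = v" using inversion_of_inversion[OF \<open>v \<noteq> 0\<close>] by (simp add: w'_def)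
  have ne: "w' \<noteq> u" using \<open>v \<noteq> 0\<close> by (simp add: w'_def)
  have "height c (Some w') = 1 / (1 + t\<^sup>2)" using height_inv_inversion[of "Some w'" u c] ne iv v(2) by (simp add: k_def)
  then have "dist w' c = t" using height_eq_iff[OF t] by (metis option.inject)
  moreover have "Some w' \<notin> f ` cball z r" using phi_image_iff[OF sub, of "Some w'"] ne iv v(1) by simp
  ultimately show ?thesis using that ne by blast
qed

text \<open>The subpath between the last visit to the inner ball and the first exit from the outer one.\<close>
lemma subpath_lift:
  assumes sub: "cball z r2 \<subseteq> D" and r: "0 < r1" "r1 < r2"
    and \<beta>: "continuous_on {0..1} \<beta>" "\<And>t. t \<in> {0..1} \<Longrightarrow> \<beta> t \<noteq> u"
    and b0: "Some (\<beta> 0) \<in> f ` cball z r1" and b1: "Some (\<beta> 1) \<notin> f ` cball z r2"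
  obtains \<gamma> a b where "0 \<le> a" "a < b" "b \<le> 1" "\<gamma> \<in> path_family (sphere z r1) (sphere z r2) D"
    "\<And>t. t \<in> {0..1} \<Longrightarrow> \<gamma> t \<in> D \<and> f (\<gamma> t) = Some (\<beta> (a + (b - a) * t))"
proof -
  define B where "B t = inversion u (Some (\<beta> t))" for t
  have contB: "continuous_on {0..1} B"
    unfolding B_def inversion_def using \<beta> by (auto intro!: continuous_intros)
  have sub1: "cball z r1 \<subseteq> D" and subo: "ball z r2 \<subseteq> D" "ball z r1 \<subseteq> D"
    using sub r by (auto simp: subset_iff)
  have c2: "closed (phi ` cball z r2)" and c1: "closed (phi ` cball z r1)"
    using compact_phi[OF sub] compact_phi[OF sub1] by (auto intro: compact_imp_closed)
  have o: "open (phi ` ball z r)" if "ball z r \<subseteq> D" for r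
    using invariance_of_domain[OF continuous_on_subset[OF continuous_phi that] open_ball inj_on_subset[OF inj_phi that]] .
  have B0: "B 0 \<in> phi ` cball z r1" using phi_image_iff[OF sub1] b0 \<beta>(2)[of 0] by (simp add: B_def)
  have B1: "B 1 \<notin> phi ` cball z r2" using phi_image_iff[OF sub] b1 \<beta>(2)[of 1] by (simp add: B_def)
  \<comment> \<open>Being outside the image of the open outer ball and being inside the image of the
    closed inner ball are closed conditions, so the first exit and the last visit are
    attained.\<close>
  define T where "T = {t \<in> {0..1}. B t \<notin> phi ` ball z r2}"
  have "T = {0..1} \<inter> B -` (- phi ` ball z r2)" by (auto simp: T_def)
  then have "closed T" using continuous_closed_preimage[OF contB] o[OF subo(1)] by (simp add: closed_Compl)
  have sb: "cball z r1 \<subseteq> ball z r2" "ball z r2 \<subseteq> cball z r2" "ball z r1 \<subseteq> cball z r1" using r by (auto simp: subset_iff)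
  have "1 \<in> T" using B1 sb by (auto simp: T_def)
  have bdd: "bdd_below T" by (auto simp: T_def intro: bdd_belowI[of _ 0])
  define b where "b = Inf T"
  have bT: "b \<in> T" unfolding b_def using closed_contains_Inf[OF _ bdd \<open>closed T\<close>] \<open>1 \<in> T\<close> by blast
  have below_b: "B t \<in> phi ` ball z r2" if "0 \<le> t" "t < b" for t
  proof (rule ccontr)
    assume "B t \<notin> phi ` ball z r2"
    then have "t \<in> T" using that bT by (auto simp: T_def)
    then show False using cInf_lower[OF _ bdd, of t] that by (simp add: b_def)
  qed
  have "b \<noteq> 0" using bT B0 sb(1) by (auto simp: T_def)
  then have b: "0 < b" "b \<le> 1" using bT by (auto simp: T_def)
  have contb: "continuous_on {0..b} B" using contB b by (auto intro: continuous_on_subset)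
  have "B ` {0..b} \<subseteq> phi ` cball z r2"
  proof -
    have "closure {0..<b} = {0..b}" using b by simp
    moreover have "B ` {0..<b} \<subseteq> phi ` cball z r2" using below_b sb by fastforce
    ultimately show ?thesis using image_closure_subset[of "{0..<b}" B "phi ` cball z r2"] contb c2 by simp
  qed
  then have Bin: "B t \<in> phi ` cball z r2" if "0 \<le> t" "t \<le> b" for t using that by auto
  define T' where "T' = {t \<in> {0..b}. B t \<in> phi ` cball z r1}"
  have "T' = {0..b} \<inter> B -` (phi ` cball z r1)" by (auto simp: T'_def)
  then have "closed T'" using continuous_closed_preimage[OF contb] c1 by simp
  have "0 \<in> T'" using B0 b by (auto simp: T'_def)
  have bdd': "bdd_above T'" by (auto simp: T'_def intro: bdd_aboveI[of _ b])
  define a where "a = Sup T'"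
  have aT: "a \<in> T'" unfolding a_def using closed_contains_Sup[OF _ bdd' \<open>closed T'\<close>] \<open>0 \<in> T'\<close> by blast
  have "a \<noteq> b" using aT bT sb(1) by (auto simp: T_def T'_def)
  then have a: "0 \<le> a" "a < b" using aT by (auto simp: T'_def)
  have above_a: "B t \<notin> phi ` cball z r1" if "a < t" "t \<le> b" for t
  proof
    assume "B t \<in> phi ` cball z r1"
    then have "t \<in> T'" using that a by (auto simp: T'_def)
    then show False using cSup_upper[OF _ bdd', of t] that by (simp add: a_def)
  qed
  \<comment> \<open>The path is lifted by the inverse of \<open>phi\<close> on the outer ball, which
    is continuous by compactness; hence the restriction to times up to \<open>b\<close>.\<close>
  obtain g where g: "homeomorphism (cball z r2) (phi ` cball z r2) phi g"
    using homeomorphism_compact[OF compact_cball continuous_on_subset[OF continuous_phi sub] refl inj_on_subset[OF inj_phi sub]]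
    by blast
  have gphi: "x \<in> cball z r2 \<Longrightarrow> g (phi x) = x" and phig: "v \<in> phi ` cball z r2 \<Longrightarrow> phi (g v) = v \<and> g v \<in> cball z r2" for x v
    using g by (auto simp: homeomorphism_def)
  have contg: "continuous_on (phi ` cball z r2) g" using g by (simp add: homeomorphism_def)
  define s where "s t = a + (b - a) * t" for t
  have s: "s t \<in> {a..b}" if "t \<in> {0..1}" for t
    unfolding s_def using a by (intro affine_in_interval that) auto
  have s': "s t \<in> {0..b}" if "t \<in> {0..1}" for t using s[OF that] a by auto
  define \<gamma> where "\<gamma> t = g (B (s t))" for t
  have "continuous_on {0..1} \<gamma>"
    unfolding \<gamma>_def
  proof (rule continuous_on_compose2[OF contg])
    show "continuous_on {0..1} (\<lambda>t. B (s t))"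
      by (rule continuous_on_compose2[OF contb]) (use s' in \<open>auto simp: s_def intro!: continuous_intros\<close>)
    show "(\<lambda>t. B (s t)) ` {0..1} \<subseteq> phi ` cball z r2" using Bin s' by auto
  qed
  have \<gamma>in: "\<gamma> t \<in> cball z r2 \<and> phi (\<gamma> t) = B (s t)" if "t \<in> {0..1}" for t
    unfolding \<gamma>_def using phig Bin s'[OF that] by auto
  have "\<gamma> 0 \<in> sphere z r1"
  proof -
    have "\<gamma> 0 \<in> cball z r1"
    proof -
      obtain x where x: "x \<in> cball z r1" "B a = phi x" using aT by (auto simp: T'_def)
      then have "\<gamma> 0 = x" unfolding \<gamma>_def s_def using gphi[of x] sb by auto
      then show ?thesis using x by simp
    qed
    \<comment> \<open>The image of the open inner ball is open by invariance of domain, so a start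
      in it would keep the path there for some time after \<open>a\<close>, against the maximality
      of \<open>a\<close>.\<close>
    moreover have "\<gamma> 0 \<notin> ball z r1"
    proof
      assume "\<gamma> 0 \<in> ball z r1"
      then have "B a \<in> phi ` ball z r1" using \<gamma>in[of 0] by (metis atLeastAtMost_iff add.right_neutral image_eqI le_numeral_extra(3) mult_zero_right s_def zero_le_one)
      moreover have "(B \<longlongrightarrow> B a) (at_right a)"
      proof -
        have "(B \<longlongrightarrow> B a) (at a within {0..b})" using contb a by (auto simp: continuous_on_def)
        then have "(B \<longlongrightarrow> B a) (at a within {a..b})" by (rule tendsto_within_subset) (use a in auto)
        then show ?thesis using a by (simp add: at_within_Icc_at_right)
      qed
      ultimately have "\<forall>\<^sub>F t in at_right a. B t \<in> phi ` ball z r1"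
        using topological_tendstoD o[OF subo(2)] by blast
      moreover have "\<forall>\<^sub>F t in at_right a. a < t \<and> t < b"
        using a eventually_at_right_real[of a b] by (auto elim: eventually_mono)
      ultimately have "\<forall>\<^sub>F t in at_right a. False"
        by eventually_elim (use above_a image_mono[OF sb(3), of phi] in \<open>meson less_imp_le subsetD\<close>)
      then show False by (simp add: trivial_limit_at_right_real)
    qed
    ultimately show ?thesis by (auto simp: sphere_def)
  qed
  moreover have "\<gamma> 1 \<in> sphere z r2"
  proof -
    have "\<gamma> 1 \<in> cball z r2" "phi (\<gamma> 1) = B b" using \<gamma>in[of 1] by (auto simp: s_def)
    moreover have "\<gamma> 1 \<notin> ball z r2"
    proof
      assume "\<gamma> 1 \<in> ball z r2"
      then have "phi (\<gamma> 1) \<in> phi ` ball z r2" by (rule imageI)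
      then show False using bT calculation(2) by (simp add: T_def)
    qed
    ultimately show ?thesis by auto
  qed
  moreover have fin: "\<gamma> t \<in> D \<and> f (\<gamma> t) = Some (\<beta> (a + (b - a) * t))" if "t \<in> {0..1}" for t
  proof -
    have D: "\<gamma> t \<in> D" using \<gamma>in[OF that] sub by auto
    have "inversion u (f (\<gamma> t)) = inversion u (Some (\<beta> (s t)))" using \<gamma>in[OF that] by (simp add: B_def phi_def)
    then have "f (\<gamma> t) = Some (\<beta> (s t))"
      using inversion_inj[OF f_ne[OF D]] \<beta>(2)[of "s t"] s'[OF that] b by auto
    then show ?thesis using D by (simp add: s_def)
  qed
  ultimately have "\<gamma> \<in> path_family (sphere z r1) (sphere z r2) D"
    using \<open>continuous_on {0..1} \<gamma>\<close> by (simp add: path_family_def)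
  then show ?thesis using that[OF a b(2) _ fin] by blast
qed

end

section \<open>Line integrals along Lipschitz paths\<close>

lemma path_length_upper:
  assumes "t 0 = c" "t k = d" "\<And>i. i < k \<Longrightarrow> t i \<le> t (Suc i)"
  shows "ennreal (\<Sum>i<k. dist (p (t (Suc i))) (p (t i))) \<le> path_length p c d"
  unfolding path_length_def
  by (rule SUP_upper2[where i = "(k, t)"]) (use assms in auto)

lemma path_length_least:
  assumes "\<And>k t. t 0 = c \<Longrightarrow> t k = d \<Longrightarrow> (\<And>i. i < k \<Longrightarrow> t i \<le> t (Suc i)) \<Longrightarrow>
    ennreal (\<Sum>i<k. dist (p (t (Suc i))) (p (t i))) \<le> B"
  shows "path_length p c d \<le> B"
  unfolding path_length_def by (rule SUP_least) (use assms in auto)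

lemma path_length_mono:
  assumes "x \<le> y" shows "path_length p c x \<le> path_length p c y"
proof (rule path_length_least)
  fix k t assume t: "t 0 = c" "t k = x" "\<And>i. i < k \<Longrightarrow> t i \<le> t (Suc i)"
  define t' where "t' i = (if i \<le> k then t i else y)" for i
  have "(\<Sum>i<k. dist (p (t (Suc i))) (p (t i))) = (\<Sum>i<k. dist (p (t' (Suc i))) (p (t' i)))"
    by (intro sum.cong) (auto simp: t'_def)
  also have "\<dots> \<le> (\<Sum>i<Suc k. dist (p (t' (Suc i))) (p (t' i)))" by simp
  finally have "ennreal (\<Sum>i<k. dist (p (t (Suc i))) (p (t i)))
      \<le> ennreal (\<Sum>i<Suc k. dist (p (t' (Suc i))) (p (t' i)))" by (rule ennreal_leI)
  also have "\<dots> \<le> path_length p c y"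
    using t assms by (intro path_length_upper) (auto simp: t'_def less_Suc_eq)
  finally show "ennreal (\<Sum>i<k. dist (p (t (Suc i))) (p (t i))) \<le> path_length p c y" .
qed

text \<open>Clipping a partition at \<open>x\<close> by \<open>min\<close> and \<open>max\<close>
  yields partitions of the two pieces. They repeat the point \<open>x\<close>, which contributes
  nothing, and only the step across \<open>x\<close> needs the triangle inequality.\<close>

lemma path_length_split:
  assumes "c \<le> x" "x \<le> y"
  shows "path_length p c y \<le> path_length p c x + path_length p x y"
proof (rule path_length_least)
  fix k t assume t: "t 0 = c" "t k = y" "\<And>i. i < k \<Longrightarrow> t i \<le> t (Suc i)"
  define t1 where "t1 i = min (t i) x" for i
  define t2 where "t2 i = max (t i) x" for i
  have "(\<Sum>i<k. dist (p (t (Suc i))) (p (t i)))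
    \<le> (\<Sum>i<k. dist (p (t1 (Suc i))) (p (t1 i)) + dist (p (t2 (Suc i))) (p (t2 i)))"
  proof (rule sum_mono)
    fix i assume "i \<in> {..<k}"
    then have "t i \<le> t (Suc i)" using t by auto
    then consider "t (Suc i) \<le> x" | "x \<le> t i" | "t i \<le> x" "x \<le> t (Suc i)" by linarith
    then show "dist (p (t (Suc i))) (p (t i)) \<le> dist (p (t1 (Suc i))) (p (t1 i)) + dist (p (t2 (Suc i))) (p (t2 i))"
    proof cases
      case 3
      then show ?thesis using dist_triangle[of "p (t (Suc i))" "p (t i)" "p x"]
        by (simp add: t1_def t2_def min_absorb1 min_absorb2 max_absorb1 max_absorb2)
    qed (use \<open>t i \<le> t (Suc i)\<close> in \<open>auto simp: t1_def t2_def min_def max_def\<close>)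
  qed
  then have "ennreal (\<Sum>i<k. dist (p (t (Suc i))) (p (t i)))
      \<le> ennreal ((\<Sum>i<k. dist (p (t1 (Suc i))) (p (t1 i))) + (\<Sum>i<k. dist (p (t2 (Suc i))) (p (t2 i))))"
    by (intro ennreal_leI) (simp add: sum.distrib)
  also have "\<dots> = ennreal (\<Sum>i<k. dist (p (t1 (Suc i))) (p (t1 i))) + ennreal (\<Sum>i<k. dist (p (t2 (Suc i))) (p (t2 i)))"
    by (intro ennreal_plus sum_nonneg) auto
  also have "\<dots> \<le> path_length p c x + path_length p x y"
    using t assms by (intro add_mono path_length_upper) (auto simp: t1_def t2_def min.coboundedI1 max.coboundedI1)
  finally show "ennreal (\<Sum>i<k. dist (p (t (Suc i))) (p (t i))) \<le> path_length p c x + path_length p x y" .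
qed

lemma path_length_lipschitz:
  assumes lip: "L-lipschitz_on {c..d} p" and cd: "c \<le> d"
  shows "path_length p c d \<le> ennreal (L * (d - c))"
proof (rule path_length_least)
  fix k t assume t: "t 0 = c" "t k = d" "\<And>i. i < k \<Longrightarrow> t i \<le> t (Suc i)"
  have mono: "t i \<le> t j" if "i \<le> j" "j \<le> k" for i j
    using that by (induction j) (auto simp: le_Suc_eq intro: order_trans[OF _ t(3)])
  have tin: "t i \<in> {c..d}" if "i \<le> k" for i using mono[of 0 i] mono[of i k] that t by auto
  have "(\<Sum>i<k. dist (p (t (Suc i))) (p (t i))) \<le> (\<Sum>i<k. L * (t (Suc i) - t i))"
  proof (rule sum_mono)
    fix i assume i: "i \<in> {..<k}"
    have "dist (p (t (Suc i))) (p (t i)) \<le> L * dist (t (Suc i)) (t i)"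
      using i by (intro lipschitz_onD[OF lip] tin) auto
    then show "dist (p (t (Suc i))) (p (t i)) \<le> L * (t (Suc i) - t i)"
      using t(3)[of i] i by (simp add: dist_real_def)
  qed
  also have "\<dots> = L * (\<Sum>i<k. t (Suc i) - t i)" by (simp add: sum_distrib_left)
  also have "\<dots> = L * (d - c)" using t by (simp add: sum_lessThan_telescope)
  finally show "ennreal (\<Sum>i<k. dist (p (t (Suc i))) (p (t i))) \<le> ennreal (L * (d - c))"
    by (rule ennreal_leI)
qed

text \<open>Because \<open>arclen\<close> clamps its argument to \<open>{c..d}\<close>, both
  properties hold on the whole line, as a distribution function requires.\<close>

lemma arclen_lipschitz:
  assumes lip: "L-lipschitz_on {c..d} p" and cd: "c \<le> d" and xy: "x \<le> y"
  shows "arclen p c d x \<le> arclen p c d y" "arclen p c d y - arclen p c d x \<le> L * (y - x)"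
proof -
  define x' where "x' = max c (min d x)"
  define y' where "y' = max c (min d y)"
  have xy': "c \<le> x'" "x' \<le> y'" "y' \<le> d" "y' - x' \<le> y - x" using xy cd by (auto simp: x'_def y'_def)
  have L: "0 \<le> L" using lip by (rule lipschitz_on_nonneg)
  have fin: "path_length p c z < \<infinity>" if "c \<le> z" "z \<le> d" for z
    using path_length_lipschitz[OF lipschitz_on_subset[OF lip, of "{c..z}"]] that
    by (auto simp: le_less_trans[OF _ ennreal_less_top])
  have 1: "path_length p c x' \<le> path_length p c y'" by (rule path_length_mono) (use xy' in auto)
  show "arclen p c d x \<le> arclen p c d y"
    unfolding arclen_def x'_def[symmetric] y'_def[symmetric]
    by (rule enn2real_mono[OF 1]) (use fin[of y'] xy' in auto)
  have "path_length p c y' \<le> path_length p c x' + path_length p x' y'"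
    by (rule path_length_split) (use xy' in auto)
  also have "path_length p x' y' \<le> ennreal (L * (y' - x'))"
    by (rule path_length_lipschitz[OF lipschitz_on_subset[OF lip]]) (use xy' in auto)
  also have "\<dots> \<le> ennreal (L * (y - x))" using L xy' by (intro ennreal_leI mult_left_mono) auto
  finally have "path_length p c y' \<le> path_length p c x' + ennreal (L * (y - x))" by (simp add: add_left_mono)
  moreover have "path_length p c x' = ennreal (arclen p c d x)" "path_length p c y' = ennreal (arclen p c d y)"
    unfolding arclen_def x'_def[symmetric] y'_def[symmetric] using fin xy' by (auto simp: less_top)
  moreover have "0 \<le> arclen p c d x" "0 \<le> L * (y - x)" using L xy by (auto simp: arclen_def)
  ultimately have "arclen p c d y \<le> arclen p c d x + L * (y - x)"
    by (simp add: ennreal_plus[symmetric] del: ennreal_plus)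
  then show "arclen p c d y - arclen p c d x \<le> L * (y - x)" by simp
qed

lemma continuous_of_increments:
  fixes F :: "real \<Rightarrow> real"
  assumes mono: "\<And>x y. x \<le> y \<Longrightarrow> F x \<le> F y" and incr: "\<And>x y. x \<le> y \<Longrightarrow> F y - F x \<le> L * (y - x)"
  shows "continuous (at_right a) F"
proof -
  have "0 \<le> L" using mono[of 0 1] incr[of 0 1] by simp
  have "\<bar>F x - F y\<bar> \<le> L * \<bar>x - y\<bar>" for x y
    using mono[of x y] incr[of x y] mono[of y x] incr[of y x] by (cases "x \<le> y") auto
  then have "L-lipschitz_on UNIV F" using \<open>0 \<le> L\<close> by (auto simp: lipschitz_on_def dist_real_def)
  then have "continuous_on UNIV F" by (rule lipschitz_on_continuous_on)
  then show ?thesis by (meson UNIV_I continuous_at_imp_continuous_at_within continuous_on_eq_continuous_at open_UNIV)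
qed

text \<open>The complementary function \<open>L x - F x\<close> is again a distribution function, and the two
  interval measures add up to \<open>L\<close> times Lebesgue measure.\<close>
lemma nn_integral_interval_measure_le:
  fixes F :: "real \<Rightarrow> real"
  assumes mono: "\<And>x y. x \<le> y \<Longrightarrow> F x \<le> F y" and incr: "\<And>x y. x \<le> y \<Longrightarrow> F y - F x \<le> L * (y - x)"
    and h: "h \<in> borel_measurable borel"
  shows "(\<integral>\<^sup>+ x. h x \<partial>interval_measure F) \<le> ennreal L * (\<integral>\<^sup>+ x. h x \<partial>lborel)"
proof -
  have L: "0 \<le> L" using mono[of 0 1] incr[of 0 1] by simp
  define G where "G x = L * x - F x" for x
  have monoG: "G x \<le> G y" if "x \<le> y" for x y using incr[OF that] by (simp add: G_def algebra_simps)
  have incrG: "G y - G x \<le> L * (y - x)" if "x \<le> y" for x y using mono[OF that] by (simp add: G_def algebra_simps)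
  note cF = continuous_of_increments[of F L, OF mono incr]
  note cG = continuous_of_increments[of G L, OF monoG incrG]
  let ?m = "\<lambda>A. emeasure (interval_measure F) A + emeasure (interval_measure G) A"
  define N where "N = measure_of UNIV (sets borel) (\<lambda>A. ?m A)"
  have setsN: "sets N = sets borel"
    unfolding N_def using sets.sigma_sets_eq[of "borel :: real measure"] by simp
  have emN: "emeasure N A = ?m A" if "A \<in> sets borel" for A
    unfolding N_def
  proof (rule emeasure_measure_of_sigma)
    show "sigma_algebra UNIV (sets (borel :: real measure))" using sets.sigma_algebra_axioms[of "borel :: real measure"] by simp
    show "positive (sets borel) (\<lambda>A. ?m A)"
      by (simp add: positive_def)
    show "countably_additive (sets borel) (\<lambda>A. ?m A)"
    proof (rule countably_additiveI)
      fix A :: "nat \<Rightarrow> real set" assume A: "range A \<subseteq> sets borel" "disjoint_family A" "\<Union> (range A) \<in> sets borel"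
      show "(\<Sum>i. emeasure (interval_measure F) (A i) + emeasure (interval_measure G) (A i))
        = emeasure (interval_measure F) (\<Union> (range A)) + emeasure (interval_measure G) (\<Union> (range A))"
        using A by (subst suminf_add[symmetric]) (auto simp: suminf_emeasure)
    qed
  qed (use that in auto)
  have Ioc: "sets (borel :: real measure) = sigma_sets UNIV (range (\<lambda>(a, b). {a<..b}))"
    by (subst borel_sigma_sets_Ioc, rule sets_measure_of) simp
  have "N = density lborel (\<lambda>_. ennreal L)"
  proof (rule measure_eqI_generator_eq[where E = "range (\<lambda>(a, b). {a<..b})" and \<Omega> = UNIV and A = "\<lambda>n. {- real n<..real n}"])
    have *: "emeasure N {a<..b} = emeasure (density lborel (\<lambda>_. ennreal L)) {a<..b}" for a b
    proof (cases "a \<le> b")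
      case True
      have "emeasure N {a<..b} = ennreal (F b - F a) + ennreal (G b - G a)"
        using True by (simp add: emN emeasure_interval_measure_Ioc mono monoG cF cG)
      also have "\<dots> = ennreal (L * (b - a))"
        using True mono[OF True] monoG[OF True] by (simp add: ennreal_plus[symmetric] G_def algebra_simps del: ennreal_plus)
      also have "\<dots> = emeasure (density lborel (\<lambda>_. ennreal L)) {a<..b}"
        using True L by (simp add: emeasure_density nn_integral_cmult_indicator ennreal_mult)
      finally show ?thesis .
    qed simp
    show "\<And>X. X \<in> range (\<lambda>(a, b). {a<..b}) \<Longrightarrow> emeasure N X = emeasure (density lborel (\<lambda>_. ennreal L)) X"
      using * by auto
    show "Int_stable (range (\<lambda>(a, b). {a<..b::real}))"
    proof (rule Int_stableI)
      fix x y assume "x \<in> range (\<lambda>(a, b). {a<..b::real})" "y \<in> range (\<lambda>(a, b). {a<..b::real})"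
      then obtain a b c d where "x = {a<..b}" "y = {c<..d}" by auto
      then have "x \<inter> y = (\<lambda>(a, b). {a<..b}) (max a c, min b d)" by auto
      then show "x \<inter> y \<in> range (\<lambda>(a, b). {a<..b::real})" by blast
    qed
    show "emeasure N {- real n<..real n} \<noteq> \<infinity>" for n
      unfolding * using L by (simp add: emeasure_density nn_integral_cmult_indicator ennreal_mult_eq_top_iff)
    show "sets N = sigma_sets UNIV (range (\<lambda>(a, b). {a<..b}))"
      unfolding setsN by (rule Ioc)
    show "sets (density (lborel :: real measure) (\<lambda>_. ennreal L)) = sigma_sets UNIV (range (\<lambda>(a, b). {a<..b}))"
      using Ioc by simp
    show "(\<Union>n. {- real n<..real n}) = UNIV"
    proof (safe; simp)
      fix x :: real
      obtain n where "\<bar>x\<bar> < real n" using reals_Archimedean2 by blast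
      then show "\<exists>n. - real n < x \<and> x \<le> real n" by (intro exI[of _ n]) auto
    qed
  qed auto
  then have "interval_measure F \<le> density lborel (\<lambda>_. ennreal L)"
    using emN by (subst le_measure) (auto simp: setsN)
  then have "(\<integral>\<^sup>+ x. h x \<partial>interval_measure F) \<le> (\<integral>\<^sup>+ x. h x \<partial>density lborel (\<lambda>_. ennreal L))"
    by (intro nn_integral_mono_measure) auto
  also have "\<dots> = ennreal L * (\<integral>\<^sup>+ x. h x \<partial>lborel)"
    using h by (simp add: nn_integral_density nn_integral_cmult)
  finally show ?thesis .
qed

text \<open>The path is controlled on \<open>{c..d}\<close> only; clamping the parameter replaces it
  by a path continuous on the whole line with the same values there.\<close>

lemma measurable_path_comp:
  fixes p :: "real \<Rightarrow> 'a::euclidean_space" and \<rho> :: "'a \<Rightarrow> ennreal"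
  assumes p: "continuous_on {c..d} p" and \<rho>: "\<rho> \<in> borel_measurable borel" and cd: "c \<le> d"
  shows "(\<lambda>t. \<rho> (p t) * indicator {c..d} t) \<in> borel_measurable borel"
proof -
  have "continuous_on UNIV (\<lambda>t. p (max c (min d t)))"
    by (rule continuous_on_compose2[OF p]) (use cd in \<open>auto intro!: continuous_intros\<close>)
  then have [measurable]: "(\<lambda>t. p (max c (min d t))) \<in> borel_measurable borel"
    by (rule borel_measurable_continuous_onI)
  note \<rho>[measurable]
  have "(\<lambda>t. \<rho> (p t) * indicator {c..d} t) = (\<lambda>t. \<rho> (p (max c (min d t))) * indicator {c..d} t)"
    by (auto simp: indicator_def min_def max_def)
  then show ?thesis by simp
qed

lemma line_int_lipschitz:
  assumes lip: "L-lipschitz_on {c..d} p" and cd: "c \<le> d" and \<rho>: "\<rho> \<in> borel_measurable borel"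
  shows "line_int \<rho> p c d \<le> ennreal L * (\<integral>\<^sup>+ t. \<rho> (p t) * indicator {c..d} t \<partial>lborel)"
  unfolding line_int_def
  by (rule nn_integral_interval_measure_le[OF arclen_lipschitz[OF lip cd]
        measurable_path_comp[OF lipschitz_on_continuous_on[OF lip] \<rho> cd]])

text \<open>The reparametrised subpath has Lipschitz constant \<open>L * (b - a)\<close>, and
  substitution cancels the factor \<open>b - a\<close>. The resulting bound concerns all of \<beta>
  and does not see how short the lifted piece is, so nothing need be known about \<open>a\<close>
  and \<open>b\<close>.\<close>

lemma admissible_lipschitz_subpath:
  assumes adm: "admissible \<rho> (image_family f D \<Gamma>)" and \<gamma>: "\<gamma> \<in> \<Gamma>" and ab: "0 \<le> a" "a < b" "b \<le> 1"
    and f: "\<And>t. t \<in> {0..1} \<Longrightarrow> \<gamma> t \<in> D \<and> f (\<gamma> t) = Some (\<beta> (a + (b - a) * t))"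
    and lip: "L-lipschitz_on {0..1} \<beta>"
  shows "1 \<le> ennreal L * (\<integral>\<^sup>+ t. \<rho> (\<beta> t) * indicator {0..1} t \<partial>lborel)"
proof -
  let ?I = "\<integral>\<^sup>+ t. \<rho> (\<beta> t) * indicator {0..1} t \<partial>lborel"
  define s where "s t = a + (b - a) * t" for t
  define \<gamma>' where "\<gamma>' = ({t\<in>{0..1}. \<gamma> t \<in> D}, \<lambda>t. f (\<gamma> t))"
  have fst: "fst \<gamma>' = {0..1}" using f by (auto simp: \<gamma>'_def)
  have \<rho>[measurable]: "\<rho> \<in> borel_measurable borel" using adm by (simp add: admissible_def)
  have L: "0 \<le> L" using lip by (rule lipschitz_on_nonneg)
  have \<beta>c: "continuous_on {0..1} \<beta>" using lip by (rule lipschitz_on_continuous_on)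
  have sin: "s t \<in> {a..b}" if "t \<in> {0..1}" for t
    unfolding s_def using ab by (intro affine_in_interval that) auto
  have snd: "the (snd \<gamma>' t) = \<beta> (s t)" if "t \<in> {0..1}" for t
    using f[OF that] by (simp add: \<gamma>'_def s_def)
  have lip': "(L * (b - a))-lipschitz_on {c..d} (\<lambda>t. the (snd \<gamma>' t))" if cd: "finite_subint (fst \<gamma>') (snd \<gamma>') c d" for c d
  proof (rule lipschitz_onI)
    fix x y assume "x \<in> {c..d}" "y \<in> {c..d}"
    then have xy: "x \<in> {0..1}" "y \<in> {0..1}" using cd fst by (auto simp: finite_subint_def)
    have "dist (\<beta> (s x)) (\<beta> (s y)) \<le> L * dist (s x) (s y)"
      using sin[OF xy(1)] sin[OF xy(2)] ab by (intro lipschitz_onD[OF lip]) auto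
    also have "dist (s x) (s y) = (b - a) * dist x y"
      using ab by (simp add: s_def dist_real_def abs_mult right_diff_distrib[symmetric])
    finally show "dist (the (snd \<gamma>' x)) (the (snd \<gamma>' y)) \<le> L * (b - a) * dist x y"
      using snd xy by (simp add: mult.assoc)
  qed (use L ab in auto)
  have "loc_rectifiable \<gamma>'"
    unfolding loc_rectifiable_def
  proof (intro allI impI)
    fix c d assume cd: "finite_subint (fst \<gamma>') (snd \<gamma>') c d"
    then have "c \<le> d" by (simp add: finite_subint_def)
    then show "path_length (\<lambda>t. the (snd \<gamma>' t)) c d < \<infinity>"
      using path_length_lipschitz[OF lip'[OF cd]] by (auto simp: le_less_trans[OF _ ennreal_less_top])
  qed
  moreover have "\<gamma>' \<in> image_family f D \<Gamma>" using \<gamma> unfolding image_family_def \<gamma>'_def by blast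
  ultimately have "1 \<le> path_int \<rho> \<gamma>'" using adm by (simp add: admissible_def)
  also have "\<dots> \<le> ennreal L * ?I"
    unfolding path_int_def
  proof (rule SUP_least, clarify)
    fix c d assume cd: "finite_subint (fst \<gamma>') (snd \<gamma>') c d"
    then have cd': "c \<le> d" "{c..d} \<subseteq> {0..1}" by (auto simp: finite_subint_def fst)
    have m: "(\<lambda>t. \<rho> (\<beta> t) * indicator {a..b} t) \<in> borel_measurable borel"
      by (rule measurable_path_comp) (use \<beta>c ab in \<open>auto intro: continuous_on_subset\<close>)
    have "line_int \<rho> (\<lambda>t. the (snd \<gamma>' t)) c d
        \<le> ennreal (L * (b - a)) * (\<integral>\<^sup>+ t. \<rho> (the (snd \<gamma>' t)) * indicator {c..d} t \<partial>lborel)"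
      by (rule line_int_lipschitz[OF lip'[OF cd] cd'(1) \<rho>])
    also have "(\<integral>\<^sup>+ t. \<rho> (the (snd \<gamma>' t)) * indicator {c..d} t \<partial>lborel)
        \<le> (\<integral>\<^sup>+ t. \<rho> (\<beta> (a + (b - a) * t)) * indicator {a..b} (a + (b - a) * t) \<partial>lborel)"
      using snd sin cd'(2) by (intro nn_integral_mono) (auto simp: indicator_def s_def subset_iff)
    also have "ennreal (L * (b - a)) * \<dots> = ennreal L * (ennreal \<bar>b - a\<bar> * (\<integral>\<^sup>+ t. \<rho> (\<beta> (a + (b - a) * t)) * indicator {a..b} (a + (b - a) * t) \<partial>lborel))"
      using L ab by (simp add: ennreal_mult mult.assoc)
    also have "\<dots> = ennreal L * (\<integral>\<^sup>+ t. \<rho> (\<beta> t) * indicator {a..b} t \<partial>lborel)"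
      using ab by (subst nn_integral_real_affine[OF m, of "b - a" a]) auto
    also have "\<dots> \<le> ennreal L * ?I"
      using ab by (intro mult_left_mono nn_integral_mono) (auto simp: indicator_def)
    finally show "line_int \<rho> (\<lambda>t. the (snd \<gamma>' t)) c d \<le> ennreal L * ?I"
      by (auto simp: mult_left_mono)
  qed
  finally show ?thesis .
qed

section \<open>Polar coordinates\<close>

lemma cball_in_borel [measurable]: "cball (a::'a::metric_space) r \<in> sets borel"
  by simp

lemma nn_integral_lborel_scale:
  fixes g :: "'a::euclidean_space \<Rightarrow> ennreal"
  assumes [measurable]: "g \<in> borel_measurable borel" and r: "r > 0"
  shows "(\<integral>\<^sup>+ x. g x \<partial>lborel) = (\<integral>\<^sup>+ x. ennreal (r ^ DIM('a)) * g (t + r *\<^sub>R x) \<partial>lborel)"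
  using r by (subst lborel_affine[of r t])
     (auto simp: nn_integral_density nn_integral_distr)

lemma nn_integral_inverse_power:
  fixes a :: real assumes a: "a > 0" and n: "n > 0"
  shows "(\<integral>\<^sup>+ s. ennreal (1 / s ^ Suc n) * indicator {a..} s \<partial>lborel) = ennreal (1 / (real n * a ^ n))"
proof -
  have "(\<integral>\<^sup>+ s. ennreal (inverse s ^ Suc n) * indicator {a..} s \<partial>lborel) = ennreal (0 - (- (1 / real n) * inverse a ^ n))"
  proof (rule nn_integral_FTC_atLeast[where F = "\<lambda>s. - (1 / real n) * inverse s ^ n"])
    fix s assume s: "a \<le> s"
    obtain m where m: "n = Suc m" using n by (cases n) auto
    have "- (1 / real n) * (real n * (- (inverse s ^ Suc (Suc 0)) * inverse s ^ (n - Suc 0))) = inverse s ^ Suc n"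
      using n by (simp add: m)
    then show "((\<lambda>s. - (1 / real n) * inverse s ^ n) has_real_derivative inverse s ^ Suc n) (at s)"
      using DERIV_cmult[OF DERIV_power[OF DERIV_inverse[of s], of n], of "- (1 / real n)"] s a by simp
    show "0 \<le> inverse s ^ Suc n" using s a by simp
  next
    have "((\<lambda>s. - (1 / real n) * inverse s ^ n) \<longlongrightarrow> - (1 / real n) * 0 ^ n) at_top"
      by (intro tendsto_intros tendsto_inverse_0_at_top filterlim_ident)
    then show "((\<lambda>s. - (1 / real n) * inverse s ^ n) \<longlongrightarrow> 0) at_top" using n by (simp add: power_0_left)
  qed auto
  then show ?thesis by (simp add: divide_inverse power_inverse del: power_Suc)
qed

text \<open>Polar coordinates without a surface measure: the direction is averaged over the unit ball.\<close>
lemma nn_integral_polar: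
  fixes g :: "'a::euclidean_space \<Rightarrow> ennreal"
  assumes g[measurable]: "g \<in> borel_measurable borel"
  shows "(\<integral>\<^sup>+ x. g x \<partial>lborel) = of_nat DIM('a) *
    (\<integral>\<^sup>+ y. indicator (cball 0 1) y *
       (\<integral>\<^sup>+ s. g (s *\<^sub>R sgn y) * ennreal (s ^ (DIM('a) - 1)) * indicator {0<..} s \<partial>lborel) \<partial>lborel)"
proof -
  let ?n = "DIM('a)"
  let ?R = "\<lambda>y s. g (s *\<^sub>R sgn y) * ennreal (s ^ (?n - 1)) * indicator {0<..} s"
  let ?P = "\<lambda>l y. g (l *\<^sub>R y) * ennreal (norm y ^ ?n) * ennreal (l ^ (?n - 1)) * indicator {0<..} l"
  let ?S = "\<lambda>l x. g x * ennreal (norm x ^ ?n) * (ennreal (1 / l ^ Suc ?n) * indicator {norm x..} l) * indicator {0<..} l"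
  have n: "?n > 0" by simp
  \<comment> \<open>With \<open>s = norm y * l\<close> the direction \<open>sgn y\<close> becomes
    the vector \<open>y\<close>. For fixed \<open>l\<close> the integral over \<open>y\<close> is
    then a dilation \<open>x = l y\<close>, and after interchanging the order the integral of
    \<open>1 / l ^ Suc n\<close> over \<open>l \<ge> norm x\<close> leaves
    \<open>1 / (n * norm x ^ n)\<close>, where \<open>n\<close> is the dimension. This is the origin
    of the factor \<open>DIM('a)\<close>.\<close>
  have inner: "(\<integral>\<^sup>+ s. ?R y s \<partial>lborel)
     = (\<integral>\<^sup>+ l. ?P l y \<partial>lborel)"
    if y: "y \<noteq> 0" for y
  proof -
    have "(\<integral>\<^sup>+ s. ?R y s \<partial>lborel)
      = ennreal \<bar>norm y\<bar> * (\<integral>\<^sup>+ l. ?R y (0 + norm y * l) \<partial>lborel)"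
      using y by (intro nn_integral_real_affine) auto
    also have "\<dots> = (\<integral>\<^sup>+ l. ennreal \<bar>norm y\<bar> * (?R y (0 + norm y * l)) \<partial>lborel)"
      by (intro nn_integral_cmult[symmetric]) measurable
    also have "\<dots> = (\<integral>\<^sup>+ l. ?P l y \<partial>lborel)"
    proof (intro nn_integral_cong)
      fix l :: real
      show "ennreal \<bar>norm y\<bar> * (?R y (0 + norm y * l))
        = ?P l y"
      proof (cases "l > 0")
        case True
        have e: "(0 + norm y * l) *\<^sub>R sgn y = l *\<^sub>R y" using y by (simp add: sgn_div_norm)
        have p: "norm y ^ ?n = norm y * norm y ^ (?n - 1)" using n by (metis power_minus_mult mult.commute)
        show ?thesis unfolding e p using True y
          by (simp add: power_mult_distrib ennreal_mult indicator_def ac_simps)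
      qed (use y in \<open>simp add: indicator_def zero_less_mult_iff\<close>)
    qed
    finally show ?thesis .
  qed
  have scl: "(\<integral>\<^sup>+ y. indicator (cball 0 1) y * (?P l y) \<partial>lborel)
     = (\<integral>\<^sup>+ x. ?S l x \<partial>lborel)" for l :: real
  proof (cases "l > 0")
    case True
    have "(\<integral>\<^sup>+ x. ?S l x \<partial>lborel)
     = (\<integral>\<^sup>+ y. ennreal (l ^ ?n) * (?S l (0 + l *\<^sub>R y)) \<partial>lborel)"
      using True by (intro nn_integral_lborel_scale) (auto simp: indicator_def)
    also have "\<dots> = (\<integral>\<^sup>+ y. indicator (cball 0 1) y * (?P l y) \<partial>lborel)"
    proof (intro nn_integral_cong)
      fix y :: 'a
      have i: "indicator {norm (0 + l *\<^sub>R y)..} l = (indicator (cball 0 1) y :: ennreal)"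
        using True by (auto simp: indicator_def)
      have "l ^ ?n = l * l ^ (?n - 1)" using n by (metis power_minus_mult mult.commute)
      then have "l ^ ?n * (norm (0 + l *\<^sub>R y) ^ ?n * (1 / l ^ Suc ?n)) = norm y ^ ?n * l ^ (?n - 1)"
        using True by (simp add: power_mult_distrib field_simps)
      then have e: "ennreal (l ^ ?n) * (ennreal (norm (0 + l *\<^sub>R y) ^ ?n) * ennreal (1 / l ^ Suc ?n)) = ennreal (norm y ^ ?n) * ennreal (l ^ (?n - 1))"
        using True by (simp add: ennreal_mult[symmetric] del: power_Suc)
      have "ennreal (l ^ ?n) * (?S l (0 + l *\<^sub>R y))
        = g (0 + l *\<^sub>R y) * (ennreal (l ^ ?n) * (ennreal (norm (0 + l *\<^sub>R y) ^ ?n) * ennreal (1 / l ^ Suc ?n))) * indicator {norm (0 + l *\<^sub>R y)..} l * indicator {0<..} l"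
        by (simp only: ac_simps)
      also have "\<dots> = indicator (cball 0 1) y * (?P l y)"
        by (simp only: e i) (simp only: add_0_left ac_simps)
      finally show "ennreal (l ^ ?n) * (?S l (0 + l *\<^sub>R y))
        = indicator (cball 0 1) y * (?P l y)" .
    qed
    finally show ?thesis by simp
  qed simp
  have "(\<integral>\<^sup>+ y. indicator (cball 0 1) y *
       (\<integral>\<^sup>+ s. ?R y s \<partial>lborel) \<partial>lborel)
    = (\<integral>\<^sup>+ y. indicator (cball 0 1) y *
       (\<integral>\<^sup>+ l. ?P l y \<partial>lborel) \<partial>lborel)"
  proof (intro nn_integral_cong_AE eventually_mono[OF AE_lborel_singleton[of 0]])
    fix y :: 'a assume "y \<noteq> 0"
    show "indicator (cball 0 1) y *
       (\<integral>\<^sup>+ s. ?R y s \<partial>lborel) = indicator (cball 0 1) y *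
       (\<integral>\<^sup>+ l. ?P l y \<partial>lborel)"
      unfolding inner[OF \<open>y \<noteq> 0\<close>] ..
  qed
  also have "\<dots> = (\<integral>\<^sup>+ y. \<integral>\<^sup>+ l. indicator (cball 0 1) y * (?P l y) \<partial>lborel \<partial>lborel)"
    by (intro nn_integral_cong nn_integral_cmult[symmetric]) measurable
  also have "\<dots> = (\<integral>\<^sup>+ l. \<integral>\<^sup>+ y. indicator (cball 0 1) y * (?P l y) \<partial>lborel \<partial>lborel)"
    by (intro lborel_pair.Fubini') measurable
  also have "\<dots> = (\<integral>\<^sup>+ l. \<integral>\<^sup>+ x. ?S l x \<partial>lborel \<partial>lborel)"
    unfolding scl ..
  also have "\<dots> = (\<integral>\<^sup>+ x. \<integral>\<^sup>+ l. ?S l x \<partial>lborel \<partial>lborel)"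
    by (intro lborel_pair.Fubini') (simp add: indicator_def)
  also have "\<dots> = (\<integral>\<^sup>+ x. g x * ennreal (1 / real ?n) \<partial>lborel)"
  proof (intro nn_integral_cong_AE eventually_mono[OF AE_lborel_singleton[of 0]])
    fix x :: 'a assume x: "x \<noteq> 0"
    have "(\<integral>\<^sup>+ l. ?S l x \<partial>lborel)
      = (\<integral>\<^sup>+ l. g x * ennreal (norm x ^ ?n) * (ennreal (1 / l ^ Suc ?n) * indicator {norm x..} l) \<partial>lborel)"
      using x[folded zero_less_norm_iff] by (intro nn_integral_cong) (auto simp: indicator_def simp del: zero_less_norm_iff)
    also have "\<dots> = g x * ennreal (norm x ^ ?n) * ennreal (1 / (real ?n * norm x ^ ?n))"
      using x by (subst nn_integral_cmult) (auto simp: nn_integral_inverse_power simp del: power_Suc)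
    also have "\<dots> = g x * ennreal (norm x ^ ?n * (1 / (real ?n * norm x ^ ?n)))"
      by (subst ennreal_mult, simp, simp, simp only: mult.assoc)
    also have "norm x ^ ?n * (1 / (real ?n * norm x ^ ?n)) = 1 / real ?n" using x by simp
    finally show "(\<integral>\<^sup>+ l. ?S l x \<partial>lborel) = g x * ennreal (1 / real ?n)" .
  qed
  also have "\<dots> = ennreal (1 / real ?n) * (\<integral>\<^sup>+ x. g x \<partial>lborel)"
    by (simp add: nn_integral_multc mult.commute)
  finally have *: "(\<integral>\<^sup>+ y. indicator (cball 0 1) y *
       (\<integral>\<^sup>+ s. ?R y s \<partial>lborel) \<partial>lborel) = ennreal (1 / real ?n) * (\<integral>\<^sup>+ x. g x \<partial>lborel)" .
  have "of_nat ?n * ennreal (1 / real ?n) = 1"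
    by (simp add: ennreal_of_nat_eq_real_of_nat ennreal_mult[symmetric])
  then show ?thesis unfolding * by (simp add: mult.assoc[symmetric])
qed

text \<open>The second factor plays the role of the surface integral of \<open>h\<close> over the
  unit sphere; the lemma passes to it from an integral with any radial weight.\<close>

lemma nn_integral_radial_direction:
  fixes h :: "'a::euclidean_space \<Rightarrow> ennreal" and w :: "real \<Rightarrow> ennreal"
  assumes [measurable]: "h \<in> borel_measurable borel" "w \<in> borel_measurable borel"
  shows "(\<integral>\<^sup>+ z. w (norm z) * h (sgn z) \<partial>lborel)
    = (\<integral>\<^sup>+ s. w s * ennreal (s ^ (DIM('a) - 1)) * indicator {0<..} s \<partial>lborel)
      * (of_nat DIM('a) * (\<integral>\<^sup>+ y. indicator (cball 0 1) y * h (sgn y) \<partial>lborel))"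
proof -
  let ?n = "DIM('a)"
  let ?F = "\<lambda>y s. w (norm (s *\<^sub>R sgn y)) * h (sgn (s *\<^sub>R sgn y)) * ennreal (s ^ (?n - 1)) * indicator {0<..} s"
  let ?C = "\<integral>\<^sup>+ s. w s * ennreal (s ^ (?n - 1)) * indicator {0<..} s \<partial>lborel"
  have *: "(\<integral>\<^sup>+ z. w (norm z) * h (sgn z) \<partial>lborel) = of_nat ?n *
    (\<integral>\<^sup>+ y. indicator (cball 0 1) y *
       (\<integral>\<^sup>+ s. ?F y s \<partial>lborel) \<partial>lborel)"
    by (rule nn_integral_polar) measurable
  have "(\<integral>\<^sup>+ y. indicator (cball 0 1) y *
       (\<integral>\<^sup>+ s. ?F y s \<partial>lborel) \<partial>lborel)
    = (\<integral>\<^sup>+ y. indicator (cball 0 1) y * (h (sgn y) * ?C) \<partial>lborel)"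
  proof (intro nn_integral_cong_AE eventually_mono[OF AE_lborel_singleton[of 0]])
    fix y :: 'a assume y: "y \<noteq> 0"
    have "(\<integral>\<^sup>+ s. ?F y s \<partial>lborel)
      = (\<integral>\<^sup>+ s. h (sgn y) * (w s * ennreal (s ^ (?n - 1)) * indicator {0<..} s) \<partial>lborel)"
    proof (intro nn_integral_cong)
      fix s :: real
      have "sgn (sgn y) = sgn y" by (cases "y = 0") (auto simp: sgn_div_norm)
      then show "?F y s
        = h (sgn y) * (w s * ennreal (s ^ (?n - 1)) * indicator {0<..} s)"
        using y by (cases "s > 0") (simp_all add: sgn_scaleR norm_sgn ac_simps)
    qed
    also have "\<dots> = h (sgn y) * ?C" by (intro nn_integral_cmult) measurable
    finally show "indicator (cball 0 1) y * (\<integral>\<^sup>+ s. ?F y s \<partial>lborel)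
      = indicator (cball 0 1) y * (h (sgn y) * ?C)" by simp
  qed
  also have "\<dots> = (\<integral>\<^sup>+ y. ?C * (indicator (cball 0 1) y * h (sgn y)) \<partial>lborel)"
    by (simp only: ac_simps)
  also have "\<dots> = ?C * (\<integral>\<^sup>+ y. indicator (cball 0 1) y * h (sgn y) \<partial>lborel)"
    by (intro nn_integral_cmult) measurable
  finally show ?thesis unfolding * by (simp only: ac_simps)
qed

section \<open>Connecting two points of the unit sphere\<close>

text \<open>The value at \<open>s = 1\<close> is infinite, so that the weight dominates \<open>norm (z - a) powr (-1/2)\<close>
  for unit vectors \<open>a\<close> without exception on the unit sphere.\<close>
definition shell_weight :: "real \<Rightarrow> ennreal" where
  "shell_weight s = inverse (ennreal (sqrt \<bar>s - 1\<bar>)) * indicator {1/4..2} s"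

lemma measurable_shell_weight [measurable]: "shell_weight \<in> borel_measurable borel"
  unfolding shell_weight_def[abs_def] by measurable

lemma nn_integral_powr_from_0:
  assumes "p > -1" "c \<ge> 0"
  shows "(\<integral>\<^sup>+ x. ennreal (x powr p) * indicator {0..c} x \<partial>lborel) = ennreal (c powr (p + 1) / (p + 1))"
  using nn_integral_has_integral_lebesgue'[OF _ has_integral_powr_from_0[OF assms]] by simp

lemma inverse_sqrt_powr: "s > 0 \<Longrightarrow> inverse (ennreal (sqrt s)) = ennreal (s powr (-1/2))"
  by (simp add: inverse_ennreal powr_minus powr_half_sqrt)

lemma shell_weight_integral_finite:
  "(\<integral>\<^sup>+ s. shell_weight s * ennreal (s ^ m) * indicator {0<..} s \<partial>lborel) < \<infinity>"
proof -
  \<comment> \<open>On both sides of the singularity at 1 the weight is dominated by a translate or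
    a reflection of the integrable function \<open>v\<close>.\<close>
  define v where "v x = ennreal (x powr (-1/2)) * indicator {0..1} x" for x :: real
  have [measurable]: "v \<in> borel_measurable borel" unfolding v_def[abs_def] by measurable
  have v: "(\<integral>\<^sup>+ x. v x \<partial>lborel) < \<infinity>"
    unfolding v_def by (subst nn_integral_powr_from_0) auto
  have "(\<integral>\<^sup>+ s. shell_weight s * ennreal (s ^ m) * indicator {0<..} s \<partial>lborel)
      \<le> (\<integral>\<^sup>+ s. ennreal (2 ^ m) * (v (-1 + 1 * s) + v (1 + (-1) * s)) \<partial>lborel)"
  proof (intro nn_integral_mono_AE eventually_mono[OF AE_lborel_singleton[of 1]])
    fix s :: real assume s: "s \<noteq> 1"
    show "shell_weight s * ennreal (s ^ m) * indicator {0<..} s \<le> ennreal (2 ^ m) * (v (-1 + 1 * s) + v (1 + (-1) * s))"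
    proof (cases "1/4 \<le> s \<and> s \<le> 2")
      case True
      have "inverse (ennreal (sqrt \<bar>s - 1\<bar>)) \<le> v (-1 + 1 * s) + v (1 + (-1) * s)"
        using s True inverse_sqrt_powr[of "\<bar>s - 1\<bar>"] by (cases "s > 1") (auto simp: v_def)
      moreover have "ennreal (s ^ m) \<le> ennreal (2 ^ m)" using True by (intro ennreal_leI power_mono) auto
      ultimately show ?thesis using True by (simp add: shell_weight_def mult.commute mult_mono)
    qed (simp add: shell_weight_def)
  qed
  also have "\<dots> = ennreal (2 ^ m) * ((\<integral>\<^sup>+ s. v (-1 + 1 * s) \<partial>lborel) + (\<integral>\<^sup>+ s. v (1 + (-1) * s) \<partial>lborel))"
    by (subst nn_integral_cmult) (auto intro!: arg_cong2[where f = "(*)"] nn_integral_add)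
  also have "(\<integral>\<^sup>+ s. v (-1 + 1 * s) \<partial>lborel) = (\<integral>\<^sup>+ x. v x \<partial>lborel)"
    using nn_integral_real_affine[of v 1 "-1"] by simp
  also have "(\<integral>\<^sup>+ s. v (1 + (-1) * s) \<partial>lborel) = (\<integral>\<^sup>+ x. v x \<partial>lborel)"
    using nn_integral_real_affine[of v "-1" 1] by simp
  also have "ennreal (2 ^ m) * ((\<integral>\<^sup>+ x. v x \<partial>lborel) + (\<integral>\<^sup>+ x. v x \<partial>lborel)) < \<infinity>"
    using v by (auto simp: ennreal_mult_less_top)
  finally show ?thesis .
qed

lemma riesz_integral_finite:
  assumes b: "b > 0"
  shows "(\<integral>\<^sup>+ x. ennreal (norm (x::'a::euclidean_space) powr (b - real DIM('a))) * indicator (cball 0 r) x \<partial>lborel) < \<infinity>"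
proof -
  let ?n = "DIM('a)"
  define w where "w s = ennreal (s powr (b - real ?n)) * indicator {0..\<bar>r\<bar>} s" for s :: real
  have [measurable]: "w \<in> borel_measurable borel" unfolding w_def[abs_def] by measurable
  have "(\<integral>\<^sup>+ x. ennreal (norm (x::'a) powr (b - real ?n)) * indicator (cball 0 r) x \<partial>lborel)
     \<le> (\<integral>\<^sup>+ (z::'a). w (norm z) * 1 \<partial>lborel)"
    by (intro nn_integral_mono) (auto simp: w_def indicator_def)
  also have "\<dots> = (\<integral>\<^sup>+ s. w s * ennreal (s ^ (?n - 1)) * indicator {0<..} s \<partial>lborel)
      * (of_nat ?n * (\<integral>\<^sup>+ (y::'a). indicator (cball 0 1) y * 1 \<partial>lborel))"
    by (rule nn_integral_radial_direction[where h = "\<lambda>_. 1"]) auto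
  also have "\<dots> < \<infinity>"
  proof -
    have "(\<integral>\<^sup>+ s. w s * ennreal (s ^ (?n - 1)) * indicator {0<..} s \<partial>lborel)
        \<le> (\<integral>\<^sup>+ s. ennreal (s powr (b - 1)) * indicator {0..\<bar>r\<bar>} s \<partial>lborel)"
    proof (intro nn_integral_mono)
      fix s :: real
      show "w s * ennreal (s ^ (?n - 1)) * indicator {0<..} s \<le> ennreal (s powr (b - 1)) * indicator {0..\<bar>r\<bar>} s"
      proof (cases "0 < s")
        case True
        have "s powr (b - real ?n) * s ^ (?n - 1) = s powr (b - real ?n + real (?n - 1))"
          using True by (simp only: powr_add powr_realpow)
        also have "b - real ?n + real (?n - 1) = b - 1" by (simp add: of_nat_diff Suc_leI)
        finally have "ennreal (s powr (b - real ?n)) * ennreal (s ^ (?n - 1)) = ennreal (s powr (b - 1))"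
          using True by (simp add: ennreal_mult[symmetric])
        then show ?thesis using True by (simp add: w_def indicator_def)
      qed simp
    qed
    also have "\<dots> < \<infinity>" using b by (subst nn_integral_powr_from_0) auto
    finally show ?thesis
      using emeasure_lborel_cball_finite[of "0::'a" 1] by (auto simp: ennreal_mult_less_top ennreal_of_nat_eq_real_of_nat)
  qed
  finally show ?thesis .
qed

text \<open>Averaging segment integrals over the end point produces a Riesz potential at
  \<open>a\<close>: for fixed \<open>t\<close> the substitution \<open>z = a + t (y - a)\<close>
  costs \<open>1 / t ^ DIM('a)\<close>, only \<open>t \<ge> dist z a / 3\<close> can occur, and
  integration over these \<open>t\<close> gives the kernel.\<close>

lemma segment_average_le:
  fixes G :: "'a::euclidean_space \<Rightarrow> ennreal"
  assumes n2: "DIM('a) \<ge> 2" and G[measurable]: "G \<in> borel_measurable borel"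
    and Y[measurable]: "Y \<in> sets borel"
    and shell: "\<And>y t. y \<in> Y \<Longrightarrow> t \<in> {0..1} \<Longrightarrow> 1/4 \<le> norm (a + t *\<^sub>R (y - a)) \<and> norm (a + t *\<^sub>R (y - a)) \<le> 2"
    and near: "\<And>y. y \<in> Y \<Longrightarrow> dist y a \<le> 3"
  shows "(\<integral>\<^sup>+ y. indicator Y y * (\<integral>\<^sup>+ t. G (a + t *\<^sub>R (y - a)) * indicator {0..1} t \<partial>lborel) \<partial>lborel)
    \<le> (\<integral>\<^sup>+ z. ennreal (3 ^ (DIM('a) - 1)) * (indicator {1/4..2} (norm z) * (G z * ennreal (1 / dist z a ^ (DIM('a) - 1)))) \<partial>lborel)"
proof -
  let ?n = "DIM('a)"
  obtain m where m: "?n = Suc m" "m > 0" using n2 by (cases ?n) auto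
  let ?L = "\<lambda>y t. indicator Y y * (G (a + t *\<^sub>R (y - a)) * indicator {0..1} t)"
  let ?Z = "\<lambda>z. ennreal (3 ^ m) * (indicator {1/4..2} (norm z) * (G z * ennreal (1 / dist z a ^ m)))"
  let ?K = "\<lambda>t z. indicator {1/4..2} (norm z) * G z * (ennreal (1 / t ^ Suc m) * indicator {dist z a / 3..} t)"
  have "(\<integral>\<^sup>+ y. indicator Y y * (\<integral>\<^sup>+ t. G (a + t *\<^sub>R (y - a)) * indicator {0..1} t \<partial>lborel) \<partial>lborel)
     = (\<integral>\<^sup>+ y. \<integral>\<^sup>+ t. ?L y t \<partial>lborel \<partial>lborel)"
    by (intro nn_integral_cong nn_integral_cmult[symmetric]) measurable
  also have "\<dots> = (\<integral>\<^sup>+ t. \<integral>\<^sup>+ y. ?L y t \<partial>lborel \<partial>lborel)"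
    by (intro lborel_pair.Fubini') measurable
  also have "\<dots> \<le> (\<integral>\<^sup>+ t. \<integral>\<^sup>+ z. ?K t z \<partial>lborel \<partial>lborel)"
  proof (rule nn_integral_mono_AE, rule eventually_mono[OF AE_lborel_singleton[of 0]])
    fix t :: real assume t: "t \<noteq> 0"
    let ?k = "\<lambda>z. ?K t z"
    show "(\<integral>\<^sup>+ y. ?L y t \<partial>lborel) \<le> (\<integral>\<^sup>+ z. ?k z \<partial>lborel)"
    proof (cases "0 < t \<and> t \<le> 1")
      case True
      have eq: "(\<integral>\<^sup>+ z. ?k z \<partial>lborel) = (\<integral>\<^sup>+ y. ennreal (t ^ ?n) * ?k ((a - t *\<^sub>R a) + t *\<^sub>R y) \<partial>lborel)"
        using True by (intro nn_integral_lborel_scale) (auto simp: indicator_def)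
      show ?thesis unfolding eq
      proof (intro nn_integral_mono)
        fix y
        have e: "(a - t *\<^sub>R a) + t *\<^sub>R y = a + t *\<^sub>R (y - a)" by (simp add: algebra_simps)
        show "?L y t \<le> ennreal (t ^ ?n) * ?k ((a - t *\<^sub>R a) + t *\<^sub>R y)"
        proof (cases "y \<in> Y")
          case y: True
          have "dist (a + t *\<^sub>R (y - a)) a = t * dist y a" using True by (simp add: dist_norm)
          also have "\<dots> \<le> t * 3" using near[OF y] True by (intro mult_left_mono) auto
          finally have i: "indicator {dist (a + t *\<^sub>R (y - a)) a / 3..} t = (1::ennreal)" by simp
          have i2: "indicator {1/4..2} (norm (a + t *\<^sub>R (y - a))) = (1::ennreal)" using shell[OF y, of t] True by simp
          have "ennreal (t ^ ?n) * ennreal (1 / t ^ Suc m) = 1"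
            using True by (simp add: ennreal_mult[symmetric] m(1) del: power_Suc)
          then have "ennreal (t ^ ?n) * ?k ((a - t *\<^sub>R a) + t *\<^sub>R y) = G (a + t *\<^sub>R (y - a))"
            unfolding e i i2 by (simp add: mult.left_commute[of _ "G _"] del: power_Suc)
          then show ?thesis using y True by simp
        qed simp
      qed
    qed (use t in auto)
  qed
  also have "\<dots> = (\<integral>\<^sup>+ z. \<integral>\<^sup>+ t. ?K t z \<partial>lborel \<partial>lborel)"
    by (intro lborel_pair.Fubini') (simp add: indicator_def)
  also have "\<dots> \<le> (\<integral>\<^sup>+ z. ?Z z \<partial>lborel)"
  proof (intro nn_integral_mono_AE eventually_mono[OF AE_lborel_singleton[of a]])
    fix z assume z: "z \<noteq> a"
    have "(\<integral>\<^sup>+ t. ?K t z \<partial>lborel)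
      = indicator {1/4..2} (norm z) * G z * ennreal (1 / (real m * (dist z a / 3) ^ m))"
      using z m(2) by (subst nn_integral_cmult) (auto simp: nn_integral_inverse_power simp del: power_Suc)
    also have "ennreal (1 / (real m * (dist z a / 3) ^ m)) \<le> ennreal (3 ^ m * (1 / dist z a ^ m))"
    proof (intro ennreal_leI)
      have "1 / (real m * (dist z a / 3) ^ m) \<le> 1 / (1 * (dist z a / 3) ^ m)"
        using z m(2) by (intro divide_left_mono mult_right_mono mult_pos_pos) auto
      then show "1 / (real m * (dist z a / 3) ^ m) \<le> 3 ^ m * (1 / dist z a ^ m)" by (simp add: power_divide)
    qed
    also have "indicator {1/4..2} (norm z) * G z * ennreal (3 ^ m * (1 / dist z a ^ m))
      = ?Z z"
      by (subst ennreal_mult, simp, simp, simp only: ac_simps)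
    finally show "(\<integral>\<^sup>+ t. ?K t z \<partial>lborel)
      \<le> ?Z z"
      by (auto simp: mult_left_mono)
  qed
  finally show ?thesis by (simp add: m(1))
qed

text \<open>The kernel \<open>1 / k ^ m\<close> just fails to lie in the dual of \<open>L^(m+1)\<close>. Where \<open>G\<close> is large the missing power is
  borrowed from \<open>G ^ (m+1)\<close>; the extra weight \<open>1 / sqrt k\<close> is harmless there since \<open>G\<close> is going to be
  constant along rays.\<close>
lemma young_split:
  fixes G :: ennreal
  assumes k: "k > 0" and \<mu>: "\<mu> > 0" and m: "m > 0"
  shows "G * ennreal (1 / k ^ m) \<le> ennreal (\<mu> * k powr (1 / (2 * real m) - real (Suc m)))
     + ennreal (1 / \<mu> ^ m) * (G ^ Suc m * inverse (ennreal (sqrt k)))"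
proof -
  define b where "b = 1 / (2 * real m)"
  define t where "t = \<mu> * k powr (b - 1)"
  have t: "t > 0" using k \<mu> by (simp add: t_def)
  show ?thesis
  proof (cases "G \<le> ennreal t")
    case True
    have "t * (1 / k ^ m) = \<mu> * (k powr (b - 1) * k powr (- real m))"
      using k by (simp add: t_def powr_minus powr_realpow divide_inverse)
    also have "k powr (b - 1) * k powr (- real m) = k powr (b - real (Suc m))"
      by (simp add: powr_add[symmetric] algebra_simps)
    finally have "ennreal t * ennreal (1 / k ^ m) = ennreal (\<mu> * k powr (b - real (Suc m)))"
      using t k by (simp add: ennreal_mult[symmetric])
    then have "G * ennreal (1 / k ^ m) \<le> ennreal (\<mu> * k powr (b - real (Suc m)))"
      using True by (metis mult_right_mono zero_le)
    then show ?thesis unfolding b_def by (rule add_increasing2[OF zero_le])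
  next
    case False
    then have "ennreal t ^ m \<le> G ^ m" by (intro power_mono) auto
    have "(k powr (b - 1)) ^ m = k powr ((b - 1) * real m)"
      using k by (simp add: powr_realpow[symmetric] powr_powr)
    also have "(b - 1) * real m = 1/2 + - real m" using m by (simp add: b_def field_simps)
    also have "k powr (1/2 + - real m) = sqrt k * (1 / k ^ m)"
      unfolding powr_add powr_minus powr_realpow[OF k] powr_half_sqrt[OF less_imp_le[OF k]]
      by (simp add: inverse_eq_divide)
    finally have "t ^ m = \<mu> ^ m * (sqrt k * (1 / k ^ m))" by (simp only: t_def power_mult_distrib)
    then have "1 / \<mu> ^ m * (t ^ m * inverse (sqrt k)) = 1 / k ^ m"
      using k \<mu> by simp
    then have "ennreal (1 / k ^ m) = ennreal (1 / \<mu> ^ m) * (ennreal t ^ m * inverse (ennreal (sqrt k)))"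
    proof -
      have "ennreal (1 / k ^ m) = ennreal (1 / \<mu> ^ m * (t ^ m * inverse (sqrt k)))" using \<open>_ = 1 / k ^ m\<close> by simp
      also have "\<dots> = ennreal (1 / \<mu> ^ m) * (ennreal (t ^ m) * ennreal (inverse (sqrt k)))"
        using k \<mu> t by (simp only: ennreal_mult zero_le_divide_iff zero_le_power less_imp_le zero_le_one
            inverse_nonnegative_iff_nonnegative real_sqrt_ge_zero mult_nonneg_nonneg simp_thms)
      also have "ennreal (t ^ m) = ennreal t ^ m" using t by (simp add: ennreal_power)
      also have "ennreal (inverse (sqrt k)) = inverse (ennreal (sqrt k))" using k by (simp add: inverse_ennreal)
      finally show ?thesis .
    qed
    also have "\<dots> \<le> ennreal (1 / \<mu> ^ m) * (G ^ m * inverse (ennreal (sqrt k)))"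
      by (intro mult_left_mono mult_right_mono \<open>ennreal t ^ m \<le> G ^ m\<close>) auto
    finally have "G * ennreal (1 / k ^ m) \<le> G * (ennreal (1 / \<mu> ^ m) * (G ^ m * inverse (ennreal (sqrt k))))"
      by (intro mult_left_mono) auto
    also have "\<dots> = ennreal (1 / \<mu> ^ m) * (G ^ Suc m * inverse (ennreal (sqrt k)))"
      by (simp add: ac_simps)
    finally show ?thesis by (rule add_increasing[OF zero_le])
  qed
qed

text \<open>As \<open>a\<close> and \<open>e\<close> form no obtuse angle, the segment between them
  stays at distance at least 1/2 from the origin; moving the end point by less than 1/4 leaves
  1/4.\<close>

lemma norm_segment_bounds:
  fixes a e y :: "'a::real_inner"
  assumes "norm a = 1" "norm e = 1" "a \<bullet> e \<ge> 0" "y \<in> ball e (1/4)" "t \<in> {0..1}"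
  shows "1/4 \<le> norm (a + t *\<^sub>R (y - a))" "norm (a + t *\<^sub>R (y - a)) \<le> 2"
proof -
  define p where "p = (1 - t) *\<^sub>R a + t *\<^sub>R e"
  have aa: "a \<bullet> a = 1" "e \<bullet> e = 1" using assms by (simp_all add: dot_square_norm)
  have eq: "(norm p)\<^sup>2 = (1 - t)\<^sup>2 + 2 * ((1 - t) * t * (a \<bullet> e)) + t\<^sup>2"
    unfolding power2_norm_eq_inner p_def
    by (simp add: inner_add_left inner_add_right aa inner_commute[of e a] power2_eq_square algebra_simps)
  have "(1/2)\<^sup>2 \<le> (1 - t)\<^sup>2 + t\<^sup>2"
    using zero_le_power2[of "2 * t - 1"] by (simp add: power2_eq_square algebra_simps)
  also have "\<dots> \<le> (norm p)\<^sup>2" unfolding eq using assms by simp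
  finally have "(1/2)\<^sup>2 \<le> (norm p)\<^sup>2" .
  then have lo: "1/2 \<le> norm p" by (rule power2_le_imp_le) simp
  have hi: "norm p \<le> 1"
    unfolding p_def using norm_triangle_ineq[of "(1 - t) *\<^sub>R a" "t *\<^sub>R e"] assms by simp
  have "a + t *\<^sub>R (y - a) = p + t *\<^sub>R (y - e)" by (simp add: p_def algebra_simps)
  moreover have "norm (t *\<^sub>R (y - e)) \<le> 1/4"
  proof -
    have "norm (t *\<^sub>R (y - e)) = t * norm (y - e)" using assms by simp
    also have "\<dots> \<le> 1 * (1/4)" using assms by (intro mult_mono) (auto simp: dist_norm norm_minus_commute)
    finally show ?thesis by simp
  qed
  ultimately show "1/4 \<le> norm (a + t *\<^sub>R (y - a))" "norm (a + t *\<^sub>R (y - a)) \<le> 2"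
    using lo hi norm_triangle_ineq[of p "t *\<^sub>R (y - e)"] norm_triangle_ineq2[of p "- (t *\<^sub>R (y - e))"] by auto
qed

lemma sgn_lipschitz:
  fixes x y :: "'a::real_normed_vector"
  assumes "r > 0" "r \<le> norm x" "r \<le> norm y"
  shows "dist (sgn x) (sgn y) \<le> 2 / r * dist x y"
proof -
  have pos: "norm x > 0" "norm y > 0" using assms by linarith+
  have "sgn x - sgn y = (x - y) /\<^sub>R norm x + (1 / norm x - 1 / norm y) *\<^sub>R y"
    by (simp add: sgn_div_norm algebra_simps divide_inverse)
  also have "norm \<dots> \<le> norm ((x - y) /\<^sub>R norm x) + norm ((1 / norm x - 1 / norm y) *\<^sub>R y)"
    by (rule norm_triangle_ineq)
  also have "norm ((x - y) /\<^sub>R norm x) = norm (x - y) / norm x" by (simp add: divide_inverse mult.commute)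
  also have "norm ((1 / norm x - 1 / norm y) *\<^sub>R y) = \<bar>norm y - norm x\<bar> / norm x"
  proof -
    have "(1 / norm x - 1 / norm y) * norm y = (norm y - norm x) / norm x" using pos by (simp add: field_simps)
    then show ?thesis using pos by (metis abs_divide abs_mult abs_norm_cancel norm_scaleR real_norm_def)
  qed
  also have "\<bar>norm y - norm x\<bar> / norm x \<le> norm (x - y) / norm x"
    using norm_triangle_ineq3[of y x] by (intro divide_right_mono) (auto simp: norm_minus_commute)
  also have "norm (x - y) / norm x + norm (x - y) / norm x = 2 * (norm (x - y) / norm x)" by simp
  also have "norm (x - y) / norm x \<le> norm (x - y) / r" using assms by (intro divide_left_mono mult_pos_pos) auto
  finally show ?thesis by (simp add: dist_norm)
qed

text \<open>Since \<open>\<bar>norm z - 1\<bar> \<le> dist z a\<close>, the weight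
  \<open>1 / sqrt (dist z a)\<close> left by \<open>young_split\<close> is dominated by
  \<open>shell_weight (norm z)\<close>. The bound thus no longer depends on the position of
  \<open>a\<close>, and the free parameter \<mu> makes the potential term as small as
  desired.\<close>

lemma potential_estimate:
  fixes a :: "'a::euclidean_space" and g :: "'a \<Rightarrow> ennreal"
  assumes n: "DIM('a) = Suc m" "m > 0" and g[measurable]: "g \<in> borel_measurable borel"
    and Y: "Y \<in> sets borel" and a: "norm a = 1" and \<mu>: "\<mu> > 0"
    and shell: "\<And>y t. y \<in> Y \<Longrightarrow> t \<in> {0..1} \<Longrightarrow> 1/4 \<le> norm (a + t *\<^sub>R (y - a)) \<and> norm (a + t *\<^sub>R (y - a)) \<le> 2"
    and near: "\<And>y. y \<in> Y \<Longrightarrow> dist y a \<le> 3"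
  shows "(\<integral>\<^sup>+ y. indicator Y y * (\<integral>\<^sup>+ t. g (sgn (a + t *\<^sub>R (y - a))) * indicator {0..1} t \<partial>lborel) \<partial>lborel)
    \<le> ennreal (3 ^ m) * (ennreal \<mu> * (\<integral>\<^sup>+ (x::'a). ennreal (norm x powr (1 / (2 * real m) - real DIM('a))) * indicator (cball 0 3) x \<partial>lborel)
         + ennreal (1 / \<mu> ^ m) * (\<integral>\<^sup>+ z. shell_weight (norm z) * g (sgn z) ^ DIM('a) \<partial>lborel))"
proof -
  let ?b = "1 / (2 * real m) - real DIM('a)"
  define r :: "'a \<Rightarrow> ennreal" where "r x = ennreal (norm x powr ?b) * indicator (cball 0 3) x" for x
  have [measurable]: "r \<in> borel_measurable borel" unfolding r_def[abs_def] by measurable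
  have G: "(\<lambda>z. g (sgn z)) \<in> borel_measurable borel" by measurable
  have "(\<integral>\<^sup>+ y. indicator Y y * (\<integral>\<^sup>+ t. g (sgn (a + t *\<^sub>R (y - a))) * indicator {0..1} t \<partial>lborel) \<partial>lborel)
    \<le> (\<integral>\<^sup>+ z. ennreal (3 ^ m) * (indicator {1/4..2} (norm z) * (g (sgn z) * ennreal (1 / dist z a ^ m))) \<partial>lborel)"
    using segment_average_le[OF _ G Y shell near] n by simp
  also have "\<dots> \<le> (\<integral>\<^sup>+ z. ennreal (3 ^ m) * (ennreal \<mu> * r (- a + 1 *\<^sub>R z) + ennreal (1 / \<mu> ^ m) * (shell_weight (norm z) * g (sgn z) ^ Suc m)) \<partial>lborel)"
  proof (intro nn_integral_mono_AE eventually_mono[OF AE_lborel_singleton[of a]] mult_left_mono)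
    fix z assume z: "z \<noteq> a"
    show "indicator {1/4..2} (norm z) * (g (sgn z) * ennreal (1 / dist z a ^ m))
      \<le> ennreal \<mu> * r (- a + 1 *\<^sub>R z) + ennreal (1 / \<mu> ^ m) * (shell_weight (norm z) * g (sgn z) ^ Suc m)"
    proof (cases "norm z \<in> {1/4..2}")
      case True
      have d: "dist z a > 0" using z by simp
      have "g (sgn z) * ennreal (1 / dist z a ^ m) \<le> ennreal (\<mu> * dist z a powr (1 / (2 * real m) - real (Suc m)))
          + ennreal (1 / \<mu> ^ m) * (g (sgn z) ^ Suc m * inverse (ennreal (sqrt (dist z a))))"
        by (rule young_split[OF d \<mu> n(2)])
      also have "ennreal (\<mu> * dist z a powr (1 / (2 * real m) - real (Suc m))) = ennreal \<mu> * r (- a + 1 *\<^sub>R z)"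
      proof -
        have "dist z a \<le> 3" using True a norm_triangle_ineq4[of z a] by (simp add: dist_norm)
        then have "indicator (cball 0 3) (- a + 1 *\<^sub>R z) = (1::ennreal)"
          by (simp add: indicator_def dist_norm norm_minus_commute)
        moreover have "norm (- a + 1 *\<^sub>R z) = dist z a" by (simp add: dist_norm)
        ultimately show ?thesis using \<mu> n(1) by (simp only: r_def ennreal_mult less_imp_le powr_ge_zero mult_1_right)
      qed
      also have "ennreal (1 / \<mu> ^ m) * (g (sgn z) ^ Suc m * inverse (ennreal (sqrt (dist z a))))
          \<le> ennreal (1 / \<mu> ^ m) * (g (sgn z) ^ Suc m * shell_weight (norm z))"
      proof (cases "norm z = 1")
        case False
        have "\<bar>norm z - 1\<bar> \<le> dist z a" using norm_triangle_ineq3[of z a] a by (simp add: dist_norm)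
        then have "inverse (ennreal (sqrt (dist z a))) \<le> shell_weight (norm z)"
          using True False d by (simp add: shell_weight_def inverse_ennreal)
        then show ?thesis by (intro mult_left_mono) auto
      next
        case True
        then have "inverse (ennreal (sqrt (dist z a))) \<le> shell_weight (norm z)" by (simp add: shell_weight_def)
        then show ?thesis by (intro mult_left_mono) auto
      qed
      finally show ?thesis using True by (simp add: mult.commute add_left_mono del: power_Suc)
    qed simp
  qed simp
  also have "\<dots> = ennreal (3 ^ m) * (ennreal \<mu> * (\<integral>\<^sup>+ z. r (- a + 1 *\<^sub>R z) \<partial>lborel)
      + ennreal (1 / \<mu> ^ m) * (\<integral>\<^sup>+ z. shell_weight (norm z) * g (sgn z) ^ Suc m \<partial>lborel))"
    by (simp add: nn_integral_cmult nn_integral_add del: power_Suc)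
  also have "(\<integral>\<^sup>+ z. r (- a + 1 *\<^sub>R z) \<partial>lborel) = (\<integral>\<^sup>+ z. r z \<partial>lborel)"
    using nn_integral_lborel_scale[of r 1 "- a"] by simp
  finally show ?thesis by (simp only: n(1) r_def)
qed

text \<open>A vector orthogonal to \<open>a\<close>, with its sign chosen to suit \<open>b\<close>.
  One ball of intermediate points then serves both end points, even if they are antipodal.\<close>

lemma intermediate_direction:
  fixes a b :: "'a::euclidean_space"
  assumes "DIM('a) \<ge> 2"
  obtains e where "norm e = 1" "a \<bullet> e \<ge> 0" "b \<bullet> e \<ge> 0"
proof -
  obtain y where y: "y \<noteq> 0" "a \<bullet> y = 0"
    using orthogonal_to_vector_exists[OF assms, of a] by (auto simp: orthogonal_def)
  define e where "e = (if b \<bullet> y \<ge> 0 then sgn y else - sgn y)"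
  show ?thesis
    by (rule that[of e]) (use y in \<open>auto simp: e_def norm_sgn sgn_div_norm zero_le_mult_iff mult_le_0_iff\<close>)
qed

text \<open>The broken segments below are 6-Lipschitz and stay outside the ball of radius 1/4, where radial
  projection is 8-Lipschitz; hence 48.\<close>
abbreviation sphere_arc :: "(real \<Rightarrow> 'a::euclidean_space) \<Rightarrow> 'a \<Rightarrow> 'a \<Rightarrow> bool" where
  "sphere_arc \<beta> a b \<equiv> 48-lipschitz_on {0..1} \<beta> \<and> (\<forall>t\<in>{0..1}. norm (\<beta> t) = 1) \<and> \<beta> 0 = a \<and> \<beta> 1 = b"

lemma broken_segment_path:
  fixes a b y :: "'a::euclidean_space"
  assumes shell: "\<And>t. t \<in> {0..1} \<Longrightarrow> 1/4 \<le> norm (a + t *\<^sub>R (y - a))" "\<And>t. t \<in> {0..1} \<Longrightarrow> 1/4 \<le> norm (b + t *\<^sub>R (y - b))"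
    and near: "dist y a \<le> 3" "dist y b \<le> 3" and ab: "norm a = 1" "norm b = 1"
    and g[measurable]: "g \<in> borel_measurable borel"
  shows "\<exists>\<beta>. sphere_arc \<beta> a b \<and>
    (\<integral>\<^sup>+ t. g (\<beta> t) * indicator {0..1} t \<partial>lborel)
      \<le> (\<integral>\<^sup>+ t. g (sgn (a + t *\<^sub>R (y - a))) * indicator {0..1} t \<partial>lborel)
       + (\<integral>\<^sup>+ t. g (sgn (b + t *\<^sub>R (y - b))) * indicator {0..1} t \<partial>lborel)"
proof -
  define p where "p t = a + (0 + 2 * t) *\<^sub>R (y - a)" for t :: real
  define q where "q t = b + (2 + (-2) * t) *\<^sub>R (y - b)" for t :: real
  define \<beta> where "\<beta> t = sgn (if t \<le> 1/2 then p t else q t)" for t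
  have lp: "6-lipschitz_on {0..1/2} p"
  proof (rule lipschitz_onI)
    fix s t :: real
    have "p s - p t = (2 * (s - t)) *\<^sub>R (y - a)" by (simp add: p_def algebra_simps)
    then have "dist (p s) (p t) = \<bar>2 * (s - t)\<bar> * norm (y - a)" by (simp only: dist_norm norm_scaleR)
    also have "\<dots> = 2 * dist s t * dist y a" unfolding dist_norm by (simp only: abs_mult) simp
    also have "\<dots> \<le> 2 * dist s t * 3" by (intro mult_left_mono near) auto
    finally show "dist (p s) (p t) \<le> 6 * dist s t" by simp
  qed simp
  have lq: "6-lipschitz_on {1/2..1} q"
  proof (rule lipschitz_onI)
    fix s t :: real
    have "q s - q t = (2 * (t - s)) *\<^sub>R (y - b)" by (simp add: q_def algebra_simps)
    then have "dist (q s) (q t) = \<bar>2 * (t - s)\<bar> * norm (y - b)" by (simp only: dist_norm norm_scaleR)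
    also have "\<dots> = 2 * dist s t * dist y b" unfolding dist_norm by (simp only: abs_mult abs_minus_commute[of t s]) simp
    also have "\<dots> \<le> 2 * dist s t * 3" by (intro mult_left_mono near) auto
    finally show "dist (q s) (q t) \<le> 6 * dist s t" by simp
  qed simp
  have l: "6-lipschitz_on {0..1} (\<lambda>t. if t \<le> 1/2 then p t else q t)"
    by (rule lipschitz_on_concat[OF lp lq]) (simp add: p_def q_def)
  have lo: "1/4 \<le> norm (if t \<le> 1/2 then p t else q t)" if "t \<in> {0..1}" for t
    using shell(1)[of "2 * t"] shell(2)[of "2 - 2 * t"] that by (auto simp: p_def q_def)
  show ?thesis
  proof (intro exI[of _ \<beta>] conjI ballI)
    show "48-lipschitz_on {0..1} \<beta>"
    proof (rule lipschitz_onI)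
      fix s t :: real assume st: "s \<in> {0..1}" "t \<in> {0..1}"
      have "dist (\<beta> s) (\<beta> t) \<le> 2 / (1/4) * dist (if s \<le> 1/2 then p s else q s) (if t \<le> 1/2 then p t else q t)"
        unfolding \<beta>_def by (rule sgn_lipschitz) (use lo st in auto)
      also have "\<dots> \<le> 2 / (1/4) * (6 * dist s t)" using lipschitz_onD[OF l st] by (intro mult_left_mono) auto
      finally show "dist (\<beta> s) (\<beta> t) \<le> 48 * dist s t" by simp
    qed simp
    show "norm (\<beta> t) = 1" if "t \<in> {0..1}" for t using lo[OF that] by (auto simp: \<beta>_def norm_sgn)
    show "\<beta> 0 = a" "\<beta> 1 = b" using ab by (auto simp: \<beta>_def p_def q_def sgn_div_norm)
    define A where "A t = g (sgn (a + t *\<^sub>R (y - a))) * indicator {0..1} t" for t :: real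
    define B where "B t = g (sgn (b + t *\<^sub>R (y - b))) * indicator {0..1} t" for t :: real
    have [measurable]: "A \<in> borel_measurable borel" "B \<in> borel_measurable borel"
      unfolding A_def[abs_def] B_def[abs_def] by measurable
    \<comment> \<open>Each half of the path runs at double speed, so substitution yields half of
      each integral on the right; the sharper factor is given away.\<close>
    have le2: "x \<le> ennreal 2 * x" for x :: ennreal using mult_right_mono[of 1 "ennreal 2" x] by simp
    have "(\<integral>\<^sup>+ t. g (\<beta> t) * indicator {0..1} t \<partial>lborel) \<le> (\<integral>\<^sup>+ t. A (0 + 2 * t) + B (2 + (-2) * t) \<partial>lborel)"
      by (intro nn_integral_mono) (auto simp: A_def B_def \<beta>_def p_def q_def indicator_def)
    also have "\<dots> = (\<integral>\<^sup>+ t. A (0 + 2 * t) \<partial>lborel) + (\<integral>\<^sup>+ t. B (2 + (-2) * t) \<partial>lborel)"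
      by (intro nn_integral_add) auto
    also have "\<dots> \<le> (\<integral>\<^sup>+ t. A t \<partial>lborel) + (\<integral>\<^sup>+ t. B t \<partial>lborel)"
      using nn_integral_real_affine[of A 2 0] nn_integral_real_affine[of B "-2" 2] le2 by (intro add_mono) auto
    finally show "(\<integral>\<^sup>+ t. g (\<beta> t) * indicator {0..1} t \<partial>lborel)
      \<le> (\<integral>\<^sup>+ t. g (sgn (a + t *\<^sub>R (y - a))) * indicator {0..1} t \<partial>lborel)
       + (\<integral>\<^sup>+ t. g (sgn (b + t *\<^sub>R (y - b))) * indicator {0..1} t \<partial>lborel)" by (simp add: A_def B_def)
  qed
qed

text \<open>A density that is large on all arcs from \<open>a\<close> to \<open>b\<close> has
  integral bounded below, whatever the two points are. Averaging over the intermediate point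
  \<open>y\<close> of broken segments from \<open>a\<close> to \<open>b\<close> turns the arc
  condition into potential estimates at the two end points.\<close>

lemma sphere_inequality:
  assumes n2: "DIM('a::euclidean_space) \<ge> 2"
  obtains c where "c > 0" "\<And>g (a::'a) b. g \<in> borel_measurable borel \<Longrightarrow> norm a = 1 \<Longrightarrow> norm b = 1 \<Longrightarrow>
     (\<And>\<beta>. sphere_arc \<beta> a b \<Longrightarrow>
        1 \<le> ennreal 48 * (\<integral>\<^sup>+ t. g (\<beta> t) * indicator {0..1} t \<partial>lborel)) \<Longrightarrow>
     ennreal c \<le> (\<integral>\<^sup>+ z. shell_weight (norm z) * g (sgn z) ^ DIM('a) \<partial>lborel)"
proof -
  let ?n = "DIM('a)"
  obtain m where m: "?n = Suc m" "m > 0" using n2 by (cases ?n) auto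
  define J where "J = (\<integral>\<^sup>+ (x::'a). ennreal (norm x powr (1 / (2 * real m) - real ?n)) * indicator (cball 0 3) x \<partial>lborel)"
  have "J < \<infinity>" unfolding J_def by (rule riesz_integral_finite) (use m in simp)
  then obtain j where j: "J = ennreal j" "j \<ge> 0" by (cases J) auto
  define v where "v = unit_ball_vol ?n * (1/4) ^ ?n"
  have v: "v > 0" by (simp add: v_def)
  \<comment> \<open>The factor 48 and the two end points give 96. The choice of \<mu> keeps the
    potential term, \<open>3 ^ m * \<mu> * j\<close>, below \<open>k / 2\<close>, so the other half
    of \<open>k\<close> must come from the integral of \<open>g\<close>; \<open>c\<close> is the
    bound solved for it.\<close>
  define k where "k = v / 96"
  have k: "k > 0" using v by (simp add: k_def)
  define \<mu> where "\<mu> = k / (2 * 3 ^ m * (j + 1))"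
  have \<mu>: "\<mu> > 0" using k j by (simp add: \<mu>_def)
  define c where "c = (k / 2) / (3 ^ m * (1 / \<mu> ^ m))"
  show ?thesis
  proof (rule that[of c])
    show "c > 0" using k \<mu> by (simp add: c_def)
    fix g :: "'a \<Rightarrow> ennreal" and a b :: 'a
    assume g[measurable]: "g \<in> borel_measurable borel" and ab: "norm a = 1" "norm b = 1"
      and H: "\<And>\<beta>. sphere_arc \<beta> a b \<Longrightarrow>
        1 \<le> ennreal 48 * (\<integral>\<^sup>+ t. g (\<beta> t) * indicator {0..1} t \<partial>lborel)"
    obtain e where e: "norm e = 1" "a \<bullet> e \<ge> 0" "b \<bullet> e \<ge> 0" by (rule intermediate_direction[OF n2])
    define Y where "Y = ball e (1/4)"
    have [measurable]: "Y \<in> sets borel" by (simp add: Y_def)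
    define X where "X = (\<integral>\<^sup>+ z. shell_weight (norm z) * g (sgn z) ^ ?n \<partial>lborel)"
    define I where "I x y = (\<integral>\<^sup>+ t. g (sgn (x + t *\<^sub>R (y - x))) * indicator {0..1} t \<partial>lborel)" for x y :: 'a
    have [measurable]: "(\<lambda>y. I x y) \<in> borel_measurable borel" for x
      unfolding I_def by measurable
    have near: "dist y x \<le> 3" if "norm x = 1" "y \<in> Y" for x y
    proof -
      have "dist y x \<le> dist y e + dist e 0 + dist 0 x" using dist_triangle[of y x e] dist_triangle[of e x 0] by linarith
      then show ?thesis using that e by (simp add: Y_def dist_commute)
    qed
    have est: "(\<integral>\<^sup>+ y. indicator Y y * I x y \<partial>lborel) \<le> ennreal (3 ^ m) * (ennreal \<mu> * J + ennreal (1 / \<mu> ^ m) * X)"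
      if "norm x = 1" "x \<bullet> e \<ge> 0" for x
      unfolding I_def J_def X_def
      by (rule potential_estimate[OF m]) (use that \<mu> near norm_segment_bounds[OF that(1) e(1) that(2)] in \<open>auto simp: Y_def\<close>)
    have "ennreal v = emeasure lborel Y" by (simp add: Y_def emeasure_ball v_def)
    also have "\<dots> = (\<integral>\<^sup>+ y. indicator Y y \<partial>lborel)" by simp
    also have "\<dots> \<le> (\<integral>\<^sup>+ y. ennreal 48 * (indicator Y y * I a y + indicator Y y * I b y) \<partial>lborel)"
    proof (intro nn_integral_mono)
      fix y
      show "indicator Y y \<le> ennreal 48 * (indicator Y y * I a y + indicator Y y * I b y)"
      proof (cases "y \<in> Y")
        case True
        have yb: "y \<in> ball e (1/4)" using True by (simp add: Y_def)
        obtain \<beta> where b: "sphere_arc \<beta> a b"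
           "(\<integral>\<^sup>+ t. g (\<beta> t) * indicator {0..1} t \<partial>lborel) \<le> I a y + I b y"
        proof -
          have "\<exists>\<beta>. sphere_arc \<beta> a b \<and>
            (\<integral>\<^sup>+ t. g (\<beta> t) * indicator {0..1} t \<partial>lborel) \<le> I a y + I b y"
            unfolding I_def
            by (rule broken_segment_path)
               (use norm_segment_bounds(1)[OF ab(1) e(1,2) yb] norm_segment_bounds(1)[OF ab(2) e(1,3) yb]
                 near[OF ab(1) True] near[OF ab(2) True] ab g in auto)
          then show thesis using that by blast
        qed
        have "1 \<le> ennreal 48 * (\<integral>\<^sup>+ t. g (\<beta> t) * indicator {0..1} t \<partial>lborel)" by (rule H[OF b(1)])
        also have "\<dots> \<le> ennreal 48 * (I a y + I b y)" by (intro mult_left_mono b) auto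
        finally show ?thesis using True by simp
      qed simp
    qed
    also have "\<dots> = ennreal 48 * ((\<integral>\<^sup>+ y. indicator Y y * I a y \<partial>lborel) + (\<integral>\<^sup>+ y. indicator Y y * I b y \<partial>lborel))"
      by (subst nn_integral_cmult, measurable, subst nn_integral_add) measurable
    also have "\<dots> \<le> ennreal 48 * (ennreal (3 ^ m) * (ennreal \<mu> * J + ennreal (1 / \<mu> ^ m) * X) + ennreal (3 ^ m) * (ennreal \<mu> * J + ennreal (1 / \<mu> ^ m) * X))"
      by (intro mult_left_mono add_mono est ab e) auto
    finally have V: "ennreal v \<le> ennreal 48 * (ennreal (3 ^ m) * (ennreal \<mu> * J + ennreal (1 / \<mu> ^ m) * X) + ennreal (3 ^ m) * (ennreal \<mu> * J + ennreal (1 / \<mu> ^ m) * X))" .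
    show "ennreal c \<le> X"
    proof (cases X)
      case (real x)
      have "v \<le> 48 * (3 ^ m * (\<mu> * j + 1 / \<mu> ^ m * x) + 3 ^ m * (\<mu> * j + 1 / \<mu> ^ m * x))"
        using V j \<mu> real by (simp add: ennreal_mult[symmetric] ennreal_plus[symmetric] del: ennreal_plus ennreal_numeral)
      then have "k \<le> 3 ^ m * (\<mu> * j + 1 / \<mu> ^ m * x)" unfolding k_def by (simp add: mult.commute)
      also have "\<dots> = 3 ^ m * \<mu> * j + 3 ^ m * (1 / \<mu> ^ m) * x" by (simp only: distrib_left mult.assoc)
      also have "3 ^ m * \<mu> * j = k / 2 * (j / (j + 1))"
      proof -
        have "E * (k / (2 * E * i)) * j = k / 2 * (j / i)" if "E > 0" "i > 0" for E i :: real using that by simp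
        from this[of "3 ^ m" "j + 1"] show ?thesis unfolding \<mu>_def using j by simp
      qed
      finally have 1: "k \<le> k / 2 * (j / (j + 1)) + 3 ^ m * (1 / \<mu> ^ m) * x" .
      have 2: "k / 2 * (j / (j + 1)) \<le> k / 2 * 1" using k j by (intro mult_left_mono) auto
      define F where "F = 3 ^ m * (1 / \<mu> ^ m)"
      have F: "F > 0" using \<mu> by (simp add: F_def)
      have "k / 2 \<le> x * F" using 1 2 unfolding F_def[symmetric] by (simp only: mult.commute[of x F])
      then have "c \<le> x" unfolding c_def F_def[symmetric] using F by (simp only: pos_divide_le_eq)
      then show ?thesis using real by (simp add: ennreal_leI)
    qed simp
  qed
qed

section \<open>Lower bounds for the modulus\<close>

abbreviation ring_image :: "('a::euclidean_space \<Rightarrow> 'a option) \<Rightarrow> 'a set \<Rightarrow> 'a \<Rightarrow> real \<Rightarrow> real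
    \<Rightarrow> (real set \<times> (real \<Rightarrow> 'a option)) set" where
  "ring_image f D z r1 r2 \<equiv> image_family f D (path_family (sphere z r1) (sphere z r2) D)"

text \<open>The arc condition of \<open>sphere_inequality\<close> carried to the sphere of radius
  \<open>t\<close> about \<open>c\<close>, where arcs are 48t-Lipschitz. The pair \<open>a\<close>,
  \<open>b\<close> may change with \<open>t\<close> in an arbitrary way.\<close>

definition sphere_joinable :: "('a::euclidean_space \<Rightarrow> ennreal) \<Rightarrow> 'a \<Rightarrow> real \<Rightarrow> bool" where
  "sphere_joinable \<rho> c t \<longleftrightarrow> (\<exists>a b. norm a = 1 \<and> norm b = 1 \<and> (\<forall>\<beta>. sphere_arc \<beta> a b \<longrightarrow>
     1 \<le> ennreal (48 * t) * (\<integral>\<^sup>+ \<tau>. \<rho> (c + t *\<^sub>R \<beta> \<tau>) * indicator {0..1} \<tau> \<partial>lborel)))"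

text \<open>The condition on \<open>u\<close> keeps all arcs of the sphere clear of the centre of
  inversion, so that they stay continuous in the inverted coordinate.\<close>

abbreviation sphere_separates :: "('a::euclidean_space \<Rightarrow> 'a option) \<Rightarrow> 'a \<Rightarrow> real \<Rightarrow> real \<Rightarrow> 'a \<Rightarrow> 'a \<Rightarrow> real \<Rightarrow> bool" where
  "sphere_separates f z r1 r2 u c t \<equiv> dist u c \<noteq> t \<and> (\<exists>w. Some w \<in> f ` cball z r1 \<and> dist w c = t)
     \<and> (\<exists>w. Some w \<notin> f ` cball z r2 \<and> dist w c = t)"

definition is_loewner_const :: "'a::euclidean_space itself \<Rightarrow> real \<Rightarrow> bool" where
  "is_loewner_const _ k \<longleftrightarrow> k > 0 \<and> (\<forall>\<rho> (c::'a) s S. \<rho> \<in> borel_measurable borel \<longrightarrow> 0 < s \<longrightarrow> s < S \<longrightarrow>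
     (\<forall>t. s < t \<longrightarrow> t < S \<longrightarrow> sphere_joinable \<rho> c t) \<longrightarrow> ennreal (k * ln (S / s)) \<le> (\<integral>\<^sup>+ x. \<rho> x ^ DIM('a) \<partial>lborel))"

text \<open>Chosen from the type alone: one value serves all maps, rings and centres.\<close>

definition loewner_const :: "'a::euclidean_space itself \<Rightarrow> real" where
  "loewner_const t = (SOME k. is_loewner_const t k)"

text \<open>On the sphere of radius \<open>t\<close> the unit-sphere bound scales to
  \<open>k / t\<close>, and integration over \<open>t\<close> gives the logarithm. The bound is the
  same for all pairs of points, so their dependence on \<open>t\<close> raises no measurability
  question.\<close>

lemma is_loewner_const_exists:
  assumes n2: "DIM('a::euclidean_space) \<ge> 2"
  shows "\<exists>k. is_loewner_const TYPE('a) k"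
proof -
  let ?n = "DIM('a)"
  obtain k where k: "k > 0" and si: "\<And>g (a::'a) b. g \<in> borel_measurable borel \<Longrightarrow> norm a = 1 \<Longrightarrow> norm b = 1 \<Longrightarrow>
     (\<And>\<beta>. sphere_arc \<beta> a b \<Longrightarrow>
        1 \<le> ennreal 48 * (\<integral>\<^sup>+ t. g (\<beta> t) * indicator {0..1} t \<partial>lborel)) \<Longrightarrow>
     ennreal k \<le> (\<integral>\<^sup>+ z. shell_weight (norm z) * g (sgn z) ^ ?n \<partial>lborel)"
    using sphere_inequality[OF n2] by blast
  define W where "W = (\<integral>\<^sup>+ s. shell_weight s * ennreal (s ^ (?n - 1)) * indicator {0<..} s \<partial>lborel)"
  have "W < \<infinity>" unfolding W_def by (rule shell_weight_integral_finite)
  then obtain w where w: "W = ennreal w" "w \<ge> 0" by (cases W) auto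
  show ?thesis
    unfolding is_loewner_const_def
  proof (intro exI[of _ "k / (w + 1)"] conjI allI impI)
    show "k / (w + 1) > 0" using k w by simp
    fix \<rho> :: "'a \<Rightarrow> ennreal" and c s S
    assume \<rho>[measurable]: "\<rho> \<in> borel_measurable borel" and s: "0 < s" "s < S"
      and H: "\<forall>t. s < t \<longrightarrow> t < S \<longrightarrow> sphere_joinable \<rho> c t"
    define P where "P = (\<integral>\<^sup>+ x. \<rho> x ^ ?n \<partial>lborel)"
    \<comment> \<open>Arcs of radius \<open>t\<close> are \<open>t\<close> times as long, so the
      density on the unit sphere is \<open>t * \<rho>\<close>; its power of order
      \<open>DIM('a)\<close> divided by \<open>t\<close> is this function, with exactly the radial
      factor of polar coordinates.\<close>
    define g where "g t z = \<rho> (c + t *\<^sub>R z) ^ ?n * ennreal (t ^ (?n - 1)) * indicator {s<..<S} t" for t z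
    have gm[measurable]: "(\<lambda>(t, z). g t z) \<in> borel_measurable (borel \<Otimes>\<^sub>M borel)" unfolding g_def by measurable
    let ?J = "\<lambda>t \<beta>. \<integral>\<^sup>+ \<tau>. \<rho> (c + t *\<^sub>R \<beta> \<tau>) * indicator {0..1} \<tau> \<partial>lborel"
    let ?w = "\<lambda>t z. shell_weight (norm z) * (ennreal t * \<rho> (c + t *\<^sub>R sgn z)) ^ ?n"
    let ?h = "\<lambda>t. \<integral>\<^sup>+ z. shell_weight (norm z) * g t (sgn z) \<partial>lborel"
    have slice: "ennreal (k / t) * indicator {s<..<S} t \<le> (?h t)" for t
    proof (cases "s < t \<and> t < S")
      case True
      have t: "t > 0" using True s by simp
      obtain a b where ab: "norm a = 1" "norm b = 1" and Hb: "\<And>\<beta>. sphere_arc \<beta> a b \<Longrightarrow>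
        1 \<le> ennreal (48 * t) * (?J t \<beta>)"
        using H True unfolding sphere_joinable_def by blast
      have "ennreal k \<le> (\<integral>\<^sup>+ z. ?w t z \<partial>lborel)"
      proof (rule si[where g = "\<lambda>z. ennreal t * \<rho> (c + t *\<^sub>R z)", OF _ ab])
        fix \<beta> :: "real \<Rightarrow> 'a" assume b: "sphere_arc \<beta> a b"
        have "continuous_on {0..1} (\<lambda>\<tau>. c + t *\<^sub>R \<beta> \<tau>)"
          by (intro continuous_intros lipschitz_on_continuous_on[OF conjunct1[OF b]])
        then have m: "(\<lambda>\<tau>. \<rho> (c + t *\<^sub>R \<beta> \<tau>) * indicator {0..1} \<tau>) \<in> borel_measurable borel"
          by (intro measurable_path_comp) auto
        have "1 \<le> ennreal (48 * t) * (?J t \<beta>)" by (rule Hb[OF b])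
        also have "ennreal (48 * t) = ennreal 48 * ennreal t" using t by (intro ennreal_mult) auto
        also have "ennreal 48 * ennreal t * (?J t \<beta>)
          = ennreal 48 * (\<integral>\<^sup>+ \<tau>. ennreal t * (\<rho> (c + t *\<^sub>R \<beta> \<tau>) * indicator {0..1} \<tau>) \<partial>lborel)"
          using m by (subst nn_integral_cmult) (simp_all add: mult.assoc)
        finally show "1 \<le> ennreal 48 * (\<integral>\<^sup>+ \<tau>. ennreal t * \<rho> (c + t *\<^sub>R \<beta> \<tau>) * indicator {0..1} \<tau> \<partial>lborel)"
          by (simp add: mult.assoc)
      qed measurable
      then have "ennreal (1 / t) * ennreal k \<le> ennreal (1 / t) * (\<integral>\<^sup>+ z. ?w t z \<partial>lborel)"
        by (rule mult_left_mono) simp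
      also have "\<dots> = (\<integral>\<^sup>+ z. ennreal (1 / t) * (?w t z) \<partial>lborel)"
        by (intro nn_integral_cmult[symmetric]) measurable
      also have "\<dots> = (?h t)"
      proof (intro nn_integral_cong)
        fix z :: 'a
        have "t ^ ?n = t * t ^ (?n - 1)" by (metis DIM_positive power_minus_mult mult.commute)
        then have "1 / t * t ^ ?n = t ^ (?n - 1)" using t by simp
        then have e: "ennreal (1 / t) * ennreal t ^ ?n = ennreal (t ^ (?n - 1))"
          using t by (simp add: ennreal_power ennreal_mult[symmetric])
        have "ennreal (1 / t) * (?w t z)
          = shell_weight (norm z) * (\<rho> (c + t *\<^sub>R sgn z) ^ ?n * (ennreal (1 / t) * ennreal t ^ ?n))"
          by (simp only: power_mult_distrib ac_simps)
        then show "ennreal (1 / t) * (?w t z)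
          = shell_weight (norm z) * g t (sgn z)"
          using True unfolding e by (simp add: g_def)
      qed
      also have "ennreal (1 / t) * ennreal k = ennreal (k / t)" using t k by (simp add: ennreal_mult[symmetric])
      finally show ?thesis using True by simp
    qed simp
    have "(\<integral>\<^sup>+ t. ennreal (k / t) * indicator {s..S} t \<partial>lborel) = ennreal (k * ln S - k * ln s)"
    proof (rule nn_integral_FTC_Icc[where F = "\<lambda>t. k * ln t"])
      fix t assume "t \<in> {s..S}"
      then show "((\<lambda>t. k * ln t) has_real_derivative k / t) (at t)"
        using s by (auto intro!: derivative_eq_intros)
    next
      fix t assume "t \<in> {s..S}"
      then show "0 \<le> k / t" using s k by simp
    qed (use s in auto)
    then have "ennreal (k * ln (S / s)) = (\<integral>\<^sup>+ t. ennreal (k / t) * indicator {s..S} t \<partial>lborel)"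
      using s by (simp add: ln_div right_diff_distrib)
    also have "\<dots> \<le> (\<integral>\<^sup>+ t. ?h t \<partial>lborel)"
    proof (rule nn_integral_mono_AE)
      show "AE t in lborel. ennreal (k / t) * indicator {s..S} t \<le> (?h t)"
        using AE_lborel_singleton[of s] AE_lborel_singleton[of S]
      proof eventually_elim
        fix t assume "t \<noteq> s" "t \<noteq> S"
        then show "ennreal (k / t) * indicator {s..S} t \<le> (?h t)"
          using slice[of t] by (auto simp: indicator_def split: if_splits)
      qed
    qed
    also have "\<dots> = (\<integral>\<^sup>+ z. \<integral>\<^sup>+ t. shell_weight (norm z) * g t (sgn z) \<partial>lborel \<partial>lborel)"
      by (intro lborel_pair.Fubini') measurable
    also have "\<dots> = (\<integral>\<^sup>+ z. shell_weight (norm z) * (\<integral>\<^sup>+ t. g t (sgn z) \<partial>lborel) \<partial>lborel)"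
      by (intro nn_integral_cong nn_integral_cmult) measurable
    also have "\<dots> = W * (of_nat ?n * (\<integral>\<^sup>+ y. indicator (cball 0 1) y * (\<integral>\<^sup>+ t. g t (sgn y) \<partial>lborel) \<partial>lborel))"
      unfolding W_def by (rule nn_integral_radial_direction) measurable
    also have "of_nat ?n * (\<integral>\<^sup>+ y. indicator (cball 0 1) y * (\<integral>\<^sup>+ t. g t (sgn y) \<partial>lborel) \<partial>lborel)
      \<le> of_nat ?n * (\<integral>\<^sup>+ y. indicator (cball 0 1) y *
         (\<integral>\<^sup>+ t. \<rho> (c + t *\<^sub>R sgn y) ^ ?n * ennreal (t ^ (?n - 1)) * indicator {0<..} t \<partial>lborel) \<partial>lborel)"
      using s by (intro mult_left_mono nn_integral_mono) (auto simp: g_def indicator_def)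
    also have "\<dots> = (\<integral>\<^sup>+ x. \<rho> (c + x) ^ ?n \<partial>lborel)"
      by (rule nn_integral_polar[symmetric]) measurable
    also have "\<dots> = P" unfolding P_def
      using nn_integral_lborel_scale[of "\<lambda>x. \<rho> x ^ ?n" 1 c] by simp
    finally have "ennreal (k * ln (S / s)) \<le> W * P" by (simp add: mult_left_mono)
    show "ennreal (k / (w + 1) * ln (S / s)) \<le> P"
    proof (cases P)
      case (real p)
      have "k * ln (S / s) \<le> w * p"
        using \<open>_ \<le> W * P\<close> real w by (simp add: ennreal_mult[symmetric])
      also have "\<dots> \<le> (w + 1) * p" using real by (simp add: algebra_simps)
      finally have "k / (w + 1) * ln (S / s) \<le> p" using w by (simp add: divide_simps mult.commute)
      then show ?thesis using real by (simp add: ennreal_leI)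
    qed simp
  qed
qed

lemma is_loewner_const:
  assumes "DIM('a::euclidean_space) \<ge> 2"
  shows "is_loewner_const TYPE('a) (loewner_const TYPE('a))"
  unfolding loewner_const_def by (rule someI_ex[OF is_loewner_const_exists[OF assms]])

lemma loewner_const_pos: "DIM('a::euclidean_space) \<ge> 2 \<Longrightarrow> loewner_const TYPE('a) > 0"
  using is_loewner_const unfolding is_loewner_const_def by blast

lemma loewner_const_le:
  fixes \<rho> :: "'a::euclidean_space \<Rightarrow> ennreal"
  assumes "DIM('a) \<ge> 2" "\<rho> \<in> borel_measurable borel" "0 < s" "s < S"
    and "\<And>t. s < t \<Longrightarrow> t < S \<Longrightarrow> sphere_joinable \<rho> c t"
  shows "ennreal (loewner_const TYPE('a) * ln (S / s)) \<le> (\<integral>\<^sup>+ x. \<rho> x ^ DIM('a) \<partial>lborel)"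
  using is_loewner_const[OF assms(1)] assms unfolding is_loewner_const_def by blast

text \<open>Each arc joining the two sets on a separating sphere contains the image of a path of the
  ring family, by \<open>subpath_lift\<close>. Admissibility for the ring images therefore forces
  the arc condition on every sphere of the range.\<close>

lemma (in omitting_homeo) modulus_lower_bound:
  assumes sub: "cball z r2 \<subseteq> D" and r: "0 < r1" "r1 < r2" and s: "0 < s" "s < S"
    and H: "\<And>t. s < t \<Longrightarrow> t < S \<Longrightarrow> sphere_separates f z r1 r2 u c t"
  shows "ennreal (loewner_const TYPE('a) * ln (S / s)) \<le> modulus (ring_image f D z r1 r2)"
  unfolding modulus_def
proof (rule INF_greatest, clarify)
  fix \<rho> :: "'a \<Rightarrow> ennreal" assume adm: "admissible \<rho> (ring_image f D z r1 r2)"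
  show "ennreal (loewner_const TYPE('a) * ln (S / s)) \<le> (\<integral>\<^sup>+ x. \<rho> x ^ DIM('a) \<partial>lborel)"
  proof (rule loewner_const_le[OF dim2 _ s])
    show "\<rho> \<in> borel_measurable borel" using adm by (simp add: admissible_def)
    fix t assume t: "s < t" "t < S"
    then have t0: "t > 0" using s by simp
    obtain w1 w2 where w: "Some w1 \<in> f ` cball z r1" "dist w1 c = t" "Some w2 \<notin> f ` cball z r2" "dist w2 c = t"
      and u: "dist u c \<noteq> t" using H[OF t] by blast
    define a where "a = (w1 - c) /\<^sub>R t"
    define b where "b = (w2 - c) /\<^sub>R t"
    have ab: "norm a = 1" "norm b = 1" "c + t *\<^sub>R a = w1" "c + t *\<^sub>R b = w2"
      using w t0 by (auto simp: a_def b_def dist_norm)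
    have "1 \<le> ennreal (48 * t) * (\<integral>\<^sup>+ \<tau>. \<rho> (c + t *\<^sub>R \<beta> \<tau>) * indicator {0..1} \<tau> \<partial>lborel)"
      if "sphere_arc \<beta> a b" for \<beta>
    proof -
      have \<beta>: "48-lipschitz_on {0..1} \<beta>" "\<forall>\<tau>\<in>{0..1}. norm (\<beta> \<tau>) = 1" "\<beta> 0 = a" "\<beta> 1 = b" using that by auto
      define B where "B \<tau> = c + t *\<^sub>R \<beta> \<tau>" for \<tau>
      have lip: "(48 * t)-lipschitz_on {0..1} B"
      proof (rule lipschitz_onI)
        fix x y :: real assume xy: "x \<in> {0..1}" "y \<in> {0..1}"
        have "dist (B x) (B y) = t * dist (\<beta> x) (\<beta> y)"
          using t0 by (simp add: B_def dist_norm scaleR_diff_right[symmetric] del: scaleR_diff_right)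
        also have "\<dots> \<le> t * (48 * dist x y)" using lipschitz_onD[OF \<beta>(1) xy] t0 by (intro mult_left_mono) auto
        finally show "dist (B x) (B y) \<le> 48 * t * dist x y" by (simp add: ac_simps)
      qed (use t0 in simp)
      have Bu: "B \<tau> \<noteq> u" if "\<tau> \<in> {0..1}" for \<tau>
      proof -
        have "dist (B \<tau>) c = t" using \<beta>(2) that t0 by (simp add: B_def dist_norm)
        then show ?thesis using u by auto
      qed
      have B01: "Some (B 0) \<in> f ` cball z r1" "Some (B 1) \<notin> f ` cball z r2"
        using w ab \<beta> by (auto simp: B_def)
      show ?thesis
      proof (rule subpath_lift[OF sub r lipschitz_on_continuous_on[OF lip] _ B01])
        fix \<gamma> x y assume g: "0 \<le> x" "x < y" "y \<le> 1" "\<gamma> \<in> path_family (sphere z r1) (sphere z r2) D"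
          "\<And>t. t \<in> {0..1} \<Longrightarrow> \<gamma> t \<in> D \<and> f (\<gamma> t) = Some (B (x + (y - x) * t))"
        have "1 \<le> ennreal (48 * t) * (\<integral>\<^sup>+ \<tau>. \<rho> (B \<tau>) * indicator {0..1} \<tau> \<partial>lborel)"
          by (rule admissible_lipschitz_subpath[OF adm g(4,1,2,3) _ lip]) (rule g(5))
        then show ?thesis by (simp add: B_def)
      qed (rule Bu)
    qed
    then show "sphere_joinable \<rho> c t"
      unfolding sphere_joinable_def using ab by blast
  qed
qed

section \<open>From Euclidean spheres to chordal distances\<close>

lemma height_ge_iff:
  assumes "t > 0" shows "1 / (1 + t\<^sup>2) \<le> height c p \<longleftrightarrow> (\<exists>w. p = Some w \<and> dist w c \<le> t)"
proof (cases p)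
  case None
  have "0 < 1 + t\<^sup>2" by (simp add: add_pos_nonneg)
  then show ?thesis by (simp add: None height_def not_le)
next
  case (Some w)
  have "0 < 1 + t\<^sup>2" "0 < 1 + (dist w c)\<^sup>2" by (auto simp: add_pos_nonneg)
  then have "1 / (1 + t\<^sup>2) \<le> height c p \<longleftrightarrow> (dist w c)\<^sup>2 \<le> t\<^sup>2" by (simp add: Some height_def divide_simps)
  also have "\<dots> \<longleftrightarrow> dist w c \<le> t" using assms by (simp add: power2_le_iff_abs_le)
  finally show ?thesis by (simp add: Some)
qed

lemma height_le_iff:
  assumes "t > 0" shows "height c p \<le> 1 / (1 + t\<^sup>2) \<longleftrightarrow> (\<forall>w. p = Some w \<longrightarrow> t \<le> dist w c)"
proof (cases p)
  case (Some w)
  have "0 < 1 + t\<^sup>2" "0 < 1 + (dist w c)\<^sup>2" by (auto simp: add_pos_nonneg)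
  then have "height c p \<le> 1 / (1 + t\<^sup>2) \<longleftrightarrow> t\<^sup>2 \<le> (dist w c)\<^sup>2" by (simp add: Some height_def divide_simps)
  also have "\<dots> \<longleftrightarrow> t \<le> dist w c" using assms by (simp add: power_mono_iff)
  finally show ?thesis by (simp add: Some)
qed (simp add: height_def)

text \<open>In the first alternative \<open>e0\<close> and \<open>q\<close> are inside the sphere
  and \<open>e1\<close> and \<open>u\<close> outside, which fits a finite centre; in the second the
  sides are exchanged, which fits a neighbourhood of infinity. The same point \<open>u\<close> is
  the far point of the complement in both.\<close>

lemma (in omitting_homeo) sphere_meets_both:
  assumes sub: "cball z r2 \<subseteq> D" and r: "r1 < r2" and e: "e0 \<in> cball z r1" "e1 \<in> cball z r1"
    and q: "q \<notin> f ` cball z r2" and t: "t > 0"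
    and H: "height c (f e1) \<le> 1 / (1 + t\<^sup>2) \<and> height c (Some u) < 1 / (1 + t\<^sup>2)
        \<and> 1 / (1 + t\<^sup>2) \<le> height c (f e0) \<and> 1 / (1 + t\<^sup>2) \<le> height c q
      \<or> 1 / (1 + t\<^sup>2) \<le> height c (f e1) \<and> 1 / (1 + t\<^sup>2) < height c (Some u)
        \<and> height c (f e0) \<le> 1 / (1 + t\<^sup>2) \<and> height c q \<le> 1 / (1 + t\<^sup>2)"
  shows "sphere_separates f z r1 r2 u c t"
proof (intro conjI)
  show "dist u c \<noteq> t" using H by (auto simp: height_def)
  have sub1: "cball z r1 \<subseteq> D" using sub r by auto
  show "\<exists>w. Some w \<in> f ` cball z r1 \<and> dist w c = t"
    using H sphere_meets_image[OF sub1 e t] sphere_meets_image[OF sub1 e(2,1) t] by metis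
  have "q \<noteq> Some u" using H by auto
  then show "\<exists>w. Some w \<notin> f ` cball z r2 \<and> dist w c = t"
    using H sphere_meets_complement[OF sub q _ t] by metis
qed

text \<open>The weight of the chordal metric is the norm of the pair \<open>(1, w)\<close>, hence
  1-Lipschitz in \<open>w\<close>.\<close>

lemma sqrt_one_plus_norm_bounds:
  fixes a w :: "'a::euclidean_space"
  shows "\<bar>sqrt (1 + (norm w)\<^sup>2) - sqrt (1 + (norm a)\<^sup>2)\<bar> \<le> dist w a" "norm w \<le> sqrt (1 + (norm w)\<^sup>2)"
    "sqrt (1 + (norm w)\<^sup>2) \<le> 1 + norm w"
proof -
  have n: "sqrt (1 + (norm x)\<^sup>2) = norm (1 :: real, x)" for x :: 'a by (simp add: norm_Pair)
  have "norm ((1::real, w) - (1, a)) = dist w a" by (simp add: norm_Pair dist_norm)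
  then show "\<bar>sqrt (1 + (norm w)\<^sup>2) - sqrt (1 + (norm a)\<^sup>2)\<bar> \<le> dist w a"
    unfolding n using norm_triangle_ineq3[of "(1::real, w)" "(1, a)"] by simp
  show "norm w \<le> sqrt (1 + (norm w)\<^sup>2)" by (rule real_le_rsqrt) simp
  show "sqrt (1 + (norm w)\<^sup>2) \<le> 1 + norm w"
    by (rule real_le_lsqrt) (auto simp: power2_eq_square algebra_simps)
qed

text \<open>\<open>\<sigma> * N \<le> 1\<close> says that \<open>a\<close> has chordal distance at
  least \<sigma> from infinity. At scales up to \<sigma> the chordal metric about \<open>a\<close>
  is then, up to constants, the Euclidean one divided by \<open>N^2\<close>, because the weight
  hardly varies.\<close>

lemma chordal_near_far_at_finite:
  fixes a :: "'a::euclidean_space"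
  defines "N \<equiv> sqrt (1 + (norm a)\<^sup>2)"
  assumes \<sigma>: "\<sigma> > 0" "\<sigma> * N \<le> 1" and R: "R > 8"
  shows "chordal x (Some a) \<le> \<sigma> / R \<Longrightarrow> \<exists>w. x = Some w \<and> dist w a \<le> 2 * \<sigma> * N\<^sup>2 / R"
    and "\<sigma> \<le> chordal x (Some a) \<Longrightarrow> x = Some w \<Longrightarrow> \<sigma> * N\<^sup>2 / 2 \<le> dist w a"
proof -
  have N: "N > 0" unfolding N_def by (rule sqrt_one_plus_norm_pos)
  {
    assume h: "chordal x (Some a) \<le> \<sigma> / R"
    have \<sigma>N: "\<sigma> / R * N \<le> 1 / 8"
    proof -
      have "\<sigma> / R * N = \<sigma> * N / R" by simp
      also have "\<dots> \<le> 1 / 8" using \<sigma> R N by (intro frac_le) auto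
      finally show ?thesis .
    qed
    show "\<exists>w. x = Some w \<and> dist w a \<le> 2 * \<sigma> * N\<^sup>2 / R"
    proof (cases x)
      case None
      then have "1 / N \<le> \<sigma> / R" using h by (simp add: chordal_def N_def)
      then have "1 / N * N \<le> \<sigma> / R * N" using N by (intro mult_right_mono) auto
      then have "1 \<le> \<sigma> / R * N" using N by simp
      then show ?thesis using \<sigma>N by linarith
    next
      case (Some w)
      define B where "B = sqrt (1 + (norm w)\<^sup>2)"
      have B: "B > 0" unfolding B_def by (rule sqrt_one_plus_norm_pos)
      have "dist w a / (B * N) \<le> \<sigma> / R" using h by (simp add: Some chordal_def B_def N_def dist_norm)
      then have "dist w a \<le> \<sigma> / R * (B * N)" using B N by (subst (asm) pos_divide_le_eq) auto
      also have "\<dots> = \<sigma> / R * N * B" by simp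
      also have "\<dots> \<le> \<sigma> / R * N * (N + dist w a)"
        using sqrt_one_plus_norm_bounds(1)[of w a] \<sigma> R N unfolding B_def N_def by (intro mult_left_mono) auto
      also have "\<dots> = \<sigma> / R * N\<^sup>2 + \<sigma> / R * N * dist w a" by (simp only: distrib_left power2_eq_square mult.assoc)
      also have "\<sigma> / R * N * dist w a \<le> 1 / 8 * dist w a" using \<sigma>N by (intro mult_right_mono) auto
      finally have "dist w a \<le> \<sigma> / R * N\<^sup>2 + 1 / 8 * dist w a" by simp
      moreover have "2 * \<sigma> * N\<^sup>2 / R = 2 * (\<sigma> / R * N\<^sup>2)" by simp
      ultimately have "dist w a \<le> 2 * \<sigma> * N\<^sup>2 / R" using zero_le_dist[of w a] by linarith
      then show ?thesis using Some by blast
    qed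
  }
  assume h: "\<sigma> \<le> chordal x (Some a)" and x: "x = Some w"
  show "\<sigma> * N\<^sup>2 / 2 \<le> dist w a"
  proof (rule ccontr)
    assume "\<not> ?thesis"
    then have d: "dist w a < \<sigma> * N\<^sup>2 / 2" by simp
    define B where "B = sqrt (1 + (norm w)\<^sup>2)"
    have B: "B > 0" unfolding B_def by (rule sqrt_one_plus_norm_pos)
    have "\<sigma> * N\<^sup>2 / 2 \<le> N / 2"
      using mult_right_mono[OF \<sigma>(2), of N] N by (simp add: power2_eq_square mult.assoc)
    then have BN: "N / 2 \<le> B" using d sqrt_one_plus_norm_bounds(1)[of w a] unfolding B_def N_def by linarith
    have "\<sigma> \<le> dist w a / (B * N)" using h by (simp add: x chordal_def B_def N_def dist_norm)
    then have "\<sigma> * (B * N) \<le> dist w a" using B N by (subst (asm) pos_le_divide_eq) auto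
    moreover have "\<sigma> * (N / 2 * N) \<le> \<sigma> * (B * N)" using BN \<sigma> N by (intro mult_left_mono mult_right_mono) auto
    moreover have "\<sigma> * (N / 2 * N) = \<sigma> * N\<^sup>2 / 2" by (simp add: power2_eq_square)
    ultimately show False using d by linarith
  qed
qed

text \<open>Near infinity the chordal distance to infinity behaves like the inverse of the norm, so
  chordally near points have large norm.\<close>

lemma chordal_near_far_at_infinity:
  assumes \<sigma>: "\<sigma> > 0" "R * \<sigma> \<le> 1" and R: "R > 8"
  shows "chordal (Some w) None \<le> 2 * \<sigma> \<Longrightarrow> 1 / (4 * \<sigma>) \<le> norm w"
    and "R * \<sigma> / 2 \<le> chordal x None \<Longrightarrow> \<exists>w. x = Some w \<and> norm w \<le> 2 / (R * \<sigma>)"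
proof -
  have R\<sigma>: "0 < R * \<sigma>" using R \<sigma> by simp
  {
    assume h: "chordal (Some w) None \<le> 2 * \<sigma>"
    define B where "B = sqrt (1 + (norm w)\<^sup>2)"
    have B: "B > 0" unfolding B_def by (rule sqrt_one_plus_norm_pos)
    have "1 / B \<le> 2 * \<sigma>" using h by (simp add: chordal_None B_def)
    then have "1 \<le> 2 * \<sigma> * B" using B by (subst (asm) pos_divide_le_eq) auto
    then have "1 / (2 * \<sigma>) \<le> B" using \<sigma> by (simp add: divide_simps mult.commute)
    moreover have "1 / (2 * \<sigma>) = 1 / (4 * \<sigma>) + 1 / (4 * \<sigma>)" using \<sigma> by (simp add: field_simps)
    moreover have "1 \<le> 1 / (4 * \<sigma>)"
    proof -
      have "8 * \<sigma> \<le> R * \<sigma>" using R \<sigma> by (intro mult_right_mono) auto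
      then have "4 * \<sigma> \<le> 1" using \<sigma> by linarith
      then show ?thesis using \<sigma> by simp
    qed
    ultimately show "1 / (4 * \<sigma>) \<le> norm w" using sqrt_one_plus_norm_bounds(3)[of w] unfolding B_def by linarith
  }
  assume h: "R * \<sigma> / 2 \<le> chordal x None"
  show "\<exists>w. x = Some w \<and> norm w \<le> 2 / (R * \<sigma>)"
  proof (cases x)
    case None
    then show ?thesis using h R\<sigma> by simp
  next
    case (Some w)
    define B where "B = sqrt (1 + (norm w)\<^sup>2)"
    have B: "B > 0" unfolding B_def by (rule sqrt_one_plus_norm_pos)
    have "R * \<sigma> / 2 \<le> 1 / B" using h by (simp add: Some chordal_None B_def)
    then have "R * \<sigma> / 2 * B \<le> 1" using B by (subst (asm) pos_le_divide_eq) auto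
    then have "B \<le> 2 / (R * \<sigma>)" using R\<sigma> by (subst pos_le_divide_eq) (auto simp: mult.commute)
    then show ?thesis using Some sqrt_one_plus_norm_bounds(2)[of w] unfolding B_def by auto
  qed
qed

text \<open>If \<open>p\<close> is not too close to infinity the Euclidean spheres about \<open>p\<close> are used,
  otherwise those about the origin.\<close>
lemma (in omitting_homeo) chordal_modulus_estimate:
  assumes sub: "cball z r2 \<subseteq> D" and r: "0 < r1" "r1 < r2"
    and e: "e0 \<in> cball z r1" "e1 \<in> cball z r1" and q: "q \<notin> f ` cball z r2"
    and near: "chordal (f e0) p \<le> s" "chordal q p \<le> s" and far: "T \<le> chordal (f e1) p" "T \<le> chordal (Some u) p"
    and sT: "0 < s" "0 < T" and M: "0 \<le> M" and mod: "modulus (ring_image f D z r1 r2) \<le> ennreal M"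
  shows "T / 64 * exp (- (2 * M / loewner_const TYPE('a))) \<le> s"
proof -
  define \<kappa> where "\<kappa> = loewner_const TYPE('a)"
  have \<kappa>: "\<kappa> > 0" unfolding \<kappa>_def by (rule loewner_const_pos[OF dim2])
  have "T / 64 * exp (- (2 * M / \<kappa>)) \<le> s"
  proof (cases "T / 64 \<le> s")
    case True
    have "T / 64 * exp (- (2 * M / \<kappa>)) \<le> T / 64 * 1" using M \<kappa> sT by (intro mult_left_mono) auto
    then show ?thesis using True by linarith
  next
    case False
    \<comment> \<open>\<sigma> is the geometric mean of \<open>s\<close> and \<open>T\<close>, with
      \<open>s = \<sigma> / R\<close> and \<open>T = R * \<sigma>\<close>. If \<open>p\<close> is at
      least \<sigma> away from infinity, the scales from \<open>s\<close> to \<sigma> are used,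
      otherwise those from \<sigma> to \<open>T\<close>. Either way the ratio is
      \<open>R = sqrt (T / s)\<close>, which accounts for the 2 in the exponent; the case
      distinction before gives \<open>R > 8\<close>.\<close>
    define R where "R = sqrt (T / s)"
    define \<sigma> where "\<sigma> = sqrt (s * T)"
    have \<sigma>: "\<sigma> > 0" using sT by (simp add: \<sigma>_def)
    have "64 < T / s" using False sT by (simp add: divide_simps)
    then have R: "R > 8" unfolding R_def by (intro real_less_rsqrt) simp
    have R\<sigma>: "R * \<sigma> = T"
      unfolding R_def \<sigma>_def using sT by (simp add: real_sqrt_mult[symmetric])
    have \<sigma>R: "\<sigma> / R = s"
      unfolding R_def \<sigma>_def using sT by (simp add: real_sqrt_divide[symmetric])
    have T1: "R * \<sigma> \<le> 1" unfolding R\<sigma> using far(1) chordal_le_1 by (rule order_trans)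
    have "\<sigma> \<le> R * \<sigma>" using R \<sigma> by simp
    \<comment> \<open>\<open>R / 8\<close> is the ratio of radii obtained near infinity; at a finite
      centre the ratio is \<open>R / 4\<close>, so the smaller value covers both.\<close>
    have goal: "\<kappa> * ln (R / 8) \<le> M" if S: "0 < s1" "R / 8 * s1 \<le> S1"
      and H: "\<And>t. s1 < t \<Longrightarrow> t < S1 \<Longrightarrow> sphere_separates f z r1 r2 u c t" for c s1 S1
    proof -
      have "1 * s1 < R / 8 * s1" using R S(1) by (intro mult_strict_right_mono) auto
      then have "s1 < S1" using S by linarith
      then have "ennreal (\<kappa> * ln (S1 / s1)) \<le> modulus (ring_image f D z r1 r2)"
        unfolding \<kappa>_def by (rule modulus_lower_bound[OF sub r S(1)]) (rule H; assumption)
      then have "ennreal (\<kappa> * ln (S1 / s1)) \<le> ennreal M" using mod by (rule order_trans)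
      then have "\<kappa> * ln (S1 / s1) \<le> M" using M by (simp add: ennreal_le_iff)
      moreover have "ln (R / 8) \<le> ln (S1 / s1)"
        using S R by (intro ln_mono) (auto simp: pos_le_divide_eq)
      then have "\<kappa> * ln (R / 8) \<le> \<kappa> * ln (S1 / s1)" using \<kappa> by simp
      ultimately show ?thesis by linarith
    qed
    have "\<kappa> * ln (R / 8) \<le> M"
    proof (cases "\<exists>a. p = Some a \<and> \<sigma> \<le> chordal p None")
      case True
      then obtain a where a: "p = Some a" "\<sigma> \<le> chordal p None" by blast
      define N where "N = sqrt (1 + (norm a)\<^sup>2)"
      have N: "N > 0" unfolding N_def by (rule sqrt_one_plus_norm_pos)
      have "\<sigma> \<le> 1 / N" using a by (simp add: chordal_None N_def)
      then have \<sigma>N: "\<sigma> * N \<le> 1" using N by (simp add: pos_le_divide_eq)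
      note nf = chordal_near_far_at_finite[of \<sigma> a R, folded N_def, OF \<sigma> \<sigma>N R]
      show ?thesis
      proof (rule goal)
        show "0 < 2 * \<sigma> * N\<^sup>2 / R" using \<sigma> N R by simp
        show "R / 8 * (2 * \<sigma> * N\<^sup>2 / R) \<le> \<sigma> * N\<^sup>2 / 2" using \<sigma> N R by simp
        fix t assume t: "2 * \<sigma> * N\<^sup>2 / R < t" "t < \<sigma> * N\<^sup>2 / 2"
        have "0 < 2 * \<sigma> * N\<^sup>2 / R" using \<sigma> N R by simp
        then have t0: "t > 0" using t by linarith
        have "\<exists>w. f e0 = Some w \<and> dist w a \<le> 2 * \<sigma> * N\<^sup>2 / R" "\<exists>w. q = Some w \<and> dist w a \<le> 2 * \<sigma> * N\<^sup>2 / R"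
          using near \<sigma>R a by (auto intro!: nf(1))
        then have 1: "1 / (1 + t\<^sup>2) \<le> height a (f e0)" "1 / (1 + t\<^sup>2) \<le> height a q"
          unfolding height_ge_iff[OF t0] using t by (meson less_imp_le order_trans)+
        have "\<sigma> * N\<^sup>2 / 2 \<le> dist w a" if "f e1 = Some w" for w
          by (rule nf(2)[OF _ that]) (use far a R\<sigma> \<open>\<sigma> \<le> R * \<sigma>\<close> in simp)
        then have 2: "height a (f e1) \<le> 1 / (1 + t\<^sup>2)"
          unfolding height_le_iff[OF t0] using t by (meson less_imp_le order_trans)
        have "\<sigma> * N\<^sup>2 / 2 \<le> dist u a"
          by (rule nf(2)[OF _ refl]) (use far a R\<sigma> \<open>\<sigma> \<le> R * \<sigma>\<close> in simp)
        then have 3: "height a (Some u) < 1 / (1 + t\<^sup>2)"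
          using height_ge_iff[OF t0, of a "Some u"] t by auto
        show "sphere_separates f z r1 r2 u a t"
          by (rule sphere_meets_both[OF sub r(2) e q t0]) (use 1 2 3 in blast)
      qed
    next
      case False
      have p: "chordal p None < \<sigma>" using False \<sigma> by (cases p) auto
      have "\<sigma> / R \<le> \<sigma>" using \<sigma> R by (simp add: divide_simps)
      have nr: "chordal x None \<le> 2 * \<sigma>" if "chordal x p \<le> s" for x
        using chordal_triangle[of x None p] that p \<sigma>R \<open>\<sigma> / R \<le> \<sigma>\<close> by linarith
      have "\<sigma> \<le> R * \<sigma> / 2" using R \<sigma> by simp
      then have fr: "R * \<sigma> / 2 \<le> chordal x None" if "T \<le> chordal x p" for x
        using chordal_triangle[of x p None] that p R\<sigma> chordal_commute[of None p] by linarith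
      note nf = chordal_near_far_at_infinity[OF \<sigma> T1 R]
      show ?thesis
      proof (rule goal)
        show s1: "0 < 2 / (R * \<sigma>)" using \<sigma> R by simp
        show "R / 8 * (2 / (R * \<sigma>)) \<le> 1 / (4 * \<sigma>)" using \<sigma> R by simp
        fix t assume t: "2 / (R * \<sigma>) < t" "t < 1 / (4 * \<sigma>)"
        then have t0: "t > 0" using s1 by linarith
        have 1: "height 0 x \<le> 1 / (1 + t\<^sup>2)" if "chordal x p \<le> s" for x
          unfolding height_le_iff[OF t0]
        proof (intro allI impI)
          fix w assume "x = Some w"
          then have "1 / (4 * \<sigma>) \<le> norm w" using nr[OF that] by (intro nf(1)) auto
          then show "t \<le> dist w 0" using t by simp
        qed
        have 2: "1 / (1 + t\<^sup>2) \<le> height 0 (f e1)"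
          unfolding height_ge_iff[OF t0] using nf(2)[OF fr[OF far(1)]] t by force
        have 3: "1 / (1 + t\<^sup>2) < height 0 (Some u)"
          using height_le_iff[OF t0, of 0 "Some u"] nf(2)[OF fr[OF far(2)]] t by auto
        show "sphere_separates f z r1 r2 u 0 t"
          by (rule sphere_meets_both[OF sub r(2) e q t0]) (use 1[OF near(1)] 1[OF near(2)] 2 3 in blast)
      qed
    qed
    then have "ln (R / 8) \<le> M / \<kappa>" using \<kappa> by (simp add: pos_le_divide_eq mult.commute)
    then have "exp (ln (R / 8)) \<le> exp (M / \<kappa>)" by simp
    then have "R / 8 \<le> exp (M / \<kappa>)" using R by simp
    then have "(R / 8)\<^sup>2 \<le> (exp (M / \<kappa>))\<^sup>2" using R by (intro power_mono) auto
    also have "(exp (M / \<kappa>))\<^sup>2 = exp (2 * M / \<kappa>)" by (simp add: exp_double[symmetric])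
    also have "(R / 8)\<^sup>2 = T / s / 64" using sT by (simp add: R_def power_divide)
    finally have "T / s / 64 * (s * exp (- (2 * M / \<kappa>))) \<le> exp (2 * M / \<kappa>) * (s * exp (- (2 * M / \<kappa>)))"
      using sT by (intro mult_right_mono) auto
    also have "\<dots> = s * (exp (2 * M / \<kappa>) * exp (- (2 * M / \<kappa>)))" by (simp only: ac_simps)
    also have "\<dots> = s" by (simp add: exp_add[symmetric])
    also have "T / s / 64 * (s * exp (- (2 * M / \<kappa>))) = T / 64 * exp (- (2 * M / \<kappa>))" using sT by simp
    finally show ?thesis .
  qed
  then show ?thesis by (simp only: \<kappa>_def)
qed

section \<open>Hausdorff measure and spherical means\<close>

definition hausdorff_content :: "nat \<Rightarrow> real \<Rightarrow> 'a::euclidean_space set \<Rightarrow> ennreal" where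
  "hausdorff_content s \<delta> E = (INF C \<in> {C :: nat \<Rightarrow> 'a set. E \<subseteq> (\<Union>i. C i) \<and> (\<forall>i. bounded (C i) \<and> diameter (C i) \<le> \<delta>)}.
       (\<Sum>i. ennreal (diameter (C i) ^ s)))"

lemma hausdorff_outer_eq: "hausdorff_outer s E = (SUP \<delta>\<in>{0<..}. hausdorff_content s \<delta> E)"
  unfolding hausdorff_outer_def hausdorff_content_def ..

lemma hausdorff_content_mono: "E \<subseteq> F \<Longrightarrow> hausdorff_content s \<delta> E \<le> hausdorff_content s \<delta> F"
  unfolding hausdorff_content_def by (rule INF_superset_mono) auto

lemma hausdorff_content_le_outer: "\<delta> > 0 \<Longrightarrow> hausdorff_content s \<delta> E \<le> hausdorff_outer s E"
  unfolding hausdorff_outer_eq by (rule SUP_upper) auto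

lemma hausdorff_content_subadditive:
  fixes A :: "nat \<Rightarrow> 'a::euclidean_space set"
  shows "hausdorff_content s \<delta> (\<Union>i. A i) \<le> (\<Sum>i. hausdorff_content s \<delta> (A i))"
proof (rule ennreal_le_epsilon)
  fix e :: real assume e: "0 < e" and fin: "(\<Sum>i. hausdorff_content s \<delta> (A i)) < top"
  define e' where "e' i = e * (1 / 2) ^ Suc i" for i
  have e': "e' i > 0" for i using e by (simp add: e'_def)
  have "e' sums (e * 1)" unfolding e'_def by (intro sums_mult power_half_series)
  then have sume: "(\<Sum>i. ennreal (e' i)) = ennreal e"
    using e' by (intro suminf_ennreal_eq) (auto simp: less_imp_le)
  have "\<exists>C :: nat \<Rightarrow> 'a set. A i \<subseteq> (\<Union>j. C j) \<and> (\<forall>j. bounded (C j) \<and> diameter (C j) \<le> \<delta>)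
      \<and> (\<Sum>j. ennreal (diameter (C j) ^ s)) \<le> hausdorff_content s \<delta> (A i) + ennreal (e' i)" for i
  proof -
    have "hausdorff_content s \<delta> (A i) < top"
      using fin by (metis ennreal_suminf_lessD)
    then have "hausdorff_content s \<delta> (A i) < hausdorff_content s \<delta> (A i) + ennreal (e' i)"
      using e'[of i] by simp
    then obtain C where "C \<in> {C :: nat \<Rightarrow> 'a set. A i \<subseteq> (\<Union>j. C j) \<and> (\<forall>j. bounded (C j) \<and> diameter (C j) \<le> \<delta>)}"
      "(\<Sum>j. ennreal (diameter (C j) ^ s)) < hausdorff_content s \<delta> (A i) + ennreal (e' i)"
      unfolding hausdorff_content_def by (subst (asm) INF_less_iff) blast
    then show ?thesis by (intro exI[of _ C]) auto
  qed
  then obtain C where C: "\<And>i. A i \<subseteq> (\<Union>j. C i j)" "\<And>i j. bounded (C i j) \<and> diameter (C i j :: 'a set) \<le> \<delta>"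
      "\<And>i. (\<Sum>j. ennreal (diameter (C i j) ^ s)) \<le> hausdorff_content s \<delta> (A i) + ennreal (e' i)"
    by metis
  define B where "B k = (case prod_decode k of (i, j) \<Rightarrow> C i j)" for k
  have "(\<Union>i. A i) \<subseteq> (\<Union>k. B k)"
  proof
    fix x assume "x \<in> (\<Union>i. A i)"
    then obtain i j where "x \<in> C i j" using C(1) by blast
    then have "x \<in> B (prod_encode (i, j))" by (simp add: B_def)
    then show "x \<in> (\<Union>k. B k)" by blast
  qed
  moreover have "\<forall>k. bounded (B k) \<and> diameter (B k) \<le> \<delta>" using C(2) by (auto simp: B_def split: prod.split)
  ultimately have "hausdorff_content s \<delta> (\<Union>i. A i) \<le> (\<Sum>k. ennreal (diameter (B k) ^ s))"
    unfolding hausdorff_content_def by (intro INF_lower) auto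
  also have "\<dots> = (\<Sum>k. (\<lambda>(i, j). ennreal (diameter (C i j) ^ s)) (prod_decode k))"
    by (simp add: B_def split_beta)
  also have "\<dots> = (\<Sum>i. \<Sum>j. ennreal (diameter (C i j) ^ s))"
    by (rule suminf_ennreal_2dimen) simp
  also have "\<dots> \<le> (\<Sum>i. hausdorff_content s \<delta> (A i) + ennreal (e' i))"
    by (intro suminf_le C(3)) auto
  also have "\<dots> = (\<Sum>i. hausdorff_content s \<delta> (A i)) + ennreal e"
    by (subst suminf_add[symmetric]) (auto simp: sume)
  finally show "hausdorff_content s \<delta> (\<Union>i. A i) \<le> (\<Sum>i. hausdorff_content s \<delta> (A i)) + ennreal e" .
qed

text \<open>Positivity of \<open>s\<close> matters for the empty set: as \<open>0 ^ 0 = 1\<close>,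
  with exponent 0 every empty covering set would count 1.\<close>

lemma hausdorff_outer_measure_space:
  assumes "s > 0"
  shows "outer_measure_space UNIV (hausdorff_outer s :: 'a::euclidean_space set \<Rightarrow> ennreal)"
  unfolding outer_measure_space_def
proof (intro conjI)
  have "hausdorff_content s \<delta> ({} :: 'a set) \<le> 0" if "\<delta> > 0" for \<delta>
  proof -
    have "hausdorff_content s \<delta> ({} :: 'a set) \<le> (\<Sum>i::nat. ennreal (diameter ({} :: 'a set) ^ s))"
      unfolding hausdorff_content_def using that by (intro INF_lower) auto
    then show ?thesis using assms by (simp add: power_0_left)
  qed
  then have "hausdorff_outer s ({} :: 'a set) = 0"
    unfolding hausdorff_outer_eq by (auto intro!: antisym SUP_least)
  then show "positive UNIV (hausdorff_outer s :: 'a set \<Rightarrow> ennreal)" by (simp add: positive_def)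
  show "increasing UNIV (hausdorff_outer s :: 'a set \<Rightarrow> ennreal)"
    unfolding increasing_def hausdorff_outer_eq by (auto intro!: SUP_mono hausdorff_content_mono)
  show "countably_subadditive UNIV (hausdorff_outer s :: 'a set \<Rightarrow> ennreal)"
    unfolding countably_subadditive_def
  proof (intro allI impI)
    fix A :: "nat \<Rightarrow> 'a set"
    show "hausdorff_outer s (\<Union>i. A i) \<le> (\<Sum>i. hausdorff_outer s (A i))"
    proof (subst hausdorff_outer_eq, rule SUP_least)
      fix \<delta> :: real assume "\<delta> \<in> {0<..}"
      have "hausdorff_content s \<delta> (\<Union>i. A i) \<le> (\<Sum>i. hausdorff_content s \<delta> (A i))"
        by (rule hausdorff_content_subadditive)
      also have "\<dots> \<le> (\<Sum>i. hausdorff_outer s (A i))"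
        using \<open>\<delta> \<in> {0<..}\<close> by (intro suminf_le hausdorff_content_le_outer) auto
      finally show "hausdorff_content s \<delta> (\<Union>i. A i) \<le> (\<Sum>i. hausdorff_outer s (A i))" .
    qed
  qed
qed

text \<open>Caratheodory's theorem shows that the outer measure really is a measure on its lambda
  system; otherwise \<open>measure_of\<close> would fall back to the zero measure.\<close>

lemma emeasure_hausdorff_measure:
  assumes "s > 0" and A: "A \<in> sets (hausdorff_measure s)"
  shows "emeasure (hausdorff_measure s) A = hausdorff_outer s A"
proof -
  have ms: "measure_space UNIV (lambda_system UNIV UNIV (hausdorff_outer s)) (hausdorff_outer s :: 'a set \<Rightarrow> ennreal)"
    using sigma_algebra.caratheodory_lemma[OF sigma_algebra_Pow[of UNIV], of "hausdorff_outer s"]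
      hausdorff_outer_measure_space[OF assms(1)] by simp
  then have sa: "sigma_algebra UNIV (lambda_system UNIV UNIV (hausdorff_outer s :: 'a set \<Rightarrow> ennreal))"
    by (simp add: measure_space_def)
  have "sets (hausdorff_measure s :: 'a measure) = lambda_system UNIV UNIV (hausdorff_outer s)"
    unfolding hausdorff_measure_def using sigma_algebra.sets_measure_of_eq[OF sa] by simp
  then show ?thesis
    using ms A unfolding hausdorff_measure_def measure_space_def
    by (intro emeasure_measure_of_sigma) auto
qed

section \<open>Hausdorff measure on spheres against averages over directions\<close>

definition direction_cone :: "'a::euclidean_space \<Rightarrow> real \<Rightarrow> 'a set" where
  "direction_cone w e = {y \<in> cball 0 1. dist (sgn y) w \<le> e}"

lemma direction_cone_measurable [measurable]: "direction_cone w e \<in> sets borel"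
proof -
  have "direction_cone w e = {y \<in> space borel. y \<in> cball 0 1 \<and> dist (sgn y) w \<le> e}" by (auto simp: direction_cone_def)
  also have "\<dots> \<in> sets borel" by measurable
  finally show ?thesis .
qed

text \<open>For \<open>0 < e < 1\<close> the cone is covered by at most
  \<open>1 / e + 2 \<le> 3 / e\<close> balls of radius \<open>2 e\<close> centred at the multiples
  of \<open>e\<close> on its axis; one power of \<open>e\<close> is lost to their number. For
  \<open>e = 0\<close> the bound follows in the limit, and for \<open>e \<ge> 1\<close> the unit
  ball suffices.\<close>

lemma emeasure_direction_cone:
  fixes w :: "'a::euclidean_space"
  assumes n2: "DIM('a) \<ge> 2" and w: "norm w = 1" and e: "e \<ge> 0"
  shows "emeasure lborel (direction_cone w e) \<le> ennreal (3 * 2 ^ DIM('a) * unit_ball_vol DIM('a) * e ^ (DIM('a) - 1))"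
proof -
  let ?n = "DIM('a)"
  define V where "V = unit_ball_vol (real ?n)"
  have V: "V > 0" by (simp add: V_def)
  have small: "emeasure lborel (direction_cone w e) \<le> ennreal (3 * 2 ^ ?n * V * e ^ (?n - 1))" if e: "0 < e" "e < 1" for e
  proof -
    define K where "K = nat \<lceil>1 / e\<rceil>"
    have "direction_cone w e \<subseteq> (\<Union>k\<in>{..K}. cball ((real k * e) *\<^sub>R w) (2 * e))"
    proof
      fix y assume y: "y \<in> direction_cone w e"
      define k where "k = nat \<lfloor>norm y / e\<rfloor>"
      have ny: "norm y \<le> 1" using y by (simp add: direction_cone_def)
      have k0: "real k = of_int \<lfloor>norm y / e\<rfloor>" using e by (simp add: k_def)
      have "real k \<le> norm y / e" "norm y / e < real k + 1" unfolding k0 by linarith+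
      then have k: "real k * e \<le> norm y" "norm y \<le> real k * e + e"
        using e by (auto simp: pos_le_divide_eq pos_divide_less_eq algebra_simps)
      have "norm y / e \<le> 1 / e" using ny e by (intro divide_right_mono) auto
      then have "\<lfloor>norm y / e\<rfloor> \<le> \<lceil>1 / e\<rceil>" by linarith
      then have "k \<le> K" unfolding k_def K_def by (rule nat_mono)
      have "norm (y - (real k * e) *\<^sub>R w) \<le> norm (norm y *\<^sub>R (sgn y - w)) + norm ((norm y - real k * e) *\<^sub>R w)"
      proof -
        have "y - (real k * e) *\<^sub>R w = norm y *\<^sub>R (sgn y - w) + (norm y - real k * e) *\<^sub>R w"
          by (cases "y = 0") (simp_all add: sgn_div_norm algebra_simps)
        then show ?thesis by (metis norm_triangle_ineq)
      qed
      also have "norm (norm y *\<^sub>R (sgn y - w)) \<le> 1 * e"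
        using mult_mono[of "norm y" 1 "norm (sgn y - w)" e] y ny e by (simp add: direction_cone_def dist_norm)
      also have "norm ((norm y - real k * e) *\<^sub>R w) \<le> e" using k w by simp
      finally have "y \<in> cball ((real k * e) *\<^sub>R w) (2 * e)" by (simp add: dist_norm norm_minus_commute)
      then show "y \<in> (\<Union>k\<in>{..K}. cball ((real k * e) *\<^sub>R w) (2 * e))" using \<open>k \<le> K\<close> by blast
    qed
    then have "emeasure lborel (direction_cone w e) \<le> emeasure lborel (\<Union>k\<in>{..K}. cball ((real k * e) *\<^sub>R w) (2 * e))"
      by (intro emeasure_mono) auto
    also have "\<dots> \<le> (\<Sum>k\<in>{..K}. emeasure lborel (cball ((real k * e) *\<^sub>R w) (2 * e)))"
      by (intro emeasure_subadditive_finite) auto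
    also have "\<dots> = (\<Sum>k\<in>{..K}. ennreal (V * (2 * e) ^ ?n))"
      using e by (intro sum.cong refl) (simp add: emeasure_cball V_def)
    also have "\<dots> = ennreal (real (Suc K) * (V * (2 * e) ^ ?n))"
      using V e by (simp add: ennreal_of_nat_eq_real_of_nat[symmetric] ennreal_mult del: of_nat_Suc)
    also have "\<dots> \<le> ennreal (3 * 2 ^ ?n * V * e ^ (?n - 1))"
    proof (rule ennreal_leI)
      have "real K \<le> 1 / e + 1" unfolding K_def using e by (simp add: of_nat_nat)
      then have "real (Suc K) \<le> 1 / e + 2" by simp
      also have "\<dots> \<le> 3 / e" using e by (simp add: field_simps)
      finally have "real (Suc K) * (V * (2 * e) ^ ?n) \<le> 3 / e * (V * (2 * e) ^ ?n)"
        using V e by (intro mult_right_mono) auto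
      also have "e ^ ?n = e * e ^ (?n - 1)" by (metis DIM_positive power_minus_mult mult.commute)
      then have "3 / e * (V * (2 * e) ^ ?n) = 3 * 2 ^ ?n * V * e ^ (?n - 1)"
        using e by (simp add: power_mult_distrib)
      finally show "real (Suc K) * (V * (2 * e) ^ ?n) \<le> 3 * 2 ^ ?n * V * e ^ (?n - 1)" .
    qed
    finally show ?thesis .
  qed
  consider "e = 0" | "0 < e" "e < 1" | "1 \<le> e" using e by linarith
  then show ?thesis
  proof cases
    case 1
    have "emeasure lborel (direction_cone w 0) \<le> 0"
    proof (rule tendsto_lowerbound)
      have "((\<lambda>d. 3 * 2 ^ ?n * V * d ^ (?n - 1)) \<longlongrightarrow> 3 * 2 ^ ?n * V * 0 ^ (?n - 1)) (at_right (0::real))"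
        by (intro tendsto_intros)
      then have "((\<lambda>d. 3 * 2 ^ ?n * V * d ^ (?n - 1)) \<longlongrightarrow> 0) (at_right (0::real))"
        using n2 by (simp add: power_0_left)
      from tendsto_ennrealI[OF this]
      show "((\<lambda>d. ennreal (3 * 2 ^ ?n * V * d ^ (?n - 1))) \<longlongrightarrow> 0) (at_right (0::real))" by simp
      have "\<forall>\<^sub>F d in at_right (0::real). d \<in> {0<..<1}" by (rule eventually_at_right_real) simp
      then show "\<forall>\<^sub>F d in at_right 0. emeasure lborel (direction_cone w 0) \<le> ennreal (3 * 2 ^ ?n * V * d ^ (?n - 1))"
      proof (rule eventually_mono)
        fix d :: real assume d: "d \<in> {0<..<1}"
        have "emeasure lborel (direction_cone w 0) \<le> emeasure lborel (direction_cone w d)"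
          using d by (intro emeasure_mono) (auto simp: direction_cone_def)
        also have "\<dots> \<le> ennreal (3 * 2 ^ ?n * V * d ^ (?n - 1))" using d by (intro small) auto
        finally show "emeasure lborel (direction_cone w 0) \<le> ennreal (3 * 2 ^ ?n * V * d ^ (?n - 1))" .
      qed
    qed simp
    then show ?thesis unfolding 1 by simp
  next
    case 2
    then show ?thesis using small unfolding V_def by blast
  next
    case 3
    have "emeasure lborel (direction_cone w e) \<le> emeasure lborel (cball (0::'a) 1)"
      by (intro emeasure_mono) (auto simp: direction_cone_def)
    also have "\<dots> = ennreal V" by (simp add: emeasure_cball V_def)
    also have "\<dots> \<le> ennreal (3 * 2 ^ ?n * V * e ^ (?n - 1))"
    proof (rule ennreal_leI)
      have "(1::real) \<le> 3 * 2 ^ ?n" using one_le_power[of "2::real" ?n] by linarith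
      then have "1 * 1 \<le> 3 * 2 ^ ?n * e ^ (?n - 1)" using 3 by (intro mult_mono one_le_power) auto
      then have "V * 1 \<le> V * (3 * 2 ^ ?n * e ^ (?n - 1))" using V by (intro mult_left_mono) auto
      then show "V \<le> 3 * 2 ^ ?n * V * e ^ (?n - 1)" by (simp add: ac_simps)
    qed
    finally show ?thesis unfolding V_def .
  qed
qed

text \<open>A covering set of diameter \<open>d\<close> on the sphere of radius \<open>s\<close>
  contains only points whose directions lie in one cone of aperture \<open>d / s\<close>. Only this
  one inequality is needed, to pass finiteness from Hausdorff integrals to averages over directions;
  coverings of diameter at most 1 are enough for it.\<close>

lemma emeasure_directions_le_hausdorff:
  fixes x0 :: "'a::euclidean_space"
  assumes n2: "DIM('a) \<ge> 2" and s: "s > 0"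
  obtains k where "k > 0" "\<And>F E. F \<in> sets lborel \<Longrightarrow>
     (AE y in lborel. y \<in> F \<longrightarrow> y \<noteq> 0 \<and> y \<in> cball 0 1 \<and> x0 + s *\<^sub>R sgn y \<in> E) \<Longrightarrow>
     emeasure lborel F \<le> ennreal k * hausdorff_outer (DIM('a) - 1) E"
proof -
  let ?n = "DIM('a)"
  define V where "V = 3 * 2 ^ ?n * unit_ball_vol (real ?n)"
  have V: "V > 0" by (simp add: V_def)
  define k where "k = V * (1 / s) ^ (?n - 1)"
  have k: "k > 0" using V s by (simp add: k_def)
  show ?thesis
  proof (rule that[OF k])
    fix F E :: "'a set"
    assume F: "F \<in> sets lborel" and AE: "AE y in lborel. y \<in> F \<longrightarrow> y \<noteq> 0 \<and> y \<in> cball 0 1 \<and> x0 + s *\<^sub>R sgn y \<in> E"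
    have "ennreal (1 / k) * emeasure lborel F \<le> hausdorff_content (?n - 1) 1 E"
      unfolding hausdorff_content_def
    proof (rule INF_greatest, clarify)
      fix C :: "nat \<Rightarrow> 'a set"
      assume C: "E \<subseteq> (\<Union>i. C i)" "\<forall>i. bounded (C i) \<and> diameter (C i) \<le> 1"
      let ?T = "\<lambda>i. {y \<in> cball 0 1. y \<noteq> 0 \<and> x0 + s *\<^sub>R sgn y \<in> C i}"
      have exB: "\<exists>B. B \<in> sets borel \<and> ?T i \<subseteq> B
          \<and> emeasure lborel B \<le> ennreal k * ennreal (diameter (C i) ^ (?n - 1))" for i
      proof (cases "\<exists>y. y \<noteq> 0 \<and> x0 + s *\<^sub>R sgn y \<in> C i")
        case True
        then obtain v where v: "v \<noteq> 0" "x0 + s *\<^sub>R sgn v \<in> C i" by blast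
        have d: "diameter (C i) \<ge> 0" using C(2) by (simp add: diameter_ge_0)
        have "?T i \<subseteq> direction_cone (sgn v) (diameter (C i) / s)"
        proof clarify
          fix y assume y: "y \<in> cball 0 1" "y \<noteq> 0" "x0 + s *\<^sub>R sgn y \<in> C i"
          have "dist (x0 + s *\<^sub>R sgn y) (x0 + s *\<^sub>R sgn v) \<le> diameter (C i)"
            using C(2) y v by (intro diameter_bounded_bound) auto
          also have "dist (x0 + s *\<^sub>R sgn y) (x0 + s *\<^sub>R sgn v) = s * dist (sgn y) (sgn v)"
            using s by (simp add: dist_norm scaleR_diff_right[symmetric] del: scaleR_diff_right)
          finally have "dist (sgn y) (sgn v) \<le> diameter (C i) / s" using s by (simp add: pos_le_divide_eq mult.commute)
          then show "y \<in> direction_cone (sgn v) (diameter (C i) / s)" using y by (simp add: direction_cone_def)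
        qed
        moreover have "emeasure lborel (direction_cone (sgn v) (diameter (C i) / s)) \<le> ennreal (V * (diameter (C i) / s) ^ (?n - 1))"
          unfolding V_def using v s d by (intro emeasure_direction_cone n2) (auto simp: norm_sgn)
        moreover have "ennreal (V * (diameter (C i) / s) ^ (?n - 1)) = ennreal k * ennreal (diameter (C i) ^ (?n - 1))"
          using V s d by (simp add: k_def ennreal_mult[symmetric] power_divide)
        ultimately show ?thesis
          by (intro exI[of _ "direction_cone (sgn v) (diameter (C i) / s)"] conjI direction_cone_measurable) simp_all
      next
        case False
        then show ?thesis by (intro exI[of _ "{}"]) auto
      qed
      from choice[OF allI, OF exB] obtain B where B0: "\<forall>i. B i \<in> sets borel
          \<and> ?T i \<subseteq> B i
          \<and> emeasure lborel (B i) \<le> ennreal k * ennreal (diameter (C i) ^ (?n - 1))" ..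
      have B: "B i \<in> sets borel" "?T i \<subseteq> B i"
          "emeasure lborel (B i) \<le> ennreal k * ennreal (diameter (C i) ^ (?n - 1))" for i
        using spec[OF B0, of i] by simp_all
      have "emeasure lborel F \<le> emeasure lborel (\<Union>i. B i)"
      proof (rule emeasure_mono_AE)
        show "AE y in lborel. y \<in> F \<longrightarrow> y \<in> (\<Union>i. B i)"
          using AE
        proof eventually_elim
          fix y assume "y \<in> F \<longrightarrow> y \<noteq> 0 \<and> y \<in> cball 0 1 \<and> x0 + s *\<^sub>R sgn y \<in> E"
          then show "y \<in> F \<longrightarrow> y \<in> (\<Union>i. B i)" using C(1) B(2) by blast
        qed
      qed (use B in auto)
      also have "\<dots> \<le> (\<Sum>i. emeasure lborel (B i))"
        using B by (intro emeasure_subadditive_countably) auto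
      also have "\<dots> \<le> (\<Sum>i. ennreal k * ennreal (diameter (C i) ^ (?n - 1)))"
        by (intro suminf_le B) auto
      also have "\<dots> = ennreal k * (\<Sum>i. ennreal (diameter (C i) ^ (?n - 1)))"
        by simp
      finally have "ennreal (1 / k) * emeasure lborel F \<le> ennreal (1 / k) * (ennreal k * (\<Sum>i. ennreal (diameter (C i) ^ (?n - 1))))"
        by (rule mult_left_mono) simp
      also have "\<dots> = (\<Sum>i. ennreal (diameter (C i) ^ (?n - 1)))"
        using k by (simp add: mult.assoc[symmetric] ennreal_mult[symmetric])
      finally show "ennreal (1 / k) * emeasure lborel F \<le> (\<Sum>i. ennreal (diameter (C i) ^ (?n - 1)))" .
    qed
    also have "\<dots> \<le> hausdorff_outer (?n - 1) E" by (rule hausdorff_content_le_outer) simp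
    finally have "ennreal k * (ennreal (1 / k) * emeasure lborel F) \<le> ennreal k * hausdorff_outer (?n - 1) E"
      by (rule mult_left_mono) simp
    then show "emeasure lborel F \<le> ennreal k * hausdorff_outer (?n - 1) E"
      using k by (simp add: mult.assoc[symmetric] ennreal_mult[symmetric])
  qed
qed

text \<open>The two integrands live on different measure spaces. What is compared are the
  distributions of their values, two measures on the extended half-line, by applying the set
  inequality to preimages of Borel sets.\<close>

lemma nn_integral_directions_le_hausdorff:
  fixes x0 :: "'a::euclidean_space" and q g :: "'a \<Rightarrow> ennreal"
  assumes n2: "DIM('a) \<ge> 2" and s: "s > 0" and q[measurable]: "q \<in> borel_measurable borel"
    and g: "g \<in> borel_measurable (hausdorff_measure (DIM('a) - 1))"
    and AE: "AE y in lborel. y \<in> cball 0 1 \<longrightarrow> q y = g (x0 + s *\<^sub>R sgn y)"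
    and fin: "(\<integral>\<^sup>+ x. g x \<partial>hausdorff_measure (DIM('a) - 1)) < \<infinity>"
  shows "(\<integral>\<^sup>+ y. indicator (cball 0 1) y * q y \<partial>lborel) < \<infinity>"
proof -
  let ?H = "hausdorff_measure (DIM('a) - 1) :: 'a measure"
  obtain k where k: "k > 0" "\<And>F E. F \<in> sets lborel \<Longrightarrow>
     (AE y in lborel. y \<in> F \<longrightarrow> y \<noteq> 0 \<and> y \<in> cball 0 1 \<and> x0 + s *\<^sub>R sgn y \<in> E) \<Longrightarrow>
     emeasure lborel F \<le> ennreal k * hausdorff_outer (DIM('a) - 1) E"
    using emeasure_directions_le_hausdorff[OF n2 s] by blast
  define M1 where "M1 = distr (density lborel (indicator (cball (0::'a) 1))) borel q"
  define M2 where "M2 = scale_measure (ennreal k) (distr ?H borel g)"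
  have "M1 \<le> M2"
  proof (subst le_measure)
    show "sets M1 = sets M2" by (simp add: M1_def M2_def)
    show "\<forall>B\<in>sets M1. emeasure M1 B \<le> emeasure M2 B"
    proof
      fix B assume "B \<in> sets M1"
      then have B[measurable]: "B \<in> sets borel" by (simp add: M1_def)
      define F where "F = {y \<in> space borel. y \<in> cball 0 1 \<and> q y \<in> B}"
      have F: "F \<in> sets borel" unfolding F_def by measurable
      define E where "E = g -` B"
      have sp: "space ?H = UNIV" by (simp add: hausdorff_measure_def space_measure_of_conv)
      have E: "E \<in> sets ?H" using measurable_sets[OF g B] unfolding sp by (simp add: E_def)
      have "emeasure M1 B = (\<integral>\<^sup>+ y. indicator (cball 0 1) y * indicator (q -` B) y \<partial>lborel)"
        unfolding M1_def using measurable_sets_borel[OF q B] by (subst emeasure_distr) (auto simp: emeasure_density)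
      also have "\<dots> = (\<integral>\<^sup>+ y. indicator F y \<partial>lborel)"
        by (intro nn_integral_cong) (auto simp: F_def indicator_def)
      also have "\<dots> = emeasure lborel F" using F by simp
      also have "\<dots> \<le> ennreal k * hausdorff_outer (DIM('a) - 1) E"
      proof (rule k(2))
        show "AE y in lborel. y \<in> F \<longrightarrow> y \<noteq> 0 \<and> y \<in> cball 0 1 \<and> x0 + s *\<^sub>R sgn y \<in> E"
          using AE AE_lborel_singleton[of 0]
          by eventually_elim (auto simp: F_def E_def)
      qed (use F in simp)
      also have "\<dots> = ennreal k * emeasure ?H E"
        using n2 E by (subst emeasure_hausdorff_measure) auto
      also have "\<dots> = emeasure M2 B"
        unfolding M2_def E_def using g B sp by (simp add: emeasure_distr)
      finally show "emeasure M1 B \<le> emeasure M2 B" .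
    qed
  qed
  have "(\<integral>\<^sup>+ y. indicator (cball 0 1) y * q y \<partial>lborel) = (\<integral>\<^sup>+ x. x \<partial>M1)"
    unfolding M1_def by (subst nn_integral_distr) (auto simp: nn_integral_density)
  also have "\<dots> \<le> (\<integral>\<^sup>+ x. x \<partial>M2)"
    by (rule nn_integral_mono_measure) (use \<open>M1 \<le> M2\<close> in \<open>auto simp: M1_def M2_def\<close>)
  also have "\<dots> = ennreal k * (\<integral>\<^sup>+ x. g x \<partial>?H)"
    unfolding M2_def using g by (simp add: nn_integral_scale_measure nn_integral_distr)
  also have "\<dots> < \<infinity>" using fin by (simp add: ennreal_mult_less_top)
  finally show ?thesis .
qed

section \<open>Upper bounds for the modulus from the ring inequality\<close>

lemma sup_dist_greater:
  assumes "open D" "cball x r \<subseteq> D" "0 \<le> r"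
  shows "ereal r < sup_dist D (x :: 'a::euclidean_space)"
proof -
  obtain b where b: "b \<in> (Basis::'a set)" using nonempty_Basis by blast
  have "x + r *\<^sub>R b \<in> D" using assms b by (auto simp: subset_iff dist_norm)
  then obtain e where e: "e > 0" "cball (x + r *\<^sub>R b) e \<subseteq> D" using assms(1) open_contains_cball by blast
  have "x + (r + e) *\<^sub>R b \<in> cball (x + r *\<^sub>R b) e"
    using e(1) b by (simp add: dist_norm algebra_simps)
  then have "x + (r + e) *\<^sub>R b \<in> D" using e by blast
  then have "ereal (dist (x + (r + e) *\<^sub>R b) x) \<le> sup_dist D x" unfolding sup_dist_def by (rule SUP_upper)
  moreover have "dist (x + (r + e) *\<^sub>R b) x = r + e" using e assms b by (simp add: dist_norm)
  ultimately show ?thesis using e(1) by (metis ereal_less_eq(3) less_add_same_cancel1 less_eq_ereal_def less_ereal.simps(1) order_less_le_trans)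
qed

lemma nn_integral_polar_at:
  fixes x0 :: "'a::euclidean_space"
  assumes [measurable]: "q \<in> borel_measurable borel" "\<eta> \<in> borel_measurable borel"
  shows "(\<integral>\<^sup>+ x. q x * \<eta> (dist x x0) \<partial>lborel) = of_nat DIM('a) *
     (\<integral>\<^sup>+ s. \<eta> s * ennreal (s ^ (DIM('a) - 1)) * indicator {0<..} s
        * (\<integral>\<^sup>+ y. indicator (cball 0 1) y * q (x0 + s *\<^sub>R sgn y) \<partial>lborel) \<partial>lborel)"
proof -
  let ?n = "DIM('a)"
  let ?G = "\<lambda>y s. q (x0 + s *\<^sub>R sgn y) * \<eta> (norm (s *\<^sub>R sgn y)) * ennreal (s ^ (?n - 1)) * indicator {0<..} s"
  let ?F = "\<lambda>s y. indicator (cball 0 1) y * (q (x0 + s *\<^sub>R sgn y) * \<eta> s * ennreal (s ^ (?n - 1)) * indicator {0<..} s)"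
  have "(\<integral>\<^sup>+ x. q x * \<eta> (dist x x0) \<partial>lborel) = (\<integral>\<^sup>+ x. q (x0 + x) * \<eta> (norm x) \<partial>lborel)"
    using nn_integral_lborel_scale[of "\<lambda>x. q x * \<eta> (dist x x0)" 1 x0] by (simp add: dist_norm)
  also have "\<dots> = of_nat ?n * (\<integral>\<^sup>+ y. indicator (cball 0 1) y *
       (\<integral>\<^sup>+ s. ?G y s \<partial>lborel) \<partial>lborel)"
    by (rule nn_integral_polar) measurable
  also have "(\<integral>\<^sup>+ y. indicator (cball 0 1) y *
       (\<integral>\<^sup>+ s. ?G y s \<partial>lborel) \<partial>lborel)
     = (\<integral>\<^sup>+ y. \<integral>\<^sup>+ s. ?F s y \<partial>lborel \<partial>lborel)"
  proof (rule nn_integral_cong_AE, rule eventually_mono[OF AE_lborel_singleton[of 0]])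
    fix y :: 'a assume "y \<noteq> 0"
    have "(\<integral>\<^sup>+ s. ?G y s \<partial>lborel)
      = (\<integral>\<^sup>+ s. q (x0 + s *\<^sub>R sgn y) * \<eta> s * ennreal (s ^ (?n - 1)) * indicator {0<..} s \<partial>lborel)"
      using \<open>y \<noteq> 0\<close> by (intro nn_integral_cong) (auto simp: indicator_def norm_sgn)
    then show "indicator (cball 0 1) y *
       (\<integral>\<^sup>+ s. ?G y s \<partial>lborel)
       = (\<integral>\<^sup>+ s. ?F s y \<partial>lborel)" by (simp only:) (intro nn_integral_cmult[symmetric], measurable)
  qed
  also have "\<dots> = (\<integral>\<^sup>+ s. \<integral>\<^sup>+ y. ?F s y \<partial>lborel \<partial>lborel)" by (intro lborel_pair.Fubini') measurable
  also have "\<dots> = (\<integral>\<^sup>+ s. \<integral>\<^sup>+ y. \<eta> s * ennreal (s ^ (?n - 1)) * indicator {0<..} s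
        * (indicator (cball 0 1) y * q (x0 + s *\<^sub>R sgn y)) \<partial>lborel \<partial>lborel)"
    by (simp only: ac_simps)
  also have "\<dots> = (\<integral>\<^sup>+ s. \<eta> s * ennreal (s ^ (?n - 1)) * indicator {0<..} s
        * (\<integral>\<^sup>+ y. indicator (cball 0 1) y * q (x0 + s *\<^sub>R sgn y) \<partial>lborel) \<partial>lborel)"
    by (intro nn_integral_cong nn_integral_cmult) measurable
  finally show ?thesis .
qed

text \<open>\<open>Q\<close> is only Lebesgue measurable, and the polar formula is applied to a
  Borel representative. This lemma makes the exceptional null set invisible on almost every
  sphere.\<close>

lemma AE_polar_null:
  fixes N :: "'a::euclidean_space set"
  assumes N: "N \<in> null_sets lborel"
  shows "AE s in lborel. s > 0 \<longrightarrow> (AE y in lborel. y \<in> cball 0 1 \<longrightarrow> x0 + s *\<^sub>R sgn y \<notin> N)"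
proof -
  have [measurable]: "N \<in> sets borel" using N by auto
  let ?m = "\<lambda>s. \<integral>\<^sup>+ y. indicator (cball 0 1) y * indicator N (x0 + s *\<^sub>R sgn y) \<partial>lborel"
  have "0 = (\<integral>\<^sup>+ x. indicator N x * 1 \<partial>lborel)" using N by auto
  also have "\<dots> = of_nat DIM('a) * (\<integral>\<^sup>+ s. 1 * ennreal (s ^ (DIM('a) - 1)) * indicator {0<..} s * ?m s \<partial>lborel)"
    by (rule nn_integral_polar_at[of "indicator N" "\<lambda>_. 1"]) measurable
  finally have "(\<integral>\<^sup>+ s. 1 * ennreal (s ^ (DIM('a) - 1)) * indicator {0<..} s * ?m s \<partial>lborel) = 0" by simp
  then have "AE s in lborel. 1 * ennreal (s ^ (DIM('a) - 1)) * indicator {0<..} s * ?m s = 0"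
    by (subst (asm) nn_integral_0_iff_AE) measurable
  then show ?thesis
  proof eventually_elim
    fix s assume *: "1 * ennreal (s ^ (DIM('a) - 1)) * indicator {0<..} s * ?m s = 0"
    show "s > 0 \<longrightarrow> (AE y in lborel. y \<in> cball 0 1 \<longrightarrow> x0 + s *\<^sub>R sgn y \<notin> N)"
    proof
      assume "s > 0"
      then have "?m s = 0" using * by simp
      then have "AE y in lborel. indicator (cball 0 1) y * indicator N (x0 + s *\<^sub>R sgn y) = (0::ennreal)"
        by (subst (asm) nn_integral_0_iff_AE) measurable
      then show "AE y in lborel. y \<in> cball 0 1 \<longrightarrow> x0 + s *\<^sub>R sgn y \<notin> N"
        by eventually_elim (auto simp: indicator_def split: if_splits)
    qed
  qed
qed

text \<open>The test function \<open>\<eta>\<close> is the normalised indicator of a set of radii on which the spherical means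
  of \<open>Q\<close> are bounded; such a set of positive length exists by the integrability over spheres.\<close>
lemma sphere_integrable_modulus_bound:
  fixes D :: "'a::euclidean_space set"
  assumes n2: "DIM('a) \<ge> 2" and D: "open D" and Q: "Q \<in> borel_measurable (lebesgue_on D)"
    and sph: "sphere_integrable D Q" and x0: "x0 \<in> D" and r: "0 < r1" "r1 < r2" "ereal r2 < sup_dist D x0"
  obtains M where "0 \<le> M" "\<And>f. ring_Q_ineq f D Q x0 (sup_dist D x0) \<Longrightarrow>
     modulus (ring_image f D x0 r1 r2) \<le> ennreal M"
proof -
  let ?n = "DIM('a)"
  define Qd where "Qd x = Q x * indicator D x" for x
  have Qd: "Qd \<in> borel_measurable (completion lborel)"
    using Q D unfolding Qd_def by (subst (asm) borel_measurable_restrict_space_iff_ennreal) auto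
  obtain q where q[measurable]: "q \<in> borel_measurable borel" and "AE x in lborel. Qd x = q x"
    using completion_ex_borel_measurable[OF Qd] by auto
  then obtain N where N: "N \<in> null_sets lborel" "{x \<in> space lborel. Qd x \<noteq> q x} \<subseteq> N" by (auto elim!: AE_E simp: null_sets_def)
  have Neq: "Qd x = q x" if "x \<notin> N" for x using N(2) that by auto
  define m where "m s = (\<integral>\<^sup>+ y. indicator (cball 0 1) y * q (x0 + s *\<^sub>R sgn y) \<partial>lborel)" for s :: real
  have mm[measurable]: "m \<in> borel_measurable borel" unfolding m_def[abs_def] by measurable
  obtain E where E: "E \<subseteq> {r1..r2}" "E \<in> sets lebesgue" "emeasure lebesgue E > 0"
     "\<And>s. s \<in> E \<Longrightarrow> (\<lambda>x. Q x * indicator (sphere x0 s \<inter> D) x) \<in> borel_measurable (hausdorff_measure (?n - 1))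
        \<and> (\<integral>\<^sup>+ x. Q x * indicator (sphere x0 s \<inter> D) x \<partial>hausdorff_measure (?n - 1)) < \<infinity>"
    using sph x0 r unfolding sphere_integrable_def by meson
  have mfin: "AE s in lborel. s \<in> E \<longrightarrow> m s < \<infinity>"
    using AE_polar_null[OF N(1), of x0]
  proof eventually_elim
    fix s assume *: "s > 0 \<longrightarrow> (AE y in lborel. y \<in> cball 0 1 \<longrightarrow> x0 + s *\<^sub>R sgn y \<notin> N)"
    show "s \<in> E \<longrightarrow> m s < \<infinity>"
    proof
      assume s: "s \<in> E"
      then have s0: "s > 0" using E(1) r by auto
      have [measurable]: "(\<lambda>y. q (x0 + s *\<^sub>R sgn y)) \<in> borel_measurable borel" by measurable
      show "m s < \<infinity>"
        unfolding m_def
      proof (rule nn_integral_directions_le_hausdorff[OF n2 s0 _ conjunct1[OF E(4)[OF s]] _ conjunct2[OF E(4)[OF s]]])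
        have "AE y in lborel. y \<in> cball 0 1 \<longrightarrow> x0 + s *\<^sub>R sgn y \<notin> N" using * s0 by simp
        then show "AE y in lborel. y \<in> cball 0 1 \<longrightarrow> q (x0 + s *\<^sub>R sgn y) =
            Q (x0 + s *\<^sub>R sgn y) * indicator (sphere x0 s \<inter> D) (x0 + s *\<^sub>R sgn y)"
          using AE_lborel_singleton[of 0]
        proof eventually_elim
          fix y :: 'a assume y: "y \<in> cball 0 1 \<longrightarrow> x0 + s *\<^sub>R sgn y \<notin> N" "y \<noteq> 0"
          have "x0 + s *\<^sub>R sgn y \<in> sphere x0 s" using s0 y(2) by (simp add: dist_norm norm_sgn)
          then show "y \<in> cball 0 1 \<longrightarrow> q (x0 + s *\<^sub>R sgn y) =
            Q (x0 + s *\<^sub>R sgn y) * indicator (sphere x0 s \<inter> D) (x0 + s *\<^sub>R sgn y)"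
            using y(1) Neq[of "x0 + s *\<^sub>R sgn y"] unfolding Qd_def by (auto simp: indicator_def)
        qed
      qed measurable
    qed
  qed
  \<comment> \<open>\<open>m\<close> is finite almost everywhere on \<open>E\<close> but may be
    unbounded there, and \<open>E\<close> may fail to be Borel. The Borel sublevel sets of
    \<open>m\<close> cover almost all of \<open>E\<close>, so one of them has positive
    length.\<close>
  define G where "G k = {s \<in> space borel. r1 < s \<and> s < r2 \<and> m s \<le> of_nat k}" for k :: nat
  have G[measurable]: "G k \<in> sets borel" for k unfolding G_def by measurable
  have "\<exists>k. emeasure lborel (G k) > 0"
  proof (rule ccontr)
    assume "\<not> ?thesis"
    then have "G k \<in> null_sets lborel" for k using G by (auto simp: null_sets_def)
    then have "AE s in lborel. \<forall>k. s \<notin> G k" by (subst AE_all_countable) (auto intro: AE_not_in)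
    then have "AE s in lborel. s \<notin> E"
      using mfin AE_lborel_singleton[of r1] AE_lborel_singleton[of r2]
    proof eventually_elim
      fix s assume *: "\<forall>k. s \<notin> G k" "s \<in> E \<longrightarrow> m s < \<infinity>" "s \<noteq> r1" "s \<noteq> r2"
      show "s \<notin> E"
      proof
        assume s: "s \<in> E"
        then have "m s < top" using * by simp
        then obtain k :: nat where "m s < of_nat k" using ennreal_Ex_less_of_nat by blast
        then have "s \<in> G k" using s E(1) *(3,4) by (auto simp: G_def less_imp_le order.order_iff_strict)
        then show False using * by blast
      qed
    qed
    then have "AE s in lebesgue. s \<notin> E" by (rule AE_completion)
    then have "emeasure lebesgue E = 0" using E(2) AE_iff_null_sets[of E lebesgue] by auto
    then show False using E(3) by simp
  qed
  then obtain k where k: "emeasure lborel (G k) > 0" by blast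
  have "emeasure lborel (G k) \<le> emeasure lborel {r1..r2}" by (rule emeasure_mono) (auto simp: G_def)
  then have "emeasure lborel (G k) < \<infinity>" using r by (simp add: le_less_trans[OF _ ennreal_less_top])
  then obtain l where l: "emeasure lborel (G k) = ennreal l" "l > 0" using k
    by (cases "emeasure lborel (G k)") auto
  define \<eta> where "\<eta> s = ennreal (1 / l) * indicator (G k) s" for s :: real
  have \<eta>[measurable]: "\<eta> \<in> borel_measurable borel" unfolding \<eta>_def[abs_def] by measurable
  define B where "B = (\<integral>\<^sup>+ x. q x * \<eta> (dist x x0) ^ ?n \<partial>lborel)"
  have "B = of_nat ?n * (\<integral>\<^sup>+ s. \<eta> s ^ ?n * ennreal (s ^ (?n - 1)) * indicator {0<..} s * m s \<partial>lborel)"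
    unfolding B_def m_def by (rule nn_integral_polar_at[of q "\<lambda>s. \<eta> s ^ ?n"]) measurable
  also have "\<dots> \<le> of_nat ?n * (\<integral>\<^sup>+ s. ennreal ((1 / l) ^ ?n) * ennreal (r2 ^ (?n - 1)) * of_nat k * indicator {r1..r2} s \<partial>lborel)"
  proof (intro mult_left_mono nn_integral_mono)
    fix s :: real
    show "\<eta> s ^ ?n * ennreal (s ^ (?n - 1)) * indicator {0<..} s * m s
      \<le> ennreal ((1 / l) ^ ?n) * ennreal (r2 ^ (?n - 1)) * of_nat k * indicator {r1..r2} s"
    proof (cases "s \<in> G k")
      case True
      then have s: "r1 < s" "s < r2" "m s \<le> of_nat k" by (auto simp: G_def)
      have "ennreal (s ^ (?n - 1)) \<le> ennreal (r2 ^ (?n - 1))" using s r by (intro ennreal_leI power_mono) auto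
      moreover have "\<eta> s ^ ?n = ennreal ((1 / l) ^ ?n)" using True l by (simp add: \<eta>_def ennreal_power)
      ultimately show ?thesis using s r by (simp add: mult_mono)
    qed (simp add: \<eta>_def power_0_left)
  qed simp
  also have "\<dots> < \<infinity>"
    using r by (subst nn_integral_cmult) (auto simp: ennreal_mult_less_top ennreal_of_nat_eq_real_of_nat)
  finally have "B < \<infinity>" .
  then obtain M where M: "B = ennreal M" "0 \<le> M" by (cases B) auto
  show ?thesis
  proof (rule that[OF M(2)])
    fix f assume f: "ring_Q_ineq f D Q x0 (sup_dist D x0)"
    have "(\<integral>\<^sup>+ s. \<eta> s * indicator {r1<..<r2} s \<partial>lebesgue) = (\<integral>\<^sup>+ s. ennreal (1 / l) * indicator (G k) s \<partial>lborel)"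
      unfolding nn_integral_completion by (intro nn_integral_cong) (auto simp: \<eta>_def G_def indicator_def)
    also have "\<dots> = ennreal (1 / l) * ennreal l" by (subst nn_integral_cmult_indicator) (auto simp: l)
    also have "\<dots> = 1" using l by (simp add: ennreal_mult[symmetric])
    finally have "1 \<le> (\<integral>\<^sup>+ s. \<eta> s * indicator {r1<..<r2} s \<partial>lebesgue)" by simp
    moreover have "\<eta> \<in> borel_measurable lebesgue" using \<eta> by (simp add: measurable_completion)
    ultimately have "modulus (ring_image f D x0 r1 r2)
      \<le> (\<integral>\<^sup>+ x. Q x * \<eta> (dist x x0) ^ ?n * indicator ({x. r1 < dist x x0 \<and> dist x x0 < r2} \<inter> D) x \<partial>lebesgue)"
      using f r unfolding ring_Q_ineq_def by blast
    also have "\<dots> \<le> B"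
      unfolding nn_integral_completion B_def
    proof (rule nn_integral_mono_AE)
      have "AE x in lborel. Qd x = q x" by fact
      then show "AE x in lborel. Q x * \<eta> (dist x x0) ^ ?n * indicator ({x. r1 < dist x x0 \<and> dist x x0 < r2} \<inter> D) x
          \<le> q x * \<eta> (dist x x0) ^ ?n"
        by eventually_elim (auto simp: Qd_def indicator_def)
    qed
    finally show "modulus (ring_image f D x0 r1 r2) \<le> ennreal M"
      by (simp add: M)
  qed
qed

text \<open>The constant test function \<open>1 / (r2 - r1)\<close> makes the dependence on the
  width of the ring explicit, which is where the power of \<open>norm (x - y)\<close> in part (2)
  originates.\<close>

lemma integrable_modulus_bound:
  fixes D :: "'a::euclidean_space set"
  assumes D: "open D" and Q: "Q \<in> borel_measurable (lebesgue_on D)"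
    and r: "0 < r1" "r1 < r2" "ereal r2 < sup_dist D x0" and f: "ring_Q_ineq f D Q x0 (sup_dist D x0)"
  shows "modulus (ring_image f D x0 r1 r2)
    \<le> ennreal ((1 / (r2 - r1)) ^ DIM('a)) * (\<integral>\<^sup>+ x\<in>D. Q x \<partial>lebesgue)"
proof -
  let ?n = "DIM('a)"
  have Qd: "(\<lambda>x. Q x * indicator D x) \<in> borel_measurable lebesgue"
    using Q D by (subst (asm) borel_measurable_restrict_space_iff_ennreal) auto
  have "(\<integral>\<^sup>+ s. ennreal (1 / (r2 - r1)) * indicator {r1<..<r2} s \<partial>lebesgue) = ennreal (1 / (r2 - r1)) * ennreal (r2 - r1)"
    using r by (subst nn_integral_cmult_indicator) auto
  also have "\<dots> = 1" using r by (simp add: ennreal_mult[symmetric])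
  finally have "1 \<le> (\<integral>\<^sup>+ s. (\<lambda>_. ennreal (1 / (r2 - r1))) s * indicator {r1<..<r2} s \<partial>lebesgue)" by simp
  then have "modulus (ring_image f D x0 r1 r2)
      \<le> (\<integral>\<^sup>+ x. Q x * (\<lambda>_. ennreal (1 / (r2 - r1))) (dist x x0) ^ ?n
           * indicator ({x. r1 < dist x x0 \<and> dist x x0 < r2} \<inter> D) x \<partial>lebesgue)"
    using f r unfolding ring_Q_ineq_def by (intro f[unfolded ring_Q_ineq_def, rule_format]) simp
  also have "\<dots> \<le> (\<integral>\<^sup>+ x. ennreal ((1 / (r2 - r1)) ^ ?n) * (Q x * indicator D x) \<partial>lebesgue)"
    using r by (intro nn_integral_mono) (auto simp: indicator_def ennreal_power mult.commute)
  also have "\<dots> = ennreal ((1 / (r2 - r1)) ^ ?n) * (\<integral>\<^sup>+ x\<in>D. Q x \<partial>lebesgue)"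
    using Qd by (rule nn_integral_cmult)
  finally show ?thesis .
qed

section \<open>Distortion of the family\<close>

lemma chordal_diam_le:
  assumes "E \<noteq> {}" "\<And>p q. p \<in> E \<Longrightarrow> q \<in> E \<Longrightarrow> chordal p q \<le> c"
  shows "chordal_diam E \<le> c"
  unfolding chordal_diam_def using assms by (intro cSUP_least) auto

lemma chordal_le_diam:
  assumes "p \<in> E" "q \<in> E" shows "chordal p q \<le> chordal_diam E"
proof -
  have 1: "bdd_above ((\<lambda>q. chordal p q) ` E)" for p using chordal_le_1 by (auto intro!: bdd_aboveI[of _ 1])
  have "(SUP q\<in>E. chordal p' q) \<le> 1" for p' using assms chordal_le_1 by (intro cSUP_least) auto
  then have 2: "bdd_above ((\<lambda>p. SUP q\<in>E. chordal p q) ` E)" by (auto intro!: bdd_aboveI[of _ 1])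
  have "chordal p q \<le> (SUP q\<in>E. chordal p q)" using assms(2) 1 by (rule cSUP_upper)
  also have "\<dots> \<le> chordal_diam E" unfolding chordal_diam_def using assms(1) 2 by (rule cSUP_upper)
  finally show ?thesis .
qed

text \<open>\<open>u\<close> and \<open>r0\<close> are the data of
  \<open>chordal_compact_omits_finite_point\<close>. Being parameters, they are common to all
  members: one inversion serves the whole family.\<close>

locale ring_Q_family =
  fixes D A :: "'a::euclidean_space set" and K :: "'a option set" and Q :: "'a \<Rightarrow> ennreal" and \<delta> :: real
    and u :: 'a and r0 :: real
  assumes n2: "DIM('a) \<ge> 2" and openD: "open D" and connD: "connected D"
    and A: "A \<subseteq> D" "compact A" "connected A" "A \<noteq> {}"
    and r0: "r0 > 0" and omitted: "\<And>y. y \<in> K \<Longrightarrow> r0 \<le> chordal y (Some u)"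
    and \<delta>: "\<delta> > 0" and Q: "Q \<in> borel_measurable (lebesgue_on D)" and sph: "sphere_integrable D Q"
begin

abbreviation "\<F> \<equiv> classB \<delta> K A Q D"

lemma F_omitting: "f \<in> \<F> \<Longrightarrow> omitting_homeo D f u r0"
  unfolding omitting_homeo_def classB_def using n2 openD r0 omitted by blast

lemma F_inj: "f \<in> \<F> \<Longrightarrow> inj_on f D"
  by (simp add: classB_def homeomorphism_into_def)

lemma F_far: "f \<in> \<F> \<Longrightarrow> x \<in> D \<Longrightarrow> r0 \<le> chordal (Some u) (f x)"
  using omitted[of "f x"] by (subst chordal_commute) (auto simp: classB_def)

lemma F_ring: "f \<in> \<F> \<Longrightarrow> x \<in> D \<Longrightarrow> ring_Q_ineq f D Q x (sup_dist D x)"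
  by (simp add: classB_def)

lemma modulus_bound:
  assumes "cball z r2 \<subseteq> D" "0 < r1" "r1 < r2"
  obtains M where "0 \<le> M" "\<And>f. f \<in> \<F> \<Longrightarrow>
     modulus (ring_image f D z r1 r2) \<le> ennreal M"
proof -
  have z: "z \<in> D" using assms by auto
  show thesis
    by (rule sphere_integrable_modulus_bound[OF n2 openD Q sph z assms(2,3) sup_dist_greater[OF openD assms(1)]])
       (use assms that F_ring[OF _ z] in auto)
qed

text \<open>The balls on which a hypothetical degenerating sequence becomes uniformly constant have an open and
  relatively closed union, which would contain \<open>A\<close>.\<close>
lemma images_of_balls_nondegenerate:
  assumes x: "cball x r \<subseteq> D" "r > 0"
  shows "\<exists>d>0. \<forall>f\<in>\<F>. \<exists>a\<in>cball x r. d \<le> chordal (f a) (f x)"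
proof (rule ccontr)
  assume neg: "\<not> ?thesis"
  have xD: "x \<in> D" using x by auto
  have "\<exists>f\<in>\<F>. \<forall>a\<in>cball x r. chordal (f a) (f x) < 1 / real (Suc m)" for m
    using neg by (metis not_le of_nat_0_less_iff zero_less_Suc zero_less_divide_1_iff)
  then obtain F where F: "\<And>m. F m \<in> \<F>" "\<And>m a. a \<in> cball x r \<Longrightarrow> chordal (F m a) (F m x) < 1 / real (Suc m)"
    by metis
  \<comment> \<open>Smallness refers to the moving point \<open>F m x\<close> instead of a limit, so
    no convergent subsequence has to be selected.\<close>
  define small where "small z \<rho> \<longleftrightarrow> (\<forall>\<epsilon>>0. \<forall>\<^sub>F m in sequentially. \<forall>a\<in>cball z \<rho>. chordal (F m a) (F m x) < \<epsilon>)" for z \<rho>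
  have small_subset: "small z' \<rho>'" if "small z \<rho>" "cball z' \<rho>' \<subseteq> cball z \<rho>" for z z' \<rho> \<rho>'
    unfolding small_def
  proof (intro allI impI)
    fix \<epsilon> :: real assume "\<epsilon> > 0"
    then have "\<forall>\<^sub>F m in sequentially. \<forall>a\<in>cball z \<rho>. chordal (F m a) (F m x) < \<epsilon>" using that by (simp add: small_def)
    then show "\<forall>\<^sub>F m in sequentially. \<forall>a\<in>cball z' \<rho>'. chordal (F m a) (F m x) < \<epsilon>"
      by (rule eventually_mono) (use that(2) in blast)
  qed
  define G where "G = {z. \<exists>\<rho>>0. cball z \<rho> \<subseteq> D \<and> small z \<rho>}"
  have GD: "G \<subseteq> D" by (auto simp: G_def subset_iff)
  have "small x r"
    unfolding small_def
  proof (intro allI impI)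
    fix \<epsilon> :: real assume "\<epsilon> > 0"
    have "\<forall>\<^sub>F m in sequentially. 1 / real (Suc m) < \<epsilon>"
      using order_tendstoD(2)[OF LIMSEQ_Suc[OF lim_1_over_n] \<open>\<epsilon> > 0\<close>] by simp
    then show "\<forall>\<^sub>F m in sequentially. \<forall>a\<in>cball x r. chordal (F m a) (F m x) < \<epsilon>"
      by (rule eventually_mono) (use F(2) in \<open>meson less_trans\<close>)
  qed
  then have "x \<in> G" using x by (auto simp: G_def)
  have "open G"
    unfolding open_contains_ball
  proof
    fix z assume "z \<in> G"
    then obtain \<rho> where \<rho>: "\<rho> > 0" "cball z \<rho> \<subseteq> D" "small z \<rho>" by (auto simp: G_def)
    have "ball z (\<rho> / 2) \<subseteq> G"
    proof
      fix y assume "y \<in> ball z (\<rho> / 2)"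
      then have "cball y (\<rho> / 2) \<subseteq> cball z \<rho>" by (intro cball_subset_cball_iff[THEN iffD2]) (auto simp: dist_commute)
      then show "y \<in> G" using \<rho> small_subset[OF \<rho>(3)] unfolding G_def by (intro CollectI exI[of _ "\<rho> / 2"]) auto
    qed
    then show "\<exists>e>0. ball z e \<subseteq> G" using \<rho> by (intro exI[of _ "\<rho> / 2"]) auto
  qed
  have closed: "z \<in> G" if z: "z \<in> D" "z \<in> closure G" for z
  proof -
    obtain R0 where R0: "R0 > 0" "cball z R0 \<subseteq> D" using z(1) openD open_contains_cball by blast
    define R where "R = R0 / 3"
    have R: "R > 0" "cball z (3 * R) \<subseteq> D" using R0 by (auto simp: R_def)
    obtain z' where z': "z' \<in> G" "dist z' z < R" using z(2) R closure_approachable by blast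
    show ?thesis
    proof (cases "z' = z")
      case False
      define d where "d = dist z' z"
      have d: "d > 0" "d < R" using False z' by (auto simp: d_def)
      obtain \<rho>0 where \<rho>0: "\<rho>0 > 0" "small z' \<rho>0" using z'(1) by (auto simp: G_def)
      define \<rho> where "\<rho> = min \<rho>0 R"
      have "small z' \<rho>" by (rule small_subset[OF \<rho>0(2)]) (auto simp: \<rho>_def)
      then have \<rho>: "\<rho> > 0" "\<rho> \<le> R" "small z' \<rho>" using \<rho>0(1) R(1) by (auto simp: \<rho>_def)
      define r2 where "r2 = d + \<rho> / 2"
      have r2: "d < r2" "cball z r2 \<subseteq> D" using d \<rho> R by (auto simp: r2_def intro: order_trans[OF _ R(2)])
      \<comment> \<open>\<open>b\<close> lies on the ray from \<open>z\<close> through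
        \<open>z'\<close>, beyond the outer radius \<open>d + \<rho> / 2\<close> but within \<rho>
        of \<open>z'\<close>. Hence the image of the ball of radius \<open>d\<close>, through
        \<open>z'\<close>, and the complement of the image of the larger ball, through
        \<open>b\<close>, both come close to \<open>F m x\<close>.\<close>
      define b where "b = z' + (3 / 4 * \<rho> / d) *\<^sub>R (z' - z)"
      have "dist b z' = 3 / 4 * \<rho>" using d \<rho> by (simp add: b_def dist_norm d_def)
      have "b - z = (1 + 3 / 4 * \<rho> / d) *\<^sub>R (z' - z)" by (simp add: b_def algebra_simps)
      then have "dist b z = \<bar>1 + 3 / 4 * \<rho> / d\<bar> * d" by (simp only: dist_norm norm_scaleR d_def)
      also have "\<dots> = d + 3 / 4 * \<rho>" using d \<rho> by (simp add: algebra_simps)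
      finally have bz: "dist b z = d + 3 / 4 * \<rho>" .
      have bD: "b \<in> D" using R(2) bz d \<rho> by (auto simp: subset_iff dist_commute)
      have bin: "b \<in> cball z' \<rho>" using \<open>dist b z' = _\<close> \<rho> by (simp add: dist_commute)
      have z'in: "z' \<in> cball z' \<rho>" using \<rho> by simp
      obtain M where M: "0 \<le> M" "\<And>f. f \<in> \<F> \<Longrightarrow>
          modulus (ring_image f D z d r2) \<le> ennreal M"
        using modulus_bound[OF r2(2) d(1) r2(1)] by blast
      have "small z d"
        unfolding small_def
      proof (intro allI impI)
        fix \<epsilon> :: real assume \<epsilon>: "\<epsilon> > 0"
        \<comment> \<open>Besides the point \<open>a\<close> also the omitted point \<open>u\<close>
          must be far from \<open>F m x\<close>, and for \<open>u\<close> only the distance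
          \<open>r0\<close> is guaranteed.\<close>
        define T where "T = min \<epsilon> r0"
        have T: "T > 0" using \<epsilon> r0 by (simp add: T_def)
        \<comment> \<open>Half the lower bound that \<open>chordal_modulus_estimate\<close> imposes
          at level \<open>T\<close>, so that smallness below \<open>s\<close> contradicts
          it.\<close>
        define s where "s = T / 64 * exp (- (2 * M / loewner_const TYPE('a))) / 2"
        have s: "s > 0" using T by (simp add: s_def)
        have "\<forall>\<^sub>F m in sequentially. \<forall>a\<in>cball z' \<rho>. chordal (F m a) (F m x) < s"
          using \<rho>(3) s by (simp add: small_def)
        then show "\<forall>\<^sub>F m in sequentially. \<forall>a\<in>cball z d. chordal (F m a) (F m x) < \<epsilon>"
        proof (rule eventually_mono, intro ballI)
          fix m a assume H: "\<forall>a\<in>cball z' \<rho>. chordal (F m a) (F m x) < s" and a: "a \<in> cball z d"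
          show "chordal (F m a) (F m x) < \<epsilon>"
          proof (rule ccontr)
            assume "\<not> chordal (F m a) (F m x) < \<epsilon>"
            then have "T \<le> chordal (F m a) (F m x)" by (simp add: T_def)
            moreover have "T \<le> chordal (Some u) (F m x)" using F_far[OF F(1) xD, of m] by (simp add: T_def)
            moreover have "F m b \<notin> F m ` cball z r2"
            proof
              assume "F m b \<in> F m ` cball z r2"
              then have "b \<in> cball z r2" using inj_on_image_mem_iff[OF F_inj[OF F(1)] bD r2(2)] by simp
              then show False using bz \<rho> by (simp add: r2_def dist_commute)
            qed
            moreover have "chordal (F m z') (F m x) \<le> s" "chordal (F m b) (F m x) \<le> s"
              using H z'in bin by (auto intro: less_imp_le)
            moreover have "z' \<in> cball z d" by (simp add: d_def dist_commute)
            ultimately have "T / 64 * exp (- (2 * M / loewner_const TYPE('a))) \<le> s"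
              using omitting_homeo.chordal_modulus_estimate[OF F_omitting[OF F(1)] r2(2) d(1) r2(1) _ a _ _ _ _ _ s T M(1) M(2)[OF F(1)]] by blast
            then show False using s unfolding s_def by simp
          qed
        qed
      qed
      then show ?thesis using d r2 unfolding G_def by (intro CollectI exI[of _ d]) (auto intro: order_trans[OF _ r2(2)])
    qed (use z' in simp)
  qed
  have "closedin (top_of_set D) G"
    unfolding closedin_closed using closed GD closure_subset[of G] by (intro exI[of _ "closure G"]) auto
  moreover have "openin (top_of_set D) G" using \<open>open G\<close> GD openin_open_eq[OF openD] by auto
  ultimately have "G = D" using connD \<open>x \<in> G\<close> unfolding connected_clopen by blast
  have "\<exists>\<rho>. \<rho> > 0 \<and> small a \<rho>" if "a \<in> A" for a using that A(1) \<open>G = D\<close> by (auto simp: G_def)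
  then obtain \<rho> where \<rho>: "\<And>a. a \<in> A \<Longrightarrow> \<rho> a > 0 \<and> small a (\<rho> a)" by metis
  have "A \<subseteq> (\<Union>a\<in>A. ball a (\<rho> a))" using \<rho> by force
  then obtain B where B: "B \<subseteq> A" "finite B" "A \<subseteq> (\<Union>a\<in>B. ball a (\<rho> a))"
    using compactE_image[OF A(2), of A "\<lambda>a. ball a (\<rho> a)"] by auto
  \<comment> \<open>With one third of \<delta> the diameter of the image of \<open>A\<close> is at
    most two thirds of \<delta>, a strict contradiction.\<close>
  have "\<forall>\<^sub>F m in sequentially. \<forall>a\<in>B. \<forall>y\<in>cball a (\<rho> a). chordal (F m y) (F m x) < \<delta> / 3"
  proof (rule eventually_ball_finite[OF B(2)], rule ballI)
    fix a assume "a \<in> B"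
    then have "small a (\<rho> a)" using \<rho> B(1) by blast
    then show "\<forall>\<^sub>F m in sequentially. \<forall>y\<in>cball a (\<rho> a). chordal (F m y) (F m x) < \<delta> / 3"
      unfolding small_def using \<delta> by (meson divide_pos_pos zero_less_numeral)
  qed
  then obtain m where m: "\<forall>a\<in>B. \<forall>y\<in>cball a (\<rho> a). chordal (F m y) (F m x) < \<delta> / 3"
    using eventually_happens'[OF sequentially_bot] by blast
  have near: "chordal (F m y) (F m x) < \<delta> / 3" if "y \<in> A" for y using that B(3) m by fastforce
  have "chordal_diam (F m ` A) \<le> 2 * \<delta> / 3"
  proof (rule chordal_diam_le)
    fix p q assume "p \<in> F m ` A" "q \<in> F m ` A"
    then have "chordal p (F m x) < \<delta> / 3" "chordal q (F m x) < \<delta> / 3" using near by auto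
    then show "chordal p q \<le> 2 * \<delta> / 3" using chordal_triangle[of p q "F m x"] chordal_commute[of "F m x" q] by linarith
  qed (use A in simp)
  moreover have "\<delta> \<le> chordal_diam (F m ` A)" using F(1)[of m] by (simp add: classB_def)
  ultimately show False using \<delta> by linarith
qed

text \<open>The contrapositive form covers two uses at once: for \<open>q\<close> a value of
  \<open>f\<close> it separates images of distant points, for general \<open>q\<close> it says that
  the image of the ball contains a chordal ball. The modulus estimate is applied about
  \<open>f y\<close> with the near points \<open>f y\<close> and \<open>q\<close>, on a ring about
  \<open>x\<close> that does not depend on \<open>y\<close>.\<close>

lemma local_openness:
  assumes x: "x \<in> D" and \<epsilon>: "\<epsilon> > 0"
  shows "\<exists>\<rho>>0. \<exists>s>0. \<forall>f\<in>\<F>. \<forall>y\<in>ball x \<rho> \<inter> D. \<forall>q. q \<notin> f ` (D \<inter> ball y \<epsilon>) \<longrightarrow> s \<le> chordal (f y) q"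
proof -
  obtain R where R: "R > 0" "cball x R \<subseteq> D" using x openD open_contains_cball by blast
  define r2 where "r2 = min R (\<epsilon> / 2)"
  define r1 where "r1 = r2 / 2"
  have r: "0 < r1" "r1 < r2" "cball x r2 \<subseteq> D" "r2 \<le> \<epsilon> / 2" using R \<epsilon> by (auto simp: r1_def r2_def subset_iff)
  have sub1: "cball x r1 \<subseteq> D" using r by (auto simp: subset_iff)
  obtain d where d: "d > 0" "\<And>f. f \<in> \<F> \<Longrightarrow> \<exists>a\<in>cball x r1. d \<le> chordal (f a) (f x)"
    using images_of_balls_nondegenerate[OF sub1 r(1)] by blast
  obtain M where M: "0 \<le> M" "\<And>f. f \<in> \<F> \<Longrightarrow>
      modulus (ring_image f D x r1 r2) \<le> ennreal M"
    using modulus_bound[OF r(3,1,2)] by blast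
  define T where "T = min (d / 2) r0"
  have T: "T > 0" using d r0 by (simp add: T_def)
  define s where "s = T / 64 * exp (- (2 * M / loewner_const TYPE('a))) / 2"
  have s: "s > 0" using T by (simp add: s_def)
  show ?thesis
  proof (rule exI[of _ r1], intro conjI r(1), rule exI[of _ s], intro conjI ballI allI impI s)
    fix f y q assume f: "f \<in> \<F>" and y: "y \<in> ball x r1 \<inter> D" and q: "q \<notin> f ` (D \<inter> ball y \<epsilon>)"
    have yx: "y \<in> cball x r1" "x \<in> cball x r1" using y r by auto
    obtain a where a: "a \<in> cball x r1" "d \<le> chordal (f a) (f x)" using d(2)[OF f] by blast
    \<comment> \<open>The far point is needed relative to \<open>f y\<close>, whereas nondegeneracy
      was obtained relative to \<open>f x\<close>; one of \<open>a\<close> and \<open>x\<close>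
      works at half the distance.\<close>
    have "\<exists>e\<in>cball x r1. d / 2 \<le> chordal (f e) (f y)"
    proof (cases "d / 2 \<le> chordal (f a) (f y)")
      case False
      then have "d / 2 \<le> chordal (f x) (f y)"
        using a chordal_triangle[of "f a" "f x" "f y"] chordal_commute[of "f x" "f y"] by linarith
      then show ?thesis using yx by blast
    qed (use a in blast)
    then obtain e where e: "e \<in> cball x r1" "d / 2 \<le> chordal (f e) (f y)" by blast
    have "cball x r2 \<subseteq> D \<inter> ball y \<epsilon>"
    proof
      fix v assume v: "v \<in> cball x r2"
      then have "dist y v \<le> dist x y + dist x v" using dist_triangle[of y v x] by (simp add: dist_commute)
      then show "v \<in> D \<inter> ball y \<epsilon>" using v y r by (auto simp: r1_def)
    qed
    then have q': "q \<notin> f ` cball x r2" using q by blast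
    show "s \<le> chordal (f y) q"
    proof (rule ccontr)
      assume "\<not> s \<le> chordal (f y) q"
      then have n: "chordal q (f y) \<le> s" by (simp add: chordal_commute)
      have "T / 64 * exp (- (2 * M / loewner_const TYPE('a))) \<le> s"
      proof (rule omitting_homeo.chordal_modulus_estimate[OF F_omitting[OF f] r(3,1,2) yx(1) e(1) q' _ n _ _ s T M(1) M(2)[OF f]])
        show "chordal (f y) (f y) \<le> s" using s by simp
        show "T \<le> chordal (f e) (f y)" using e by (simp add: T_def)
        show "T \<le> chordal (Some u) (f y)" using F_far[OF f, of y] y by (auto simp: T_def)
      qed
      then show False using s unfolding s_def by simp
    qed
  qed
qed

lemma uniform_openness:
  assumes K1: "compact K1" "K1 \<subseteq> D" and \<epsilon>: "\<epsilon> > 0"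
  shows "\<exists>s>0. \<forall>f\<in>\<F>. \<forall>y\<in>K1. \<forall>q. q \<notin> f ` (D \<inter> ball y \<epsilon>) \<longrightarrow> s \<le> chordal (f y) q"
proof -
  have "\<exists>\<rho> s. \<rho> > 0 \<and> s > 0 \<and> (\<forall>f\<in>\<F>. \<forall>y\<in>ball x \<rho> \<inter> D. \<forall>q. q \<notin> f ` (D \<inter> ball y \<epsilon>) \<longrightarrow> s \<le> chordal (f y) q)"
    if "x \<in> K1" for x
    using local_openness[OF _ \<epsilon>, of x] that K1 by blast
  then obtain \<rho> s where \<rho>: "\<And>x. x \<in> K1 \<Longrightarrow> \<rho> x > 0 \<and> s x > 0 \<and>
     (\<forall>f\<in>\<F>. \<forall>y\<in>ball x (\<rho> x) \<inter> D. \<forall>q. q \<notin> f ` (D \<inter> ball y \<epsilon>) \<longrightarrow> s x \<le> chordal (f y) q)" by metis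
  have "K1 \<subseteq> (\<Union>x\<in>K1. ball x (\<rho> x))" using \<rho> by force
  then obtain B where B: "B \<subseteq> K1" "finite B" "K1 \<subseteq> (\<Union>x\<in>B. ball x (\<rho> x))"
    using compactE_image[OF K1(1), of K1 "\<lambda>x. ball x (\<rho> x)"] by auto
  define t where "t = Min (insert 1 (s ` B))"
  have t: "t > 0" unfolding t_def using B \<rho> by (subst Min_gr_iff) auto
  have ts: "t \<le> s x" if "x \<in> B" for x unfolding t_def using B that by (intro Min_le) auto
  show ?thesis
  proof (intro exI[of _ t] conjI ballI allI impI t)
    fix f y q assume f: "f \<in> \<F>" and y: "y \<in> K1" and q: "q \<notin> f ` (D \<inter> ball y \<epsilon>)"
    obtain x where x: "x \<in> B" "y \<in> ball x (\<rho> x)" using B y by blast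
    then have "s x \<le> chordal (f y) q" using \<rho>[of x] B f y q K1 by blast
    then show "t \<le> chordal (f y) q" using ts[OF x(1)] by linarith
  qed
qed

text \<open>Chordal distance is at most Euclidean distance, so \<open>y\<close> lies outside the
  Euclidean ball \<open>ball x e\<close>, and by injectivity \<open>f y\<close> lies outside its
  image.\<close>

lemma equi_uniform_compact:
  assumes K1: "compact K1" "K1 \<subseteq> D"
  shows "equi_uniform \<F> K1"
  unfolding equi_uniform_def
proof (intro allI impI)
  fix e :: real assume "0 < e"
  obtain s where s: "s > 0" "\<And>f y q. f \<in> \<F> \<Longrightarrow> y \<in> K1 \<Longrightarrow> q \<notin> f ` (D \<inter> ball y e) \<Longrightarrow> s \<le> chordal (f y) q"
    using uniform_openness[OF K1 \<open>0 < e\<close>] by blast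
  show "\<exists>d>0. \<forall>f\<in>\<F>. \<forall>x\<in>K1. \<forall>y\<in>K1. e \<le> chordal (Some x) (Some y) \<longrightarrow> d \<le> chordal (f x) (f y)"
  proof (intro exI[of _ s] conjI ballI impI s)
    fix f x y assume f: "f \<in> \<F>" and xy: "x \<in> K1" "y \<in> K1" and e: "e \<le> chordal (Some x) (Some y)"
    have "e \<le> dist x y" using e chordal_le_dist[of x y] by linarith
    moreover have "f y \<in> f ` (D \<inter> ball x e) \<longleftrightarrow> y \<in> D \<inter> ball x e"
      using xy K1 by (intro inj_on_image_mem_iff[OF F_inj[OF f]]) auto
    ultimately show "f y \<notin> f ` (D \<inter> ball x e)" by auto
  qed
qed

lemma uniformly_light_compact:
  assumes K1: "compact K1" "K1 \<subseteq> D"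
  shows "uniformly_light \<F> K1"
  unfolding uniformly_light_def
proof (intro allI impI)
  fix e :: real assume e: "0 < e"
  then obtain d where d: "d > 0" "\<And>f x y. f \<in> \<F> \<Longrightarrow> x \<in> K1 \<Longrightarrow> y \<in> K1 \<Longrightarrow>
      e / 2 \<le> chordal (Some x) (Some y) \<Longrightarrow> d \<le> chordal (f x) (f y)"
    using equi_uniform_compact[OF K1] unfolding equi_uniform_def by (metis half_gt_zero)
  show "\<exists>d>0. \<forall>f\<in>\<F>. \<forall>C. C \<subseteq> K1 \<and> C \<noteq> {} \<and> compact C \<and> connected C \<and> e \<le> chordal_diam (Some ` C)
      \<longrightarrow> d \<le> chordal_diam (f ` C)"
  proof (intro exI[of _ d] conjI ballI allI impI d)
    fix f C assume f: "f \<in> \<F>" and C: "C \<subseteq> K1 \<and> C \<noteq> {} \<and> compact C \<and> connected C \<and> e \<le> chordal_diam (Some ` C)"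
    \<comment> \<open>Passing from \<open>e\<close> to \<open>e / 2\<close> avoids discussing
      whether the supremum in the diameter is attained.\<close>
    have "\<exists>x\<in>C. \<exists>y\<in>C. e / 2 \<le> chordal (Some x) (Some y)"
    proof (rule ccontr)
      assume "\<not> ?thesis"
      then have "chordal_diam (Some ` C) \<le> e / 2" using C by (intro chordal_diam_le) (auto simp: not_le less_imp_le)
      then show False using C e by linarith
    qed
    then obtain x y where xy: "x \<in> C" "y \<in> C" "e / 2 \<le> chordal (Some x) (Some y)" by blast
    then have "d \<le> chordal (f x) (f y)" using d(2)[OF f] C by blast
    also have "\<dots> \<le> chordal_diam (f ` C)" using xy by (intro chordal_le_diam) auto
    finally show "d \<le> chordal_diam (f ` C)" .
  qed
qed

lemma uniformly_open_compact:
  assumes K1: "compact K1" "K1 \<subseteq> D"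
  shows "uniformly_open \<F> K1"
  unfolding uniformly_open_def
proof (intro allI impI)
  fix e :: real assume e: "0 < e"
  obtain s where s: "s > 0" "\<And>f y q. f \<in> \<F> \<Longrightarrow> y \<in> K1 \<Longrightarrow> q \<notin> f ` (D \<inter> ball y e) \<Longrightarrow> s \<le> chordal (f y) q"
    using uniform_openness[OF K1 e] by blast
  show "\<exists>r0>0. \<forall>f\<in>\<F>. \<forall>x0. ball x0 e \<subseteq> K1 \<longrightarrow> chordal_ball (f x0) r0 \<subseteq> f ` ball x0 e"
  proof (intro exI[of _ s] conjI ballI allI impI subsetI s(1))
    fix f x0 q assume f: "f \<in> \<F>" and b: "ball x0 e \<subseteq> K1" and q: "q \<in> chordal_ball (f x0) s"
    have "x0 \<in> K1" using b e by auto
    then have "q \<in> f ` (D \<inter> ball x0 e)" using s(2)[OF f, of x0 q] q by (force simp: chordal_ball_def chordal_commute)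
    then show "q \<in> f ` ball x0 e" by blast
  qed
qed

text \<open>For each pair the ring is centred at a point \<open>z\<close> beyond \<open>x\<close> on
  the line from \<open>y\<close> through \<open>x\<close>: \<open>x\<close> lies on the inner sphere
  and \<open>y\<close> outside the outer one, at a width comparable to \<open>norm (x - y)\<close>.
  The near points are \<open>f x\<close> and \<open>f y\<close>, the far one is \<open>f z\<close>.
  Pairs with \<open>x = y\<close> must be excluded, since division by 0 gives 0 and the exponential
  would be 1.\<close>

lemma integrable_lower_bound:
  assumes K1: "compact K1" "K1 \<subseteq> D" and int: "(\<integral>\<^sup>+ z\<in>D. Q z \<partial>lebesgue) < \<infinity>"
    and finite_valued: "\<And>f x. f \<in> \<F> \<Longrightarrow> x \<in> D \<Longrightarrow> f x \<noteq> None"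
  shows "\<exists>C>0. \<exists>C1>0. \<forall>f\<in>\<F>. \<forall>x\<in>K1. \<forall>y\<in>K1. x \<noteq> y \<longrightarrow>
     norm (the (f x) - the (f y))
       \<ge> C1 * exp (- enn2real (\<integral>\<^sup>+ z\<in>D. Q z \<partial>lebesgue) / (C * norm (x - y) ^ DIM('a)))"
proof -
  define I where "I = enn2real (\<integral>\<^sup>+ z\<in>D. Q z \<partial>lebesgue)"
  have I: "(\<integral>\<^sup>+ z\<in>D. Q z \<partial>lebesgue) = ennreal I" "0 \<le> I" using int by (auto simp: I_def less_top)
  obtain R0 where R0: "R0 > 0" "(\<Union>x\<in>K1. cball x R0) \<subseteq> D"
    using compact_subset_open_imp_cball_epsilon_subset[OF K1(1) openD K1(2)] by blast
  define R where "R = R0 / 3"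
  have R: "R > 0" and RD: "\<And>x. x \<in> K1 \<Longrightarrow> cball x (3 * R) \<subseteq> D" using R0 by (auto simp: R_def)
  \<comment> \<open>The centres \<open>z\<close> range over this compact neighbourhood of
    \<open>K1\<close>, on which openness at the fixed scale \<open>R\<close> is uniform.\<close>
  define K2 where "K2 = {x + v | x v. x \<in> K1 \<and> v \<in> cball 0 R}"
  have K2c: "compact K2" unfolding K2_def by (intro compact_sums K1 compact_cball)
  have K2D: "K2 \<subseteq> D"
  proof
    fix z assume "z \<in> K2"
    then obtain x v where "x \<in> K1" "norm v \<le> R" "z = x + v" by (auto simp: K2_def)
    then show "z \<in> D" using RD[of x] R by (auto simp: subset_iff dist_norm)
  qed
  obtain s0 where s0: "s0 > 0" "\<And>f y q. f \<in> \<F> \<Longrightarrow> y \<in> K2 \<Longrightarrow> q \<notin> f ` (D \<inter> ball y R) \<Longrightarrow> s0 \<le> chordal (f y) q"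
    using uniform_openness[OF K2c K2D R] by blast
  obtain B where B: "B > 0" "\<And>x y. x \<in> K1 \<Longrightarrow> y \<in> K1 \<Longrightarrow> dist x y \<le> B"
  proof -
    obtain b where b: "\<And>x. x \<in> K1 \<Longrightarrow> norm x \<le> b" "b > 0" using compact_imp_bounded[OF K1(1)] bounded_pos by metis
    have "dist x y \<le> 2 * b" if "x \<in> K1" "y \<in> K1" for x y
      using norm_triangle_ineq4[of x y] b(1)[OF that(1)] b(1)[OF that(2)] by (simp add: dist_norm)
    then show thesis using that[of "2 * b"] \<open>b > 0\<close> by simp
  qed
  \<comment> \<open>\<open>l \<le> R / B\<close> keeps the outer radius below \<open>2 R\<close> for
    every pair, so that the ball stays in \<open>D\<close>; \<open>l < 1\<close> leaves
    \<open>y\<close> outside it.\<close>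
  define l where "l = min (1 / 2) (R / B)"
  have l: "l > 0" "l < 1" "l \<le> R / B" using R B by (auto simp: l_def)
  define T where "T = min s0 r0"
  have T: "T > 0" using s0 r0 by (simp add: T_def)
  \<comment> \<open>Chosen so that \<open>2 * M / loewner_const\<close> becomes
    \<open>I / (C * d ^ DIM('a))\<close> for the modulus bound
    \<open>M = I / (l * d) ^ DIM('a)\<close>.\<close>
  define C where "C = loewner_const TYPE('a) * l ^ DIM('a) / 2"
  have C: "C > 0" using loewner_const_pos[OF n2] l by (simp add: C_def)
  have main: "T / 64 * exp (- I / (C * norm (x - y) ^ DIM('a))) \<le> norm (the (f x) - the (f y))"
    if f: "f \<in> \<F>" and xy: "x \<in> K1" "y \<in> K1" "x \<noteq> y" for f x y
  proof -
    define d where "d = norm (x - y)"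
    have d: "d > 0" "d \<le> B" using xy B by (auto simp: d_def dist_norm[symmetric])
    define z where "z = x + (R / d) *\<^sub>R (x - y)"
    have zx: "dist z x = R" using d R by (simp add: z_def dist_norm d_def[symmetric])
    have "z - y = (1 + R / d) *\<^sub>R (x - y)" by (simp add: z_def algebra_simps)
    then have "dist z y = \<bar>1 + R / d\<bar> * d" by (simp only: dist_norm norm_scaleR d_def)
    also have "\<dots> = R + d" using d R by (simp add: algebra_simps)
    finally have zy: "dist z y = R + d" .
    define r2 where "r2 = R + l * d"
    have "l * d \<le> R / B * B" using l d R B by (intro mult_mono) auto
    then have r2: "R < r2" "r2 \<le> 2 * R" using l d B by (auto simp: r2_def)
    have sub: "cball z r2 \<subseteq> D"
    proof
      fix v assume "v \<in> cball z r2"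
      then have "dist x v \<le> 3 * R" using dist_triangle[of x v z] zx r2 by (simp add: dist_commute)
      then show "v \<in> D" using RD[OF xy(1)] by auto
    qed
    have "z = x + (z - x)" "z - x \<in> cball 0 R" using zx by (auto simp: dist_norm norm_minus_commute)
    then have zK2: "z \<in> K2" unfolding K2_def using xy(1) by blast
    have xD: "x \<in> D" "y \<in> D" "z \<in> D" using xy K1 zK2 K2D by auto
    have qn: "f y \<notin> f ` cball z r2"
    proof
      assume "f y \<in> f ` cball z r2"
      then have "y \<in> cball z r2" using inj_on_image_mem_iff[OF F_inj[OF f] xD(2) sub] by simp
      moreover have "l * d < 1 * d" using l d by (intro mult_strict_right_mono) auto
      ultimately show False using zy by (simp add: r2_def)
    qed
    \<comment> \<open>\<open>x\<close> is at distance exactly \<open>R\<close> from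
      \<open>z\<close>, just outside the open ball, so uniform openness at \<open>z\<close> keeps
      \<open>f z\<close> away from \<open>f x\<close>.\<close>
    have "f x \<notin> f ` (D \<inter> ball z R)"
      using inj_on_image_mem_iff[OF F_inj[OF f] xD(1), of "D \<inter> ball z R"] zx by auto
    then have e1: "s0 \<le> chordal (f z) (f x)" by (rule s0(2)[OF f zK2])
    define M where "M = (1 / (l * d)) ^ DIM('a) * I"
    have M: "0 \<le> M" using l d I by (simp add: M_def)
    have mod: "modulus (ring_image f D z R r2) \<le> ennreal M"
      using integrable_modulus_bound[OF openD Q R r2(1) sup_dist_greater[OF openD sub] F_ring[OF f xD(3)]] r2 R l d I
      by (simp add: M_def r2_def ennreal_mult)
    have pos: "chordal (f x) (f y) > 0"
      using chordal_eq_0_iff[of "f x" "f y"] chordal_nonneg[of "f x" "f y"] F_inj[OF f] xD xy(3)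
      by (metis inj_on_eq_iff less_eq_real_def)
    have "T / 64 * exp (- (2 * M / loewner_const TYPE('a))) \<le> chordal (f x) (f y)"
    proof (rule omitting_homeo.chordal_modulus_estimate[OF F_omitting[OF f] sub R r2(1) _ _ qn _ _ _ _ pos T M mod])
      show "x \<in> cball z R" using zx by simp
      show "z \<in> cball z R" using R by simp
      show "chordal (f x) (f x) \<le> chordal (f x) (f y)" using pos by simp
      show "chordal (f y) (f x) \<le> chordal (f x) (f y)" by (simp add: chordal_commute)
      show "T \<le> chordal (f z) (f x)" using e1 by (simp add: T_def)
      show "T \<le> chordal (Some u) (f x)" using F_far[OF f xD(1)] by (simp add: T_def)
    qed
    also have "chordal (f x) (f y) \<le> norm (the (f x) - the (f y))"
    proof -
      obtain v w where "f x = Some v" "f y = Some w" using finite_valued[OF f] xD by blast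
      then show ?thesis using chordal_le_dist[of v w] by (simp add: dist_norm)
    qed
    also have "2 * M / loewner_const TYPE('a) = I / (C * d ^ DIM('a))"
      using l d loewner_const_pos[OF n2] by (simp add: M_def C_def power_divide power_mult_distrib ac_simps)
    finally show ?thesis by (simp add: d_def)
  qed
  show ?thesis
    unfolding I_def[symmetric]
  proof (rule exI[of _ C], intro conjI C, rule exI[of _ "T / 64"], intro conjI ballI impI)
    show "0 < T / 64" using T by simp
  qed (rule main)
qed

end

theorem theorem6:
  fixes D A :: "'a::euclidean_space set"
    and K :: "'a option set"
    and Q :: "'a \<Rightarrow> ennreal"
    and \<delta> :: real
  assumes n2: "DIM('a) \<ge> 2"
    and domain: "open D" "connected D" "D \<noteq> {}"
    and continuum: "A \<subseteq> D" "compact A" "connected A" "\<exists>a\<in>A. \<exists>b\<in>A. a \<noteq> b"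
    and Kcomp: "chordal_compact K" "K \<noteq> UNIV"
    and delta: "\<delta> > 0"
    and Qmeas: "Q \<in> borel_measurable (lebesgue_on D)"
    and Qsph: "sphere_integrable D Q"
  shows "(bounded D \<longrightarrow> (\<forall>K1. compact K1 \<and> K1 \<subseteq> D \<longrightarrow>
              equi_uniform (classB \<delta> K A Q D) K1
            \<and> uniformly_light (classB \<delta> K A Q D) K1
            \<and> uniformly_open (classB \<delta> K A Q D) K1))
       \<and> ((\<integral>\<^sup>+ x\<in>D. Q x \<partial>lebesgue) < \<infinity>
          \<and> (\<forall>f\<in>classB \<delta> K A Q D. \<forall>x\<in>D. f x \<noteq> None)
          \<longrightarrow> (\<forall>K1. compact K1 \<and> K1 \<subseteq> D \<longrightarrow>
                (\<exists>C>0. \<exists>C1>0. \<forall>f\<in>classB \<delta> K A Q D. \<forall>x\<in>K1. \<forall>y\<in>K1. x \<noteq> y \<longrightarrow>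
                   norm (the (f x) - the (f y))
                     \<ge> C1 * exp (- enn2real (\<integral>\<^sup>+ z\<in>D. Q z \<partial>lebesgue) / (C * norm (x - y) ^ DIM('a))))))"
proof -
  obtain u r0 where u: "r0 > 0" "\<And>y. y \<in> K \<Longrightarrow> r0 \<le> chordal y (Some u)"
    using chordal_compact_omits_finite_point[OF Kcomp] by blast
  have "A \<noteq> {}" using continuum by blast
  then interpret ring_Q_family D A K Q \<delta> u r0
    by (intro ring_Q_family.intro assms u)
  show ?thesis
  proof (intro conjI impI allI)
    fix K1 assume "compact K1 \<and> K1 \<subseteq> D"
    then have K1: "compact K1" "K1 \<subseteq> D" by auto
    show "equi_uniform (classB \<delta> K A Q D) K1" "uniformly_light (classB \<delta> K A Q D) K1"
        "uniformly_open (classB \<delta> K A Q D) K1"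
      using K1 by (rule equi_uniform_compact uniformly_light_compact uniformly_open_compact)+
  next
    fix K1
    assume H: "(\<integral>\<^sup>+ x\<in>D. Q x \<partial>lebesgue) < \<infinity> \<and> (\<forall>f\<in>classB \<delta> K A Q D. \<forall>x\<in>D. f x \<noteq> None)"
      and K1: "compact K1 \<and> K1 \<subseteq> D"
    show "\<exists>C>0. \<exists>C1>0. \<forall>f\<in>classB \<delta> K A Q D. \<forall>x\<in>K1. \<forall>y\<in>K1. x \<noteq> y \<longrightarrow>
        norm (the (f x) - the (f y))
          \<ge> C1 * exp (- enn2real (\<integral>\<^sup>+ z\<in>D. Q z \<partial>lebesgue) / (C * norm (x - y) ^ DIM('a)))"
      by (rule integrable_lower_bound[OF conjunct1[OF K1] conjunct2[OF K1] conjunct1[OF H]])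
         (use conjunct2[OF H] in blast)
  qed
qed

end
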